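(* For any integer $b\ge2$, there exists $c=c(b)>0$ such that for all $a,d,\lambda\in\mathbb Z$ with $\lambda\ge2$ and $$2\le d\le\exp\Bigl(\frac{c\,\lambda}{\log\lambda}\Bigr),$$ we have for any real $t\in[b^{\lambda-1},b^\lambda]$, $$\overleftarrow{\pi}_\lambda(t,a,d)=\frac{\Pi_d(b)}{d}\,\overleftarrow{\pi}_\lambda\bigl(t,a,\Pi_d(b)\bigr)+O\Bigl(b^\lambda\exp\Bigl(-\frac{c\,\lambda}{\log d}\Bigr)\Bigr),$$ where $$\Pi_d(b)=\gcd(d,b^2-1)\prod_{\substack{p\mid b\\ p\text{ prime}}}p^{v_p(d)}.$$ In particular, if $\gcd(d,b(b^2-1))=1$ then $$\overleftarrow{\pi}_\lambda(t,a,d)=\frac{\pi_\lambda(t)}{d}+O\Bigl(b^\lambda\exp\Bigl(-\frac{c\,\lambda}{\log d}\Bigr)\Bigr).$$ The implicit constants depend at most on $b$.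
   Context: For integers $b\ge2$ and $n\ge 0$ write $n=\sum_{j\ge 0}\varepsilon_j(n)b^j$ with $\varepsilon_j(n)\in\{0,\dots,b-1\}$ (base-$b$ digits), and for $\lambda\ge 0$ set $R_\lambda(n)=\sum_{j=0}^{\lambda-1}\varepsilon_j(n)\,b^{\lambda-1-j}$. With $p$ denoting primes, $\pi_\lambda(t)=|\{p: b^{\lambda-1}\le p<t\}|$ and, for an integer $a$ and an integer $d\ge1$, $\overleftarrow{\pi}_\lambda(t,a,d)=|\{p: b^{\lambda-1}\le p<t,\ R_\lambda(p)\equiv a \bmod d\}|$. $v_p(d)$ is the $p$-adic valuation of $d$. *)

theory Defs
  imports Complex_Main "HOL-Number_Theory.Number_Theory"
begin

definition digit :: "nat \<Rightarrow> nat \<Rightarrow> nat \<Rightarrow> nat" where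
  "digit b j n = (n div b ^ j) mod b"

text \<open>Reversal of the \<open>l\<close> lowest base-\<open>b\<close> digits. Only \<open>j < l\<close> occurs, so the natural number
  subtraction in the exponent never truncates.\<close>

definition digit_reverse :: "nat \<Rightarrow> nat \<Rightarrow> nat \<Rightarrow> nat" where
  "digit_reverse b l n = (\<Sum>j<l. digit b j n * b ^ (l - 1 - j))"

definition prime_count :: "nat \<Rightarrow> nat \<Rightarrow> real \<Rightarrow> nat" where
  "prime_count b l t = card {p :: nat. prime p \<and> b ^ (l - 1) \<le> p \<and> real p < t}"

definition reverse_prime_count :: "nat \<Rightarrow> nat \<Rightarrow> real \<Rightarrow> int \<Rightarrow> nat \<Rightarrow> nat" where
  "reverse_prime_count b l t a d =
     card {p :: nat. prime p \<and> b ^ (l - 1) \<le> p \<and> real p < t \<and>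
                     [int (digit_reverse b l p) = a] (mod (int d))}"

definition Pi_mod :: "nat \<Rightarrow> nat \<Rightarrow> nat" where
  "Pi_mod b d = gcd d (b\<^sup>2 - 1) * (\<Prod>p | prime p \<and> p dvd b. p ^ multiplicity p d)"

end

theory Submission
  imports Defs "HOL-Computational_Algebra.Squarefree"
begin

text \<open>
  A residue class of the reversal is detected by additive characters. The count modulo \<open>d\<close> is thus
  an average over \<open>h < d\<close> of sums over primes of \<open>e(h R(p) / d)\<close>. The frequencies \<open>h\<close> divisible by
  \<open>d / Pi_mod b d\<close> reproduce the main term exactly. For every other \<open>h\<close>, no \<open>h (b\<^sup>2 - 1) b^i\<close> is
  divisible by \<open>d\<close>, and then the sum over primes is \<open>O(l^K b^l exp(- c l / ln d))\<close>
  (\<open>norm_sum_primes_reversal_le\<close>). In the permitted range \<open>l / ln d\<close> is at least a constant times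
  \<open>ln l\<close>, so all powers of \<open>l\<close> are absorbed by lowering \<open>c\<close>; logarithms and divisor counts are
  therefore treated generously throughout.

  The function \<open>e(\<alpha> R(n))\<close> is a product over the digits of \<open>n\<close>, so its Fourier transform is a product
  of one-digit kernels. Three properties of this transform carry the proof. It decays uniformly,
  because two neighbouring kernels close to one would force \<open>\<alpha> (b\<^sup>2 - 1) b^i\<close> to be close to an
  integer, and multiplication by \<open>b\<close> expands that distance to constant size within \<open>O(ln d)\<close> digits
  (\<open>norm_digital_transform_reversal_le\<close>). It satisfies Parseval's identity on any block of digits
  (\<open>parseval_digital\<close>). And it is never flat, whatever the phases are, so that the energy of pairs of
  frequencies congruent modulo \<open>g\<close> is exponentially smaller than the Cauchy-Schwarz bound, unless
  a high power of \<open>b\<close> divides \<open>g\<close> (\<open>class_energy_le\<close>). The last property holds for all \<open>b \<ge> 2\<close>; for \<open>b = 2\<close> it takes two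
  consecutive digits.

  Primes are reached through an elementary identity. Pairing the divisors of \<open>n\<close> by its least prime
  factor turns the truncated sum of the Moebius function over divisors \<open>d \<le> D\<close> into a sum over
  divisors \<open>m\<close> just above \<open>D\<close> (\<open>sum_moebius_cut\<close>), and this yields the prime indicator as a sum over
  small divisors and a bilinear sum with bounded coefficients in which \<open>m\<close> never exceeds the square
  root of \<open>b^l\<close>.

  For the small divisors \<open>d\<close>, two disjoint blocks of digits are square-summable over the fractions
  with denominator \<open>d\<close>, and the other digits supply the decay
  (\<open>sum_digital_transform_fractions_le\<close>). For the bilinear sum, the Cauchy-Schwarz inequality and
  short blocks of the long variable lead to correlations of \<open>e(\<alpha> R(m k))\<close> and \<open>e(\<alpha> R(m (k + r)))\<close>.
  Up to rare carries only the low digits matter, and these are periodic modulo \<open>Q = b^L\<close>. Completing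
  the sum over \<open>m\<close> and summing over full periods of \<open>k\<close> leaves pairs of frequencies that are
  congruent modulo a divisor \<open>g\<close> of \<open>Q\<close>. If \<open>g\<close> is not divisible by a large power of \<open>b\<close>, the energy
  gap wins; otherwise the shift \<open>r\<close> leaves few classes modulo \<open>g\<close>, each of small mass by uniform decay
  (\<open>restricted_class_energy_le\<close>).
\<close>

section \<open>Additive characters\<close>

definition ee :: "real \<Rightarrow> complex" where
  "ee x = cis (2 * pi * x)"

lemma norm_ee [simp]: "norm (ee x) = 1"
  by (simp add: ee_def)

lemma ee_0 [simp]: "ee 0 = 1"
  by (simp add: ee_def)

lemma ee_nonzero [simp]: "ee x \<noteq> 0"
  by (simp add: ee_def)

lemma ee_add: "ee (x + y) = ee x * ee y"
  by (simp add: ee_def cis_mult algebra_simps)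

lemma ee_diff: "ee (x - y) = ee x / ee y"
  by (simp add: ee_def cis_divide algebra_simps)

lemma cnj_ee [simp]: "cnj (ee x) = ee (- x)"
  by (simp add: ee_def cis_cnj)

lemma ee_of_int [simp]: "ee (of_int k) = 1"
  unfolding ee_def by (rule cis_multiple_2pi) simp

lemma ee_of_nat [simp]: "ee (of_nat k) = 1"
  using ee_of_int[of "int k"] by simp

lemma ee_add_of_int [simp]: "ee (x + of_int k) = ee x"
  by (simp add: ee_add)

lemma ee_power: "ee x ^ n = ee (of_nat n * x)"
  by (simp add: ee_def DeMoivre algebra_simps)

lemma continuous_on_ee [continuous_intros]:
  "continuous_on A f \<Longrightarrow> continuous_on A (\<lambda>x. ee (f x))"
  unfolding ee_def by (intro continuous_intros)

lemma norm_one_minus_ee: "norm (1 - ee x) = 2 * \<bar>sin (pi * x)\<bar>"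
proof -
  have "(norm (1 - ee x))\<^sup>2 = (1 - cos (2 * pi * x))\<^sup>2 + (sin (2 * pi * x))\<^sup>2"
    by (simp add: ee_def cmod_power2)
  also have "\<dots> = 2 - 2 * cos (2 * (pi * x))"
    using sin_cos_squared_add3[of "2 * pi * x"] by (simp add: power2_eq_square algebra_simps)
  also have "\<dots> = (2 * \<bar>sin (pi * x)\<bar>)\<^sup>2"
    by (simp add: cos_double_sin power_mult_distrib)
  finally show ?thesis
    by (subst (asm) power2_eq_iff_nonneg) auto
qed

lemma norm_one_plus_ee: "norm (1 + ee x) = 2 * \<bar>cos (pi * x)\<bar>"
proof -
  have "1 + ee x = 1 - ee (x + 1 / 2)"
    by (simp add: ee_add) (simp add: ee_def)
  then have "norm (1 + ee x) = 2 * \<bar>sin (pi * (x + 1 / 2))\<bar>"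
    by (simp only: norm_one_minus_ee)
  also have "pi * (x + 1 / 2) = pi * x + pi / 2"
    by (simp add: algebra_simps)
  also have "sin (pi * x + pi / 2) = cos (pi * x)"
    by (simp add: sin_add)
  finally show ?thesis .
qed

text \<open>A linear lower bound on the quarter period, with any constant, makes the Fourier coefficients of
  intervals decay harmonically.\<close>

lemma sin_ge_half: "x / 2 \<le> sin x" if "0 \<le> x" "x \<le> pi / 2" for x :: real
proof -
  have "0 \<le> sin x - x * cos x" if "0 \<le> x" "x \<le> pi" for x :: real
  proof -
    have "sin 0 - 0 * cos 0 \<le> sin x - x * cos x"
    proof (rule DERIV_nonneg_imp_nondecreasing[OF that(1)])
      fix y assume "0 \<le> y" "y \<le> x"
      then have "((\<lambda>y. sin y - y * cos y) has_real_derivative y * sin y) (at y)"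
        by (auto intro!: derivative_eq_intros)
      moreover have "0 \<le> y * sin y"
        using that \<open>0 \<le> y\<close> \<open>y \<le> x\<close> by (intro mult_nonneg_nonneg sin_ge_zero) auto
      ultimately show "\<exists>z. ((\<lambda>y. sin y - y * cos y) has_real_derivative z) (at y) \<and> 0 \<le> z"
        by blast
    qed
    then show ?thesis by simp
  qed
  from this[of "x / 2"] have *: "x / 2 * cos (x / 2) \<le> sin (x / 2)"
    using that by simp
  have c: "cos (x / 2) \<ge> 0"
    using that by (intro cos_ge_zero) auto
  have "x * (cos (x / 2))\<^sup>2 \<le> sin x"
    using mult_right_mono[OF * c] sin_double[of "x / 2"] by (simp add: power2_eq_square)
  moreover have "(cos (x / 2))\<^sup>2 \<ge> 1 / 2"
  proof -
    have "cos x \<ge> 0"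
      using that by (intro cos_ge_zero) auto
    then show ?thesis
      using cos_double_cos[of "x / 2"] by simp
  qed
  ultimately show ?thesis
    using that mult_left_mono[of "1 / 2" "(cos (x / 2))\<^sup>2" x] by simp
qed

lemma norm_one_minus_ee_ge:
  assumes "0 < z" "z < Q"
  shows "norm (1 - ee (real z / real Q)) \<ge> 2 / (real Q * (1 / real z + 1 / real (Q - z)))"
proof -
  have gen: "norm (1 - ee (real w / real Q)) \<ge> 2 * real w / real Q" if "2 * w \<le> Q" for w :: nat
  proof -
    define y where "y = pi * (real w / real Q)"
    have "y / 2 \<le> sin y"
    proof (rule sin_ge_half)
      show "y \<le> pi / 2"
        using that assms by (simp add: y_def field_simps)
    qed (simp add: y_def)
    then have "y \<le> 2 * \<bar>sin y\<bar>"
      by linarith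
    then have "pi * (real w / real Q) \<le> norm (1 - ee (real w / real Q))"
      by (simp only: norm_one_minus_ee y_def)
    moreover have "2 * (real w / real Q) \<le> pi * (real w / real Q)"
      using pi_ge_two by (intro mult_right_mono) auto
    ultimately show ?thesis by simp
  qed
  have le: "2 / (real Q * (1 / real z + 1 / real (Q - z))) \<le> 2 * real w / real Q"
    if "w = z \<or> w = Q - z" for w
  proof -
    have "1 / real w \<le> 1 / real z + 1 / real (Q - z)"
      using that by auto
    moreover have "w > 0" using that assms by auto
    ultimately have "2 / (real Q * (1 / real z + 1 / real (Q - z))) \<le> 2 / (real Q * (1 / real w))"
      using assms by (intro divide_left_mono mult_left_mono mult_pos_pos) (auto intro!: add_pos_pos)
    then show ?thesis by simp
  qed
  show ?thesis
  proof (cases "2 * z \<le> Q")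
    case True
    then show ?thesis using gen[of z] le[of z] by linarith
  next
    case False
    have "norm (1 - ee (real z / real Q)) = norm (1 - ee (real (Q - z) / real Q))"
    proof -
      have "real (Q - z) / real Q = - (real z / real Q) + of_int 1"
        using assms by (simp add: of_nat_diff field_simps)
      then have "ee (real (Q - z) / real Q) = cnj (ee (real z / real Q))"
        by (metis cnj_ee ee_add_of_int)
      then have "1 - ee (real (Q - z) / real Q) = cnj (1 - ee (real z / real Q))"
        by simp
      then show ?thesis
        by (simp only: complex_mod_cnj)
    qed
    moreover have "2 * (Q - z) \<le> Q" using False by simp
    ultimately show ?thesis using gen[of "Q - z"] le[of "Q - z"] by linarith
  qed
qed

lemma norm_sum_ee_interval_le:
  "norm (1 - ee x) * norm (\<Sum>m\<in>{i..<j}. ee (real m * x)) \<le> 2" for i j :: nat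
proof (cases "i \<le> j")
  case True
  have "(1 - ee x) * (\<Sum>m\<in>{i..<j}. ee x ^ m) = ee x ^ i - ee x ^ j"
    using True
  proof (induction j rule: dec_induct)
    case (step n)
    then show ?case
      by (simp add: distrib_left) (simp add: algebra_simps)
  qed simp
  then have "norm (1 - ee x) * norm (\<Sum>m\<in>{i..<j}. ee (real m * x)) = norm (ee x ^ i - ee x ^ j)"
    by (simp add: ee_power flip: norm_mult)
  also have "\<dots> \<le> 1 + 1"
    by (rule norm_triangle_le_diff) (simp add: norm_power)
  finally show ?thesis by simp
qed simp

lemma sum_ee_orthogonality:
  assumes "Q > 0"
  shows "(\<Sum>z<Q. ee (real z * of_int x / real Q)) = (if int Q dvd x then of_nat Q else 0)"
proof (cases "int Q dvd x")
  case True
  then obtain y where "x = int Q * y" by (elim dvdE)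
  then have "ee (real z * of_int x / real Q) = ee (of_int (int z * y))" for z
    using assms by (simp add: field_simps)
  then have "ee (real z * of_int x / real Q) = 1" for z
    by (simp only: ee_of_int)
  then show ?thesis using True by simp
next
  case False
  define \<zeta> where "\<zeta> = ee (of_int x / real Q)"
  have pw: "ee (real z * of_int x / real Q) = \<zeta> ^ z" for z
    by (simp add: \<zeta>_def ee_power)
  have "\<zeta> ^ Q = 1"
    using assms by (simp add: \<zeta>_def ee_power)
  moreover have "\<zeta> \<noteq> 1"
  proof
    assume "\<zeta> = 1"
    then have "\<bar>sin (pi * (of_int x / real Q))\<bar> = 0"
      using norm_one_minus_ee[of "of_int x / real Q"] by (simp add: \<zeta>_def)
    then have "of_int x / real Q \<in> \<int>"
      using sin_times_pi_eq_0[of "of_int x / real Q"] by (simp add: mult.commute)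
    then obtain y where "of_int x / real Q = of_int y" by (elim Ints_cases)
    then have "of_int x = (of_int (y * int Q) :: real)"
      using assms by (simp add: field_simps)
    then show False using False by (simp only: of_int_eq_iff) simp
  qed
  ultimately have "(\<Sum>z<Q. \<zeta> ^ z) = 0"
    by (simp add: geometric_sum)
  then show ?thesis using False by (simp add: pw)
qed

section \<open>Completing incomplete sums\<close>

text \<open>A common upper bound for the Fourier coefficients at frequency \<open>z\<close> of all intervals modulo \<open>Q\<close>.
  The two terms are the reciprocal distances from \<open>z\<close> to the two neighbouring multiples of \<open>Q\<close>.\<close>

definition iota :: "nat \<Rightarrow> nat \<Rightarrow> real" where
  "iota Q z = (if z = 0 then 1 else 1 / real z + 1 / real (Q - z))"

lemma iota_nonneg: "iota Q z \<ge> 0"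
  by (simp add: iota_def)

lemma iota_pos: "iota Q z > 0"
  by (auto simp: iota_def intro!: add_pos_nonneg)

lemma sum_inverse_le: "(\<Sum>n=1..N. 1 / real n) \<le> 1 + ln (real N)" if "N \<ge> 1"
  using that
proof (induction N rule: dec_induct)
  case (step n)
  have "1 / real (Suc n) \<le> ln (real (Suc n)) - ln (real n)"
    using ln_diff_le[of "real n" "real (Suc n)"] step by (simp add: field_simps)
  then show ?case using step by simp
qed simp

lemma sum_iota_le:
  assumes "Q \<ge> 1"
  shows "(\<Sum>z<Q. iota Q z) \<le> 3 + 2 * ln (real Q)"
proof -
  have "{..<Q} = insert 0 {1..<Q}" using assms by auto
  then have "(\<Sum>z<Q. iota Q z) = 1 + (\<Sum>z=1..<Q. 1 / real z + 1 / real (Q - z))"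
    by (simp add: iota_def)
  also have "\<dots> = 1 + ((\<Sum>z=1..<Q. 1 / real z) + (\<Sum>z=1..<Q. 1 / real (Q - z)))"
    by (simp add: sum.distrib)
  also have "(\<Sum>z=1..<Q. 1 / real (Q - z)) = (\<Sum>z=1..<Q. 1 / real z)"
    by (rule sum.reindex_bij_witness[of _ "\<lambda>z. Q - z" "\<lambda>z. Q - z"]) auto
  also have "(\<Sum>z=1..<Q. 1 / real z) \<le> (\<Sum>z=1..Q. 1 / real z)"
    by (rule sum_mono2) auto
  also have "\<dots> \<le> 1 + ln (real Q)"
    using assms by (rule sum_inverse_le)
  finally show ?thesis by simp
qed

text \<open>The bound on the coefficients depends on the modulus alone. This uniformity lets interval conditions
  that couple two variables be separated at the cost of a logarithm.\<close>

lemma interval_indicator_expansion: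
  assumes "j \<le> Q" "Q > 0"
  obtains H where "\<And>m. m < Q \<Longrightarrow> (\<Sum>z<Q. H z * ee (real z * real m / real Q)) = of_bool (m \<in> {i..<j})"
    and "\<And>z. z < Q \<Longrightarrow> norm (H z) \<le> iota Q z"
proof -
  define H where "H z = (\<Sum>k\<in>{i..<j}. ee (- (real z * real k / real Q))) / of_nat Q" for z
  have "(\<Sum>z<Q. H z * ee (real z * real m / real Q)) = of_bool (m \<in> {i..<j})" if "m < Q" for m
  proof -
    have "(\<Sum>z<Q. H z * ee (real z * real m / real Q))
        = (\<Sum>z<Q. \<Sum>k\<in>{i..<j}. ee (real z * of_int (int m - int k) / real Q)) / of_nat Q"
      by (simp add: H_def sum_distrib_right sum_distrib_left sum_divide_distrib
          right_diff_distrib diff_divide_distrib ee_add[of _ "- _", symmetric] add.commute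
          flip: ee_add)
    also have "\<dots> = (\<Sum>k\<in>{i..<j}. \<Sum>z<Q. ee (real z * of_int (int m - int k) / real Q)) / of_nat Q"
      by (subst sum.swap) simp
    also have "\<dots> = (\<Sum>k\<in>{i..<j}. if k = m then of_nat Q else 0) / of_nat Q"
    proof -
      have "int Q dvd int m - int k \<longleftrightarrow> k = m" if "k \<in> {i..<j}" for k
      proof -
        have "\<bar>int m - int k\<bar> < int Q" using that \<open>m < Q\<close> assms by auto
        then show ?thesis using zdvd_imp_le[of "int Q" "\<bar>int m - int k\<bar>"] by fastforce
      qed
      then show ?thesis
        by (intro arg_cong[of _ _ "\<lambda>x. x / of_nat Q"] sum.cong)
           (simp_all only: sum_ee_orthogonality[OF assms(2)])
    qed
    also have "\<dots> = of_bool (m \<in> {i..<j})"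
      using assms by (simp add: sum.delta)
    finally show ?thesis .
  qed
  moreover have "norm (H z) \<le> iota Q z" if "z < Q" for z
  proof (cases "z = 0")
    case True
    have "norm (\<Sum>k\<in>{i..<j}. ee (- (real z * real k / real Q))) \<le> real (card {i..<j})"
      by (rule order.trans[OF norm_sum]) simp
    also have "\<dots> \<le> real Q" using assms by simp
    finally show ?thesis
      using assms True by (simp add: H_def iota_def norm_divide)
  next
    case False
    define S where "S = (\<Sum>k\<in>{i..<j}. ee (real k * (- (real z / real Q))))"
    have "norm (1 - ee (- (real z / real Q))) = norm (1 - ee (real z / real Q))"
      by (simp add: norm_one_minus_ee)
    then have "norm (1 - ee (real z / real Q)) * norm S \<le> 2"
      using norm_sum_ee_interval_le[of "- (real z / real Q)" i j] by (simp add: S_def)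
    moreover have "2 / (real Q * iota Q z) \<le> norm (1 - ee (real z / real Q))"
      using norm_one_minus_ee_ge[of z Q] False that by (simp add: iota_def)
    ultimately have "2 / (real Q * iota Q z) * norm S \<le> 2"
      by (meson mult_right_mono norm_ge_zero order_trans)
    then have "norm S \<le> real Q * iota Q z"
      using assms iota_pos[of Q z] by (simp add: field_simps)
    moreover have "norm (H z) = norm S / real Q"
      by (simp add: H_def S_def algebra_simps norm_divide)
    ultimately show ?thesis
      using assms by (simp add: divide_le_eq mult.commute)
  qed
  ultimately show ?thesis using that by blast
qed

section \<open>Digital characters and their Fourier transforms\<close>

definition digital_char :: "nat \<Rightarrow> (nat \<Rightarrow> real) \<Rightarrow> nat \<Rightarrow> nat \<Rightarrow> complex" where
  "digital_char b a L n = ee (\<Sum>i<L. a i * real (digit b i n))"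

definition digit_kernel :: "nat \<Rightarrow> real \<Rightarrow> complex" where
  "digit_kernel b x = (\<Sum>e<b. ee (real e * x)) / of_nat b"

definition digital_transform :: "nat \<Rightarrow> (nat \<Rightarrow> real) \<Rightarrow> nat \<Rightarrow> real \<Rightarrow> complex" where
  "digital_transform b a L \<theta> = (\<Prod>i<L. digit_kernel b (a i - real b ^ i * \<theta>))"

lemma norm_digital_char [simp]: "norm (digital_char b a L n) = 1"
  by (simp add: digital_char_def)

lemma norm_digit_kernel_le_1: "norm (digit_kernel b x) \<le> 1"
proof -
  have "norm (\<Sum>e<b. ee (real e * x)) \<le> real b"
    by (rule order.trans[OF norm_sum]) simp
  then show ?thesis
    by (cases "b = 0") (simp_all add: digit_kernel_def norm_divide)
qed

lemma norm_digital_transform_le_1: "norm (digital_transform b a L \<theta>) \<le> 1"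
  unfolding digital_transform_def prod_norm[symmetric]
  by (rule prod_le_1) (auto simp: norm_digit_kernel_le_1)

lemma digit_kernel_add_int: "digit_kernel b (x + of_int k) = digit_kernel b x"
proof -
  have "ee (real e * (x + of_int k)) = ee (real e * x)" for e
    using ee_add_of_int[of "real e * x" "int e * k"] by (simp add: algebra_simps)
  then show ?thesis by (simp add: digit_kernel_def)
qed

lemma digital_transform_add_int: "digital_transform b a L (\<theta> + of_int k) = digital_transform b a L \<theta>"
proof -
  have "digit_kernel b (a i - real b ^ i * (\<theta> + of_int k)) = digit_kernel b (a i - real b ^ i * \<theta>)" for i
    using digit_kernel_add_int[of b "a i - real b ^ i * \<theta>" "- (int b ^ i * k)"]
    by (simp add: algebra_simps)
  then show ?thesis by (simp add: digital_transform_def)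
qed

lemma digital_transform_split:
  "digital_transform b a (k + L) \<theta>
    = digital_transform b a k \<theta> * digital_transform b (\<lambda>i. a (k + i)) L (real b ^ k * \<theta>)"
proof -
  have "(\<Prod>i<k + L. g i) = (\<Prod>i<k. g i) * (\<Prod>i<L. g (k + i))" for g :: "nat \<Rightarrow> complex"
    by (induction L) (auto simp: algebra_simps)
  then show ?thesis
    by (simp add: digital_transform_def power_add mult_ac)
qed

lemma digit_add_power:
  assumes "i < L"
  shows "digit b i (n + b ^ L * e) = digit b i n"
proof (cases "b = 0")
  case True
  then show ?thesis using assms by (simp add: power_0_left)
next
  case False
  have "b ^ L * e = b ^ i * (b * (b ^ (L - i - 1) * e))"
    using assms by (metis Suc_diff_Suc diff_Suc_1 less_imp_le_nat mult.assoc
        ordered_cancel_comm_monoid_diff_class.add_diff_inverse power_Suc power_add)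
  moreover have "(n + b ^ i * (b * (b ^ (L - i - 1) * e))) div b ^ i = b * (b ^ (L - i - 1) * e) + n div b ^ i"
    using False by simp
  ultimately have "(n + b ^ L * e) div b ^ i = b * (b ^ (L - i - 1) * e) + n div b ^ i"
    by (simp only:)
  then show ?thesis by (simp add: digit_def)
qed

lemma digit_top:
  assumes "n < b ^ L" "e < b"
  shows "digit b L (n + b ^ L * e) = e"
  using assms by (simp add: digit_def div_add_self2)

lemma digital_char_mod: "digital_char b a L (n mod b ^ L) = digital_char b a L n"
proof -
  have "digit b i n = digit b i (n mod b ^ L)" if "i < L" for i
    using digit_add_power[OF that, of b "n mod b ^ L" "n div b ^ L"] by simp
  then show ?thesis by (simp add: digital_char_def)
qed

lemma digital_char_split:
  "digital_char b a (L + M) n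
     = digital_char b a L n * digital_char b (\<lambda>i. a (L + i)) M (n div b ^ L)"
proof -
  have "(\<Sum>i<L + M. g i) = (\<Sum>i<L. g i) + (\<Sum>i<M. g (L + i))" for g :: "nat \<Rightarrow> real"
    by (induction M) (auto simp: algebra_simps)
  moreover have "digit b (L + i) n = digit b i (n div b ^ L)" for i
    by (simp add: digit_def power_add div_mult2_eq)
  ultimately show ?thesis
    by (simp add: digital_char_def flip: ee_add)
qed

lemma sum_lessThan_mult:
  fixes f :: "nat \<Rightarrow> 'a :: comm_monoid_add"
  shows "(\<Sum>n<k * m. f n) = (\<Sum>j<m. \<Sum>n<k. f (n + k * j))"
proof -
  have "(\<Sum>n<m * k. f n) = (\<Sum>j<m. \<Sum>n\<in>{j * k..<j * k + k}. f n)"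
    by (simp add: sum.nat_group)
  also have "\<dots> = (\<Sum>j<m. \<Sum>n<k. f (n + k * j))"
  proof (rule sum.cong[OF refl])
    fix j
    show "(\<Sum>n\<in>{j * k..<j * k + k}. f n) = (\<Sum>n<k. f (n + k * j))"
      by (rule sum.reindex_bij_witness[of _ "\<lambda>n. n + k * j" "\<lambda>n. n - k * j"]) (auto simp: mult.commute)
  qed
  finally show ?thesis by (simp add: mult.commute)
qed

text \<open>Distinct digits are independent, so the transform of a digital character is a product of
  one-digit kernels.\<close>

lemma sum_digital_char_ee:
  assumes "b > 0"
  shows "(\<Sum>n<b ^ L. digital_char b a L n * ee (- (real n * \<theta>))) = of_nat (b ^ L) * digital_transform b a L \<theta>"
proof (induction L)
  case 0
  then show ?case by (simp add: digital_char_def digital_transform_def)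
next
  case (Suc L)
  have "(\<Sum>n<b ^ Suc L. digital_char b a (Suc L) n * ee (- (real n * \<theta>)))
      = (\<Sum>e<b. \<Sum>n<b ^ L. digital_char b a (Suc L) (n + b ^ L * e) * ee (- (real (n + b ^ L * e) * \<theta>)))"
    by (simp only: power_Suc2 sum_lessThan_mult)
  also have "\<dots> = (\<Sum>e<b. \<Sum>n<b ^ L. ee (real e * (a L - real b ^ L * \<theta>)) *
      (digital_char b a L n * ee (- (real n * \<theta>))))"
  proof (intro sum.cong refl)
    fix e n assume *: "e \<in> {..<b}" "n \<in> {..<b ^ L}"
    then have "digital_char b a (Suc L) (n + b ^ L * e) = digital_char b a L n * ee (a L * real e)"
      by (simp add: digital_char_def digit_add_power digit_top ee_add)
    then show "digital_char b a (Suc L) (n + b ^ L * e) * ee (- (real (n + b ^ L * e) * \<theta>)) =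
        ee (real e * (a L - real b ^ L * \<theta>)) * (digital_char b a L n * ee (- (real n * \<theta>)))"
      by (simp add: algebra_simps flip: ee_add)
  qed
  also have "\<dots> = (\<Sum>e<b. ee (real e * (a L - real b ^ L * \<theta>))) * (of_nat (b ^ L) * digital_transform b a L \<theta>)"
    by (simp add: Suc.IH flip: sum_distrib_left sum_distrib_right)
  also have "\<dots> = of_nat (b ^ Suc L) * digital_transform b a (Suc L) \<theta>"
    using assms by (simp add: digital_transform_def digit_kernel_def)
  finally show ?case .
qed

text \<open>The identity holds for all \<open>n\<close>, since both sides have period \<open>b^L\<close>.\<close>

lemma digital_char_inversion:
  assumes "b > 0"
  shows "digital_char b a L n
    = (\<Sum>h<b ^ L. digital_transform b a L (real h / real b ^ L) * ee (real h * real n / real b ^ L))"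
proof -
  define Q where "Q = b ^ L"
  define n' where "n' = n mod Q"
  have Q: "Q > 0" "real b ^ L = real Q" using assms by (auto simp: Q_def)
  have n': "n' < Q" using Q by (simp add: n'_def)
  have per: "ee (real h * real n / real Q) = ee (real h * real n' / real Q)" for h
  proof -
    have "real n = real n' + real Q * real (n div Q)"
      unfolding n'_def by (metis add.commute mult_div_mod_eq of_nat_add of_nat_mult)
    then have "real h * real n / real Q = real h * real n' / real Q + of_int (int (h * (n div Q)))"
      using Q by (simp add: field_simps)
    then show ?thesis by (simp only: ee_add_of_int)
  qed
  have "(\<Sum>h<Q. digital_transform b a L (real h / real Q) * ee (real h * real n / real Q))
     = (\<Sum>h<Q. (\<Sum>m<Q. digital_char b a L m * ee (- (real m * (real h / real Q)))) *
          ee (real h * real n' / real Q)) / of_nat Q"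
    unfolding sum_digital_char_ee[OF assms, of a L, folded Q_def] sum_divide_distrib
    using Q by (simp add: per)
  also have "\<dots> = (\<Sum>h<Q. \<Sum>m<Q. digital_char b a L m * ee (real h * of_int (int n' - int m) / real Q)) / of_nat Q"
    by (simp add: sum_distrib_right mult.assoc right_diff_distrib diff_divide_distrib
        mult.commute[of "real _" "real _"] flip: ee_add)
  also have "\<dots> = (\<Sum>m<Q. digital_char b a L m * (\<Sum>h<Q. ee (real h * of_int (int n' - int m) / real Q))) / of_nat Q"
    by (subst sum.swap) (simp add: sum_distrib_left)
  also have "\<dots> = (\<Sum>m<Q. if m = n' then digital_char b a L m * of_nat Q else 0) / of_nat Q"
  proof (intro arg_cong[of _ _ "\<lambda>x. x / of_nat Q"] sum.cong refl)
    fix m assume m: "m \<in> {..<Q}"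
    have "\<bar>int n' - int m\<bar> < int Q" using m n' by auto
    then have "int Q dvd int n' - int m \<longleftrightarrow> m = n'"
      using zdvd_imp_le[of "int Q" "\<bar>int n' - int m\<bar>"] by fastforce
    then show "digital_char b a L m * (\<Sum>h<Q. ee (real h * of_int (int n' - int m) / real Q))
        = (if m = n' then digital_char b a L m * of_nat Q else 0)"
      by (simp only: sum_ee_orthogonality[OF Q(1)]) simp
  qed
  also have "\<dots> = digital_char b a L n'"
    using Q n' by simp
  also have "\<dots> = digital_char b a L n"
    by (simp add: n'_def Q_def digital_char_mod)
  finally show ?thesis by (simp add: Q_def)
qed

lemma norm_square_sum:
  "of_real ((norm (\<Sum>x\<in>A. f x))\<^sup>2) = (\<Sum>x\<in>A. \<Sum>y\<in>A. f x * cnj (f y))" for f :: "'a \<Rightarrow> complex"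
  by (simp only: complex_norm_square cnj_sum sum_product)

lemma parseval:
  assumes "M \<le> Q" "Q > 0"
  shows "(\<Sum>i<Q. (norm (\<Sum>n<M. x n * ee (- (real n * (\<theta> + real i / real Q)))))\<^sup>2)
    = real Q * (\<Sum>n<M. (norm (x n))\<^sup>2)"
proof -
  define y where "y n = x n * ee (- (real n * \<theta>))" for n
  have xy: "x n * ee (- (real n * (\<theta> + real i / real Q))) = y n * ee (- (real n * real i / real Q))" for n i
    by (simp add: y_def algebra_simps ee_add[symmetric])
  have "complex_of_real (\<Sum>i<Q. (norm (\<Sum>n<M. y n * ee (- (real n * real i / real Q))))\<^sup>2)
     = (\<Sum>i<Q. \<Sum>n<M. \<Sum>m<M. y n * cnj (y m) * ee (real i * of_int (int m - int n) / real Q))"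
    by (simp only: of_real_sum norm_square_sum)
       (simp add: algebra_simps diff_divide_distrib flip: ee_add)
  also have "\<dots> = (\<Sum>n<M. \<Sum>m<M. y n * cnj (y m) * (\<Sum>i<Q. ee (real i * of_int (int m - int n) / real Q)))"
    unfolding sum_distrib_left
    by (rule trans[OF sum.swap sum.cong[OF refl sum.swap]])
  also have "\<dots> = (\<Sum>n<M. \<Sum>m<M. if m = n then of_nat Q * of_real ((norm (y n))\<^sup>2) else 0)"
  proof (intro sum.cong refl)
    fix n m assume m: "n \<in> {..<M}" "m \<in> {..<M}"
    have "\<bar>int m - int n\<bar> < int Q" using m assms by auto
    then have "int Q dvd int m - int n \<longleftrightarrow> m = n"
      using zdvd_imp_le[of "int Q" "\<bar>int m - int n\<bar>"] by fastforce
    then show "y n * cnj (y m) * (\<Sum>i<Q. ee (real i * of_int (int m - int n) / real Q))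
        = (if m = n then of_nat Q * of_real ((norm (y n))\<^sup>2) else 0)"
      by (simp only: sum_ee_orthogonality[OF assms(2)] complex_norm_square) simp
  qed
  also have "\<dots> = of_real (real Q * (\<Sum>n<M. (norm (y n))\<^sup>2))"
    by (simp add: sum_distrib_left)
  finally have "(\<Sum>i<Q. (norm (\<Sum>n<M. y n * ee (- (real n * real i / real Q))))\<^sup>2)
      = real Q * (\<Sum>n<M. (norm (y n))\<^sup>2)"
    by (simp only: of_real_eq_iff)
  then show ?thesis
    by (simp add: xy) (simp add: y_def norm_mult)
qed

lemma parseval_digital:
  assumes "b > 0" "b ^ L \<le> Q"
  shows "(\<Sum>i<Q. (norm (digital_transform b a L (\<theta> + real i / real Q)))\<^sup>2) = real Q / real b ^ L"
proof -
  have "Q > 0" using assms by (metis gr0I leD zero_less_power)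
  have "norm (digital_transform b a L t) = norm (\<Sum>n<b ^ L. digital_char b a L n * ee (- (real n * t))) / real b ^ L" for t
    using assms by (simp add: sum_digital_char_ee norm_mult norm_power)
  then have "(\<Sum>i<Q. (norm (digital_transform b a L (\<theta> + real i / real Q)))\<^sup>2)
    = (\<Sum>i<Q. (norm (\<Sum>n<b ^ L. digital_char b a L n * ee (- (real n * (\<theta> + real i / real Q)))))\<^sup>2) / (real b ^ L)\<^sup>2"
    by (simp add: power_divide sum_divide_distrib)
  also have "\<dots> = real Q / real b ^ L"
    using assms by (subst parseval[OF assms(2) \<open>Q > 0\<close>]) (simp add: power2_eq_square)
  finally show ?thesis .
qed

section \<open>Uniform decay of the transform of the reversal character\<close>

lemma norm_one_minus_ee_add: "norm (1 - ee (x + y)) \<le> norm (1 - ee x) + norm (1 - ee y)"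
proof -
  have "1 - ee (x + y) = (1 - ee x) + ee x * (1 - ee y)"
    by (simp add: ee_add algebra_simps)
  then show ?thesis
    by (metis mult_1 norm_ee norm_mult norm_triangle_ineq)
qed

lemma norm_one_minus_ee_minus: "norm (1 - ee (- x)) = norm (1 - ee x)"
  by (simp add: norm_one_minus_ee)

lemma norm_one_minus_ee_of_nat_mult: "norm (1 - ee (real n * x)) \<le> real n * norm (1 - ee x)"
proof (induction n)
  case (Suc n)
  have "norm (1 - ee (real (Suc n) * x)) \<le> norm (1 - ee x) + norm (1 - ee (real n * x))"
    using norm_one_minus_ee_add[of x "real n * x"] by (simp add: algebra_simps)
  then show ?case using Suc by (simp add: algebra_simps)
qed simp

lemma norm_digit_kernel_le:
  assumes "b \<ge> 2"
  shows "norm (digit_kernel b x) \<le> 1 - (norm (1 - ee x))\<^sup>2 / (4 * real b)"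
proof -
  have "{..<b} = {0, 1} \<union> {2..<b}" using assms by auto
  then have "(\<Sum>e<b. ee (real e * x)) = (1 + ee x) + (\<Sum>e\<in>{2..<b}. ee (real e * x))"
    by (simp add: sum.union_disjoint)
  also have "norm \<dots> \<le> norm (1 + ee x) + norm (\<Sum>e\<in>{2..<b}. ee (real e * x))"
    by (rule norm_triangle_ineq)
  also have "norm (\<Sum>e\<in>{2..<b}. ee (real e * x)) \<le> real b - 2"
    using assms by (intro order.trans[OF norm_sum]) simp
  also have "norm (1 + ee x) \<le> 2 - (norm (1 - ee x))\<^sup>2 / 4"
  proof (rule power2_le_imp_le)
    have eq: "(norm (1 + ee x))\<^sup>2 = 4 - (norm (1 - ee x))\<^sup>2"
      by (simp add: norm_one_plus_ee norm_one_minus_ee power_mult_distrib cos_squared_eq)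
    show "(norm (1 + ee x))\<^sup>2 \<le> (2 - (norm (1 - ee x))\<^sup>2 / 4)\<^sup>2"
      unfolding eq by (simp add: power2_diff field_simps)
    have "(norm (1 - ee x))\<^sup>2 \<le> 4"
      using eq by (smt (verit) zero_le_power2)
    then show "0 \<le> 2 - (norm (1 - ee x))\<^sup>2 / 4" by simp
  qed
  finally show ?thesis
    using assms by (simp add: digit_kernel_def norm_divide field_simps)
qed

text \<open>Neighbouring kernels cannot both be close to one: eliminating the frequency between them
  leaves a quantity that depends only on the phases.\<close>

lemma norm_digit_kernel_pair_le:
  assumes "b \<ge> 2" and "norm (1 - ee (real b * z - z')) \<ge> \<kappa>" "\<kappa> \<ge> 0"
  shows "norm (digit_kernel b z) * norm (digit_kernel b z') \<le> 1 - (\<kappa> / (real b + 1))\<^sup>2 / (4 * real b)"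
proof -
  define t where "t = \<kappa> / (real b + 1)"
  have t: "t \<ge> 0" using assms by (simp add: t_def)
  have "\<kappa> \<le> real b * norm (1 - ee z) + norm (1 - ee z')"
    using norm_one_minus_ee_add[of "real b * z" "- z'"] norm_one_minus_ee_of_nat_mult[of b z] assms(2)
    by (simp add: norm_one_minus_ee_minus)
  moreover have "\<kappa> = real b * t + t"
  proof -
    have "(real b + 1) * t = \<kappa>" by (simp add: t_def add_eq_0_iff)
    then show ?thesis by (simp add: distrib_right)
  qed
  ultimately have "norm (1 - ee z) \<ge> t \<or> norm (1 - ee z') \<ge> t"
    by (smt (verit) mult_left_mono of_nat_0_le_iff)
  moreover have "norm (digit_kernel b y) \<le> 1 - t\<^sup>2 / (4 * real b)" if "norm (1 - ee y) \<ge> t" for y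
  proof -
    have "t\<^sup>2 / (4 * real b) \<le> (norm (1 - ee y))\<^sup>2 / (4 * real b)"
      using that t by (intro divide_right_mono power_mono) auto
    then show ?thesis using norm_digit_kernel_le[OF assms(1), of y] by linarith
  qed
  ultimately show ?thesis
    using norm_digit_kernel_le_1 mult_mono[of "norm (digit_kernel b z)" _ "norm (digit_kernel b z')" 1]
      mult_mono[of "norm (digit_kernel b z)" 1 "norm (digit_kernel b z')"]
    unfolding t_def by (smt (verit) mult.right_neutral mult.left_neutral norm_ge_zero mult_left_le mult_left_le_one_le)
qed

text \<open>The quotient of the two distances is the modulus of a geometric sum of \<open>b\<close> terms, which near \<open>1\<close>
  is at least \<open>b - 1 / 2\<close>.\<close>

lemma norm_one_minus_ee_expand:
  assumes "b \<ge> 2" "norm (1 - ee y) \<le> 1 / (real b)\<^sup>2"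
  shows "norm (1 - ee (real b * y)) \<ge> 3 / 2 * norm (1 - ee y)"
proof -
  have "1 - ee (real b * y) = (1 - ee y) * (\<Sum>e<b. ee (real e * y))"
    using one_diff_power_eq[of "ee y" b] by (simp add: ee_power)
  moreover have "norm (\<Sum>e<b. ee (real e * y)) \<ge> 3 / 2"
  proof -
    have "real b - norm (\<Sum>e<b. ee (real e * y)) \<le> norm (of_nat b - (\<Sum>e<b. ee (real e * y)))"
      by (metis norm_of_nat norm_triangle_ineq2)
    also have "of_nat b - (\<Sum>e<b. ee (real e * y)) = (\<Sum>e<b. 1 - ee (real e * y))"
      by (simp add: sum_subtractf)
    also have "norm \<dots> \<le> (\<Sum>e<b. real e * norm (1 - ee y))"
      by (intro sum_norm_le norm_one_minus_ee_of_nat_mult)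
    also have "\<dots> = real (\<Sum>e<b. e) * norm (1 - ee y)"
      by (simp add: sum_distrib_right)
    also have "\<dots> \<le> (real b)\<^sup>2 / 2 * (1 / (real b)\<^sup>2)"
    proof (intro mult_mono assms(2))
      have "2 * (\<Sum>e<b. e) \<le> b\<^sup>2" 
        by (induction b) (auto simp: power2_eq_square algebra_simps)
      then have "real (2 * (\<Sum>e<b. e)) \<le> real (b\<^sup>2)" by (simp only: of_nat_le_iff)
      then show "real (\<Sum>e<b. e) \<le> (real b)\<^sup>2 / 2" by simp
    qed auto
    also have "\<dots> = 1 / 2" using assms by simp
    finally show ?thesis using assms by simp
  qed
  ultimately show ?thesis
    using mult_left_mono[of "3 / 2" "norm (\<Sum>e<b. ee (real e * y))" "norm (1 - ee y)"]
    by (simp add: norm_mult mult.commute)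
qed

lemma norm_one_minus_ee_rational_ge:
  assumes "q > 0" "\<not> q dvd w"
  shows "norm (1 - ee (real w / real q)) \<ge> 1 / real q"
proof -
  define z where "z = w mod q"
  have z: "0 < z" "z < q"
    using assms by (auto simp: z_def dvd_eq_mod_eq_0)
  have "real w = real z + real q * real (w div q)"
    unfolding z_def by (metis add.commute mult_div_mod_eq of_nat_add of_nat_mult)
  then have "real w / real q = real z / real q + of_int (int (w div q))"
    using assms by (simp add: field_simps)
  then have "ee (real w / real q) = ee (real z / real q)"
    by (simp only: ee_add_of_int)
  moreover have "norm (1 - ee (real z / real q)) \<ge> 2 / (real q * (1 / real z + 1 / real (q - z)))"
    by (rule norm_one_minus_ee_ge[OF z])
  moreover have "2 / (real q * (1 / real z + 1 / real (q - z))) \<ge> 2 / (real q * (1 + 1))"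
    using z by (intro divide_left_mono mult_left_mono add_mono mult_pos_pos) (auto intro!: add_pos_pos)
  ultimately show ?thesis by simp
qed

text \<open>A fraction with denominator \<open>q\<close> that is not an integer is at distance at least \<open>1 / q\<close> from the
  integers. Since small distances expand geometrically, they cannot stay small for \<open>W\<close> steps.\<close>

lemma exists_large_multiple:
  assumes "b \<ge> 2" "q > 0" "\<And>e. \<not> q dvd w * b ^ e" "real q \<le> (3 / 2) ^ W"
  shows "\<exists>j\<le>W. norm (1 - ee (real w * real b ^ (e + j) / real q)) \<ge> 1 / (real b)\<^sup>2"
proof (rule ccontr)
  assume "\<not> ?thesis"
  then have small: "norm (1 - ee (real w * real b ^ (e + j) / real q)) < 1 / (real b)\<^sup>2" if "j \<le> W" for j
    using that by (meson not_le)
  have "norm (1 - ee (real w * real b ^ (e + j) / real q)) \<ge> (3 / 2) ^ j / real q" if "j \<le> W" for j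
    using that
  proof (induction j)
    case 0
    then show ?case
      using norm_one_minus_ee_rational_ge[OF assms(2,3), of e] by simp
  next
    case (Suc j)
    then have "(3 / 2) ^ Suc j / real q \<le> 3 / 2 * norm (1 - ee (real w * real b ^ (e + j) / real q))"
      by simp
    also have "\<dots> \<le> norm (1 - ee (real b * (real w * real b ^ (e + j) / real q)))"
      using Suc.prems small[of j] by (intro norm_one_minus_ee_expand assms(1)) auto
    finally show ?case by (simp add: mult_ac)
  qed
  from this[of W] have "(3 / 2) ^ W / real q < 1 / (real b)\<^sup>2"
    using small[of W] by simp
  moreover have "(3 / 2) ^ W / real q \<ge> 1"
    using assms by simp
  moreover have "1 / (real b)\<^sup>2 \<le> 1"
    using assms by simp
  ultimately show False by linarith
qed

text \<open>The bound \<open>w\<close> is applied to \<open>n\<close> consecutive windows of \<open>W\<close> digits; the other \<open>r\<close> digits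
  contribute at most \<open>1\<close>.\<close>

lemma digital_transform_decay:
  assumes "\<And>k \<theta>. k + W \<le> l \<Longrightarrow> norm (digital_transform b (\<lambda>i. a (k + i)) W \<theta>) \<le> w"
    and "0 \<le> w" "k + n * W + r \<le> l"
  shows "norm (digital_transform b (\<lambda>i. a (k + i)) (n * W + r) \<theta>) \<le> w ^ n"
  using assms(3)
proof (induction n arbitrary: k \<theta>)
  case 0
  then show ?case by (simp add: norm_digital_transform_le_1)
next
  case (Suc n)
  have "norm (digital_transform b (\<lambda>i. a (k + i)) W \<theta>) *
      norm (digital_transform b (\<lambda>i. a (k + W + i)) (n * W + r) (real b ^ W * \<theta>)) \<le> w * w ^ n"
    using Suc.prems assms(1)[of k \<theta>] Suc.IH[of "k + W"] by (intro mult_mono) (auto simp: assms(2))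
  then show ?case
    using digital_transform_split[of b "\<lambda>i. a (k + i)" W "n * W + r" \<theta>]
    by (simp add: add.assoc norm_mult)
qed

definition reversal_phase :: "nat \<Rightarrow> nat \<Rightarrow> real \<Rightarrow> nat \<Rightarrow> real" where
  "reversal_phase b l \<alpha> i = \<alpha> * real b ^ (l - 1 - i)"

lemma digital_char_reversal: "digital_char b (reversal_phase b l \<alpha>) l n = ee (\<alpha> * real (digit_reverse b l n))"
  by (simp add: digital_char_def reversal_phase_def digit_reverse_def sum_distrib_left mult_ac)

text \<open>Two neighbouring phases \<open>\<alpha> b^(e+1)\<close> and \<open>\<alpha> b^e\<close> produce the obstruction
  \<open>\<alpha> (b\<^sup>2 - 1) b^e\<close>. If it is never an integer, it expands under multiplication by \<open>b\<close> and
  becomes large within \<open>O(log q)\<close> digits.\<close>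

lemma norm_digital_transform_reversal_le:
  fixes b :: nat
  assumes b: "b \<ge> 2"
  obtains c where "c > 0"
    and "\<And>q h l k L \<theta>. q \<ge> 2 \<Longrightarrow> (\<And>e. \<not> q dvd h * (b\<^sup>2 - 1) * b ^ e) \<Longrightarrow> k + L \<le> l \<Longrightarrow>
      norm (digital_transform b (\<lambda>i. reversal_phase b l (real h / real q) (k + i)) L \<theta>)
        \<le> 3 * exp (- (c * real L / ln (real q)))"
proof -
  define \<kappa> where "\<kappa> = 1 / (real b)\<^sup>2"
  define \<delta> where "\<delta> = (\<kappa> / (real b + 1))\<^sup>2 / (4 * real b)"
  define C :: real where "C = 1 / ln (3 / 2) + 3 / ln 2"
  have \<delta>: "\<delta> > 0" using b by (simp add: \<delta>_def \<kappa>_def)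
  have \<delta>1: "\<delta> \<le> 1"
  proof -
    have "\<kappa> \<le> 1" using b by (simp add: \<kappa>_def)
    then have "\<kappa> / (real b + 1) \<le> 1" using b by simp
    then have "(\<kappa> / (real b + 1))\<^sup>2 \<le> 1\<^sup>2"
      by (intro power_mono) (auto simp: \<kappa>_def)
    then show ?thesis unfolding \<delta>_def using b by (simp add: divide_le_eq)
  qed
  have C: "C > 0" by (simp add: C_def add_pos_pos)
  show ?thesis
  proof (rule that[of "\<delta> / C"])
    show "\<delta> / C > 0" using \<delta> C by simp
    fix q h l k L :: nat and \<theta> :: real
    assume q: "q \<ge> 2" and h: "\<And>e. \<not> q dvd h * (b\<^sup>2 - 1) * b ^ e" and kL: "k + L \<le> l"
    define a where "a = reversal_phase b l (real h / real q)"
    define V where "V = nat \<lceil>ln (real q) / ln (3 / 2)\<rceil>"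
    define W where "W = V + 2"
    have lnq: "ln (real q) > 0" "ln 2 \<le> ln (real q)" using q by auto
    have V: "real q \<le> (3 / 2) ^ V"
    proof -
      have "ln (real q) / ln (3 / 2) \<le> real V"
        unfolding V_def by linarith
      then have "ln (real q) \<le> real V * ln (3 / 2)"
        by (simp add: divide_le_eq)
      then have "ln (real q) \<le> ln ((3 / 2) ^ V)"
        by (simp add: ln_realpow)
      then show ?thesis using q by simp
    qed
    have W: "real W \<le> C * ln (real q)"
    proof -
      have "ln (real q) / ln (3 / 2) > 0" using lnq by simp
      then have "real W \<le> ln (real q) / ln (3 / 2) + 3"
        unfolding W_def V_def by linarith
      moreover have "3 \<le> 3 / ln 2 * ln (real q)"
        using lnq by (simp add: field_simps)
      ultimately show ?thesis by (simp add: C_def distrib_right)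
    qed
    have win: "norm (digital_transform b (\<lambda>i. a (k + i)) W \<theta>) \<le> 1 - \<delta>" if "k + W \<le> l" for k \<theta>
    proof -
      define z where "z i = a (k + i) - real b ^ i * \<theta>" for i
      define e where "e = l - 2 - (k + V)"
      obtain j where j: "j \<le> V" "norm (1 - ee (real (h * (b\<^sup>2 - 1)) * real b ^ (e + j) / real q)) \<ge> \<kappa>"
        using exists_large_multiple[OF b _ h V, of e] q by (auto simp: \<kappa>_def)
      define i where "i = V - j"
      have "real b * a (k + i) - a (k + i + 1) = real (h * (b\<^sup>2 - 1)) * real b ^ (e + j) / real q"
      proof -
        have "l - 1 - (k + i) = Suc (e + j)" "l - 1 - (k + i + 1) = e + j"
          using that j by (auto simp: e_def i_def W_def)
        moreover have "real (b\<^sup>2 - 1) = (real b)\<^sup>2 - 1"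
          using b by (simp add: of_nat_diff)
        ultimately show ?thesis
          unfolding a_def reversal_phase_def of_nat_mult
          by (simp only: power_Suc diff_divide_distrib) (simp add: algebra_simps power2_eq_square diff_divide_distrib)
      qed
      then have "norm (1 - ee (real b * z i - z (Suc i))) \<ge> \<kappa>"
        using j by (simp add: z_def algebra_simps)
      then have pair: "norm (digit_kernel b (z i)) * norm (digit_kernel b (z (Suc i))) \<le> 1 - \<delta>"
        unfolding \<delta>_def using b by (intro norm_digit_kernel_pair_le) (auto simp: \<kappa>_def)
      have set: "{..<W} = insert i (insert (Suc i) ({..<W} - {i, Suc i}))"
        by (auto simp: W_def i_def)
      have "norm (digital_transform b (\<lambda>i. a (k + i)) W \<theta>) = (\<Prod>i<W. norm (digit_kernel b (z i)))"
        by (simp add: digital_transform_def z_def prod_norm)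
      also have "\<dots> = (norm (digit_kernel b (z i)) * norm (digit_kernel b (z (Suc i)))) *
          (\<Prod>i\<in>{..<W} - {i, Suc i}. norm (digit_kernel b (z i)))"
        by (subst set) simp
      also have "\<dots> \<le> (norm (digit_kernel b (z i)) * norm (digit_kernel b (z (Suc i)))) * 1"
        by (intro mult_left_mono prod_le_1) (auto simp: norm_digit_kernel_le_1)
      finally show ?thesis using pair by simp
    qed
    define n where "n = L div W"
    have L: "n * W + L mod W = L"
      by (simp add: n_def)
    then have "norm (digital_transform b (\<lambda>i. a (k + i)) L \<theta>) \<le> (1 - \<delta>) ^ n"
      using digital_transform_decay[of W l b a "1 - \<delta>" k n "L mod W" \<theta>] win kL \<delta>1 by simp
    also have "\<dots> \<le> exp (- \<delta>) ^ n"
      using \<delta>1 exp_ge_add_one_self[of "- \<delta>"] by (intro power_mono) auto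
    also have "\<dots> = exp (- \<delta> * real n)"
      using exp_of_nat2_mult[of "- \<delta>" n] by simp
    also have "\<dots> \<le> exp (1 - \<delta> / C * real L / ln (real q))"
    proof -
      have "real L / (C * ln (real q)) \<le> real L / real W"
        using W by (intro divide_left_mono) (auto simp: W_def C lnq intro!: mult_pos_pos)
      also have "\<dots> \<le> real n + 1"
      proof -
        have "W > 0" by (simp add: W_def)
        then have "real (L mod W) \<le> real W"
          by (simp add: less_imp_le)
        moreover have "real L = real n * real W + real (L mod W)"
          using L by (metis of_nat_add of_nat_mult)
        ultimately show ?thesis using \<open>W > 0\<close> by (simp add: field_simps)
      qed
      finally have "\<delta> * (real L / (C * ln (real q))) \<le> \<delta> * (real n + 1)"
        using \<delta> by (intro mult_left_mono) auto
      also have "\<dots> \<le> \<delta> * real n + 1"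
        using \<delta>1 by (simp add: distrib_left)
      finally show ?thesis by simp
    qed
    also have "\<dots> \<le> 3 * exp (- (\<delta> / C * real L / ln (real q)))"
      using exp_le by (simp add: exp_diff exp_minus field_simps)
    finally show "norm (digital_transform b (\<lambda>i. reversal_phase b l (real h / real q) (k + i)) L \<theta>)
        \<le> 3 * exp (- (\<delta> / C * real L / ln (real q)))"
      by (simp add: a_def)
  qed
qed

section \<open>Energy of the transform in residue classes\<close>

text \<open>For \<open>g = 1\<close> this is the square of the \<open>L\<^sup>1\<close> norm of the transform, for \<open>g = b^L\<close> the square of its
  \<open>L\<^sup>2\<close> norm. General divisors \<open>g\<close>, not only powers of \<open>b\<close>, occur because they are the possible values
  of \<open>gcd (h - l) (b^L)\<close>.\<close>

definition class_energy :: "nat \<Rightarrow> (nat \<Rightarrow> real) \<Rightarrow> nat \<Rightarrow> nat \<Rightarrow> real" where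
  "class_energy b a L g = (\<Sum>h<b ^ L. \<Sum>l<b ^ L. of_bool (int g dvd int h - int l) *
     (norm (digital_transform b a L (real h / real b ^ L)) * norm (digital_transform b a L (real l / real b ^ L))))"

lemma mult_le_half_squares: "x * y \<le> (x\<^sup>2 + y\<^sup>2) / 2" for x y :: real
  using sum_squares_bound[of x y] by simp

lemma sum_symmetric_relation_le:
  fixes v :: "'a \<Rightarrow> real"
  assumes "\<And>x y. P x y \<longleftrightarrow> P y x" "finite A" and "\<And>x. x \<in> A \<Longrightarrow> (\<Sum>y\<in>A. of_bool (P x y)) \<le> K"
  shows "(\<Sum>x\<in>A. \<Sum>y\<in>A. of_bool (P x y) * (v x * v y)) \<le> K * (\<Sum>x\<in>A. (v x)\<^sup>2)"
proof -
  have "(\<Sum>x\<in>A. \<Sum>y\<in>A. of_bool (P x y) * (v x * v y))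
      \<le> (\<Sum>x\<in>A. \<Sum>y\<in>A. of_bool (P x y) * (((v x)\<^sup>2 + (v y)\<^sup>2) / 2))"
    by (intro sum_mono mult_left_mono mult_le_half_squares) simp
  also have "\<dots> = (\<Sum>x\<in>A. \<Sum>y\<in>A. of_bool (P x y) * (v x)\<^sup>2) / 2 + (\<Sum>x\<in>A. \<Sum>y\<in>A. of_bool (P x y) * (v y)\<^sup>2) / 2"
    by (simp add: sum.distrib add_divide_distrib distrib_left sum_divide_distrib)
  also have "(\<Sum>x\<in>A. \<Sum>y\<in>A. of_bool (P x y) * (v y)\<^sup>2) = (\<Sum>x\<in>A. \<Sum>y\<in>A. of_bool (P x y) * (v x)\<^sup>2)"
    by (subst sum.swap) (simp add: assms(1))
  also have "(\<Sum>x\<in>A. \<Sum>y\<in>A. of_bool (P x y) * (v x)\<^sup>2) / 2 + (\<Sum>x\<in>A. \<Sum>y\<in>A. of_bool (P x y) * (v x)\<^sup>2) / 2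
      = (\<Sum>x\<in>A. (\<Sum>y\<in>A. of_bool (P x y)) * (v x)\<^sup>2)"
    by (simp add: sum_distrib_right)
  also have "\<dots> \<le> (\<Sum>x\<in>A. K * (v x)\<^sup>2)"
    by (intro sum_mono mult_right_mono assms(3)) auto
  finally show ?thesis by (simp add: sum_distrib_left)
qed

lemma sum_of_bool_class:
  assumes "c > 0"
  shows "(\<Sum>s<c. of_bool (int c dvd x - int s) * of_bool (int c dvd y - int s)) = (of_bool (int c dvd x - y) :: real)"
proof -
  define s0 where "s0 = nat (x mod int c)"
  have s0: "s0 < c" "int s0 = x mod int c"
    using assms by (auto simp: s0_def nat_less_iff)
  have eq: "int c dvd x - int s \<longleftrightarrow> s = s0" if "s < c" for s
    using that s0 by (metis mod_eq_dvd_iff mod_pos_pos_trivial of_nat_0_le_iff of_nat_eq_iff of_nat_less_iff)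
  have "int c dvd y - int s0 \<longleftrightarrow> int c dvd x - y"
    using s0 by (metis mod_eq_dvd_iff mod_mod_trivial)
  moreover have "(\<Sum>s<c. of_bool (int c dvd x - int s) * of_bool (int c dvd y - int s))
      = (\<Sum>s<c. if s = s0 then of_bool (int c dvd y - int s0) else (0::real))"
    by (intro sum.cong refl) (auto simp: eq)
  ultimately show ?thesis using s0 by simp
qed

lemma sum_of_bool_class_card:
  assumes "g dvd Q" "Q > 0"
  shows "(\<Sum>l<Q. of_bool (int g dvd x - int l)) = (real Q / real g :: real)"
proof -
  obtain m where Q: "Q = g * m" using assms by (elim dvdE)
  have g: "g > 0" using assms Q by (auto intro: gr0I)
  have "(\<Sum>l<Q. of_bool (int g dvd x - int l)) = (\<Sum>j<m. \<Sum>n<g. of_bool (int g dvd x - int (n + g * j)) :: real)"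
    unfolding Q by (rule sum_lessThan_mult)
  also have "\<dots> = (\<Sum>j<m. \<Sum>n<g. of_bool (int g dvd x - int n) * of_bool (int g dvd x - int n))"
  proof -
    have "int g dvd x - int (n + g * j) \<longleftrightarrow> int g dvd x - int n" for n j
      using dvd_diff_left_iff[of "int g" "int g * int j" "x - int n"] by (simp add: algebra_simps)
    then show ?thesis by simp
  qed
  also have "\<dots> = real m"
    by (simp add: sum_of_bool_class[OF g])
  finally show ?thesis using g by (simp add: Q)
qed

lemma class_energy_trivial:
  assumes "b > 0" "g dvd b ^ L"
  shows "class_energy b a L g \<le> real b ^ L / real g"
proof -
  have "class_energy b a L g \<le> real (b ^ L) / real g * (\<Sum>h<b ^ L. (norm (digital_transform b a L (real h / real b ^ L)))\<^sup>2)"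
    unfolding class_energy_def
  proof (rule sum_symmetric_relation_le)
    show "(\<Sum>l<b ^ L. of_bool (int g dvd int h - int l)) \<le> real (b ^ L) / real g" for h
      using assms by (simp only: sum_of_bool_class_card order.refl zero_less_power)
  qed (auto simp: dvd_diff_commute)
  also have "(\<Sum>h<b ^ L. (norm (digital_transform b a L (real h / real b ^ L)))\<^sup>2) = 1"
    using parseval_digital[of b L "b ^ L" a 0] assms by simp
  finally show ?thesis by simp
qed

text \<open>Both sums are split into classes modulo \<open>c\<close>; the shift \<open>s0\<close> merely permutes the classes of one of
  them.\<close>

lemma sum_shifted_class_le:
  fixes v w :: "nat \<Rightarrow> real"
  assumes "c > 0"
    and "(\<Sum>i<M. \<Sum>j<M. of_bool (int c dvd int i - int j) * (v i * v j)) \<le> K"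
    and "(\<Sum>i<M. \<Sum>j<M. of_bool (int c dvd int i - int j) * (w i * w j)) \<le> K"
  shows "(\<Sum>i<M. \<Sum>j<M. of_bool (int c dvd int i - int j - s0) * (v i * w j)) \<le> K"
proof -
  define A where "A u t s = (\<Sum>i<M. of_bool (int c dvd int i - t - int s) * u i)" for u :: "nat \<Rightarrow> real" and t s
  have prod: "(\<Sum>s<c. A u t s * A u' t' s) = (\<Sum>i<M. \<Sum>j<M. of_bool (int c dvd (int i - t) - (int j - t')) * (u i * u' j))" for u u' t t'
  proof -
    have "(\<Sum>s<c. A u t s * A u' t' s) = (\<Sum>s<c. \<Sum>i<M. \<Sum>j<M.
        (of_bool (int c dvd int i - t - int s) * of_bool (int c dvd int j - t' - int s)) * (u i * u' j))"
      unfolding A_def sum_product by (intro sum.cong refl) (simp only: mult_ac)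
    also have "\<dots> = (\<Sum>i<M. \<Sum>j<M. \<Sum>s<c.
        (of_bool (int c dvd int i - t - int s) * of_bool (int c dvd int j - t' - int s)) * (u i * u' j))"
      by (rule trans[OF sum.swap sum.cong[OF refl sum.swap]])
    also have "\<dots> = (\<Sum>i<M. \<Sum>j<M. of_bool (int c dvd (int i - t) - (int j - t')) * (u i * u' j))"
      by (simp only: sum_of_bool_class[OF assms(1)] flip: sum_distrib_right)
    finally show ?thesis .
  qed
  have "(\<Sum>i<M. \<Sum>j<M. of_bool (int c dvd int i - int j - s0) * (v i * w j)) = (\<Sum>s<c. A v s0 s * A w 0 s)"
    unfolding prod by (simp add: algebra_simps)
  also have "\<dots> \<le> (\<Sum>s<c. ((A v s0 s)\<^sup>2 + (A w 0 s)\<^sup>2) / 2)"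
    by (intro sum_mono mult_le_half_squares)
  also have "\<dots> = ((\<Sum>s<c. A v s0 s * A v s0 s) + (\<Sum>s<c. A w 0 s * A w 0 s)) / 2"
    by (simp add: sum.distrib power2_eq_square flip: sum_divide_distrib)
  also have "\<dots> \<le> K"
    unfolding prod using assms by simp
  finally show ?thesis .
qed

text \<open>Fixing the low parts of two frequencies, the class condition modulo \<open>g\<close> becomes a class
  condition modulo \<open>c = g / gcd g (b^L)\<close> on their top parts; the two linked factors separate.\<close>

lemma class_energy_step:
  assumes b: "b > 0" and g: "g dvd b ^ (k + L)" and c: "c * gcd g (b ^ L) = g"
    and K: "\<And>\<theta>. (\<Sum>i<b ^ k. \<Sum>j<b ^ k. of_bool (int c dvd int i - int j) *
        (norm (digital_transform b a k (\<theta> + real i / real b ^ k)) *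
         norm (digital_transform b a k (\<theta> + real j / real b ^ k)))) \<le> K" "K \<ge> 0"
  shows "class_energy b a (k + L) g \<le> K * class_energy b (\<lambda>i. a (k + i)) L (gcd g (b ^ L))"
proof -
  define g' where "g' = gcd g (b ^ L)"
  define B where "B = b ^ L"
  have pos: "g > 0" "g' > 0" "c > 0" "B > 0"
  proof -
    show "B > 0" using b by (simp add: B_def)
    show g0: "g > 0" using g b by (metis gr0I power_eq_0_iff dvd_0_left_iff less_irrefl)
    then show "g' > 0" by (simp add: g'_def)
    show "c > 0" using c g0 by (metis gr0I mult_0 less_irrefl)
  qed
  define v where "v h i = norm (digital_transform b a k (real h / real b ^ (k + L) + real i / real b ^ k))" for h i
  define w where "w h = norm (digital_transform b (\<lambda>i. a (k + i)) L (real h / real b ^ L))" for h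
  have split: "norm (digital_transform b a (k + L) (real (h + B * i) / real b ^ (k + L))) = v h i * w h" for h i
  proof -
    have "real (h + B * i) / real b ^ (k + L) = real h / real b ^ (k + L) + real i / real b ^ k"
      using b by (simp add: B_def field_simps power_add)
    moreover have "real b ^ k * (real (h + B * i) / real b ^ (k + L)) = real h / real b ^ L + of_int (int i)"
      using b by (simp add: B_def field_simps power_add)
    ultimately show ?thesis
      by (simp only: digital_transform_split norm_mult v_def w_def digital_transform_add_int)
  qed
  have inner: "(\<Sum>i<b ^ k. \<Sum>j<b ^ k. of_bool (int g dvd int (h + B * i) - int (l + B * j)) * (v h i * v l j))
      \<le> of_bool (int g' dvd int h - int l) * K" for h l
  proof (cases "\<exists>i j. int g dvd int (h + B * i) - int (l + B * j)")
    case True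
    then obtain i0 j0 where ij: "int g dvd int (h + B * i0) - int (l + B * j0)" by blast
    define s0 where "s0 = int i0 - int j0"
    have "int g' dvd int h - int l"
    proof -
      have "int g' dvd int (h + B * i0) - int (l + B * j0)" "int g' dvd int B * (int i0 - int j0)"
      proof -
        have "int g' dvd int g" by (simp add: g'_def)
        then show "int g' dvd int (h + B * i0) - int (l + B * j0)" using ij by (rule dvd_trans)
        have "int g' dvd int B" unfolding g'_def B_def by (simp only: int_dvd_int_iff gcd_dvd2)
        then show "int g' dvd int B * (int i0 - int j0)" by (rule dvd_mult2)
      qed
      then have "int g' dvd (int (h + B * i0) - int (l + B * j0)) - int B * (int i0 - int j0)"
        by (rule dvd_diff)
      then show ?thesis by (simp add: algebra_simps)
    qed
    moreover have "int g dvd int (h + B * i) - int (l + B * j) \<longleftrightarrow> int c dvd int i - int j - s0" for i j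
    proof -
      have "int g dvd int (h + B * i) - int (l + B * j) \<longleftrightarrow>
          int g dvd (int (h + B * i) - int (l + B * j)) - (int (h + B * i0) - int (l + B * j0))"
        by (rule dvd_diff_left_iff[OF ij, symmetric])
      also have "(int (h + B * i) - int (l + B * j)) - (int (h + B * i0) - int (l + B * j0))
          = int B * (int i - int j - s0)"
        by (simp add: s0_def algebra_simps)
      also have "int g dvd int B * (int i - int j - s0) \<longleftrightarrow> int c dvd int i - int j - s0"
      proof -
        obtain B' where B': "B = g' * B'"
          using gcd_dvd2[of g "b ^ L"] unfolding g'_def B_def by (elim dvdE)
        have g_eq: "g = g' * c" using c by (simp add: g'_def mult.commute)
        have "g' * gcd c B' = gcd g B"
          unfolding g_eq B' by (rule gcd_mult_distrib_nat)
        then have "g' * gcd c B' = g' * 1" by (simp add: g'_def B_def)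
        then have "gcd c B' = 1" using pos by (simp only: mult_cancel1) simp
        then have "coprime c B'" by (rule gcd_eq_1_imp_coprime)
        have "int g dvd int B * (int i - int j - s0) \<longleftrightarrow> int g' * int c dvd int g' * (int B' * (int i - int j - s0))"
          by (simp only: g_eq B' of_nat_mult mult.assoc)
        also have "\<dots> \<longleftrightarrow> int c dvd int B' * (int i - int j - s0)"
          using pos by simp
        also have "\<dots> \<longleftrightarrow> int c dvd int i - int j - s0"
          using \<open>coprime c B'\<close> by (simp add: coprime_dvd_mult_right_iff)
        finally show ?thesis .
      qed
      finally show ?thesis .
    qed
    moreover have "(\<Sum>i<b ^ k. \<Sum>j<b ^ k. of_bool (int c dvd int i - int j - s0) * (v h i * v l j)) \<le> K"
      using K pos unfolding v_def by (intro sum_shifted_class_le) auto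
    ultimately show ?thesis by simp
  next
    case False
    then show ?thesis using K(2) by simp
  qed
  have "class_energy b a (k + L) g = (\<Sum>h<B * b ^ k. \<Sum>l<B * b ^ k. of_bool (int g dvd int h - int l) *
     (norm (digital_transform b a (k + L) (real h / real b ^ (k + L))) * norm (digital_transform b a (k + L) (real l / real b ^ (k + L)))))"
    by (simp add: class_energy_def B_def power_add mult.commute)
  also have "\<dots> = (\<Sum>i<b ^ k. \<Sum>h<B. \<Sum>j<b ^ k. \<Sum>l<B. of_bool (int g dvd int (h + B * i) - int (l + B * j)) *
     ((v h i * w h) * (v l j * w l)))"
    by (simp only: sum_lessThan_mult split)
  also have "\<dots> = (\<Sum>h<B. \<Sum>i<b ^ k. \<Sum>l<B. \<Sum>j<b ^ k. of_bool (int g dvd int (h + B * i) - int (l + B * j)) *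
     ((v h i * w h) * (v l j * w l)))"
    by (rule trans[OF sum.swap sum.cong[OF refl sum.cong[OF refl sum.swap]]])
  also have "\<dots> = (\<Sum>h<B. \<Sum>l<B. \<Sum>i<b ^ k. \<Sum>j<b ^ k. of_bool (int g dvd int (h + B * i) - int (l + B * j)) *
     ((v h i * w h) * (v l j * w l)))"
    by (rule sum.cong[OF refl sum.swap])
  also have "\<dots> = (\<Sum>h<B. \<Sum>l<B. (\<Sum>i<b ^ k. \<Sum>j<b ^ k. of_bool (int g dvd int (h + B * i) - int (l + B * j)) *
     (v h i * v l j)) * (w h * w l))"
    by (simp add: sum_distrib_left sum_distrib_right mult_ac)
  also have "\<dots> \<le> (\<Sum>h<B. \<Sum>l<B. (of_bool (int g' dvd int h - int l) * K) * (w h * w l))"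
    by (intro sum_mono mult_right_mono inner) (auto simp: w_def)
  also have "\<dots> = K * class_energy b (\<lambda>i. a (k + i)) L g'"
    unfolding class_energy_def B_def w_def sum_distrib_left by (intro sum.cong refl) (simp only: mult_ac)
  finally show ?thesis by (simp add: g'_def)
qed

lemma continuous_on_digit_kernel [continuous_intros]:
  "continuous_on A f \<Longrightarrow> continuous_on A (\<lambda>x. digit_kernel b (f x))"
  unfolding digit_kernel_def by (cases "b = 0") (auto intro!: continuous_intros)

text \<open>For \<open>b \<ge> 3\<close> the kernel cannot be constant on all residue classes modulo a proper divisor
  \<open>c\<close> of \<open>b\<close>: its values at shifts by multiples of \<open>1 / b\<close> have a common numerator, and equality of
  the denominators at two consecutive shifts would force \<open>sin (2 * pi / b) = 0\<close>.\<close>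

lemma digit_kernel_class_not_constant:
  assumes b: "b \<ge> 3" and c: "c dvd b" "c < b"
  shows "\<exists>i<b. \<exists>j<b. int c dvd int i - int j \<and>
    norm (digit_kernel b (x - real i / real b)) \<noteq> norm (digit_kernel b (x - real j / real b))"
proof (rule ccontr)
  assume "\<not> ?thesis"
  then have eq: "norm (digit_kernel b (x - real i / real b)) = norm (digit_kernel b (x - real j / real b))"
    if "i < b" "j < b" "int c dvd int i - int j" for i j
    using that by blast
  define y where "y i = x - real i / real b" for i
  define w where "w = ee (real b * x)"
  have cpos: "c > 0" by (rule dvd_pos_nat[OF _ c(1)]) (use b in simp)
  have c2: "2 * c \<le> b"
  proof -
    obtain m where m: "b = c * m" using c by (elim dvdE)
    then have "m \<noteq> 0" "m \<noteq> 1" using c b by auto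
    then have "c * 2 \<le> c * m" by (intro mult_le_mono2) simp
    then show ?thesis using m by simp
  qed
  have w: "ee (real b * y i) = w" for i
  proof -
    have "real b * y i = real b * x + of_int (- int i)"
      using b by (simp add: y_def algebra_simps)
    then show ?thesis by (simp only: ee_add_of_int w_def)
  qed
  have ker: "real b * norm (digit_kernel b (y i)) * norm (1 - ee (y i)) = norm (1 - w)" for i
  proof -
    have "(1 - ee (y i)) * (\<Sum>e<b. ee (real e * y i)) = 1 - w"
      using one_diff_power_eq[of "ee (y i)" b] by (simp add: ee_power w)
    then have "norm (1 - ee (y i)) * norm (\<Sum>e<b. ee (real e * y i)) = norm (1 - w)"
      by (metis norm_mult)
    then show ?thesis using b by (simp add: digit_kernel_def norm_divide mult.commute)
  qed
  have distinct: "ee (y i) \<noteq> ee (y j)" if "i < b" "j < b" "i \<noteq> j" for i j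
  proof
    assume "ee (y i) = ee (y j)"
    then have "ee (y i - y j) = 1" by (simp add: ee_diff)
    then have "sin (pi * (y i - y j)) = 0"
      using norm_one_minus_ee[of "y i - y j"] by simp
    then have "y i - y j \<in> \<int>"
      using sin_times_pi_eq_0[of "y i - y j"] by (simp add: mult.commute)
    then obtain n where "y i - y j = of_int n" by (elim Ints_cases)
    moreover have "(y i - y j) * real b = real j - real i"
      using b by (simp add: y_def left_diff_distrib)
    ultimately have "of_int (int j - int i) = (of_int (n * int b) :: real)"
      by simp
    then have "int j - int i = n * int b" by (simp only: of_int_eq_iff)
    then have "int b dvd int j - int i" by simp
    moreover have "\<bar>int j - int i\<bar> < int b" using that by auto
    ultimately show False
      using that zdvd_imp_le[of "int b" "\<bar>int j - int i\<bar>"] by auto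
  qed
  show False
  proof (cases "w = 1")
    case True
    have zero: "digit_kernel b (y i) = 0" if "ee (y i) \<noteq> 1" for i
      using ker[of i] True that b by auto
    have "(\<Sum>i<b. (norm (digit_kernel b (y i)))\<^sup>2) = 1"
    proof -
      have "(\<Sum>i<b. (norm (digital_transform b (\<lambda>_. x) 1 (0 + real i / real b)))\<^sup>2) = real b / real b ^ 1"
        by (rule parseval_digital) (use b in auto)
      then show ?thesis using b by (simp add: digital_transform_def y_def)
    qed
    then obtain i where i: "i < b" "digit_kernel b (y i) \<noteq> 0"
      by (metis (no_types, lifting) lessThan_iff norm_zero sum.neutral zero_neq_one zero_power2)
    then have yi: "ee (y i) = 1" using zero by blast
    obtain j where j: "j < b" "j \<noteq> i" "int c dvd int i - int j"
    proof (cases "i + c < b")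
      case True
      then show ?thesis using that[of "i + c"] cpos by auto
    next
      case False
      then have "i \<ge> c" using c2 by simp
      then show ?thesis using that[of "i - c"] cpos i by auto
    qed
    have "digit_kernel b (y j) = 0"
      using distinct[of j i] i j yi by (intro zero) auto
    then show False using eq[of i j] i j by (simp flip: y_def)
  next
    case False
    have sine: "sin (2 * pi * y i - pi * real c / real b) = 0" if "i < b" "i + c < b" for i
    proof -
      have "norm (digit_kernel b (y i)) = norm (digit_kernel b (y (i + c)))"
        unfolding y_def using that by (intro eq) auto
      moreover have "norm (digit_kernel b (y i)) \<noteq> 0"
        using ker[of i] False by auto
      ultimately have "norm (1 - ee (y i)) = norm (1 - ee (y (i + c)))"
        using ker[of i] ker[of "i + c"] b by (metis mult_eq_0_iff mult_left_cancel not_numeral_le_zero of_nat_eq_0_iff)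
      then have "(sin (pi * y i))\<^sup>2 = (sin (pi * y (i + c)))\<^sup>2"
        by (simp add: norm_one_minus_ee power2_eq_iff abs_eq_iff)
      then have cos: "cos (2 * (pi * y i)) = cos (2 * (pi * y (i + c)))"
        by (simp only: cos_double_sin)
      have "cos (2 * (pi * y i)) - cos (2 * (pi * y (i + c)))
        = 2 * sin ((2 * (pi * y i) + 2 * (pi * y (i + c))) / 2) * sin ((2 * (pi * y (i + c)) - 2 * (pi * y i)) / 2)"
        by (rule cos_diff_cos)
      moreover have "(2 * (pi * y (i + c)) - 2 * (pi * y i)) / 2 = - (pi * real c / real b)"
        using b by (simp add: y_def field_simps)
      moreover have "(2 * (pi * y i) + 2 * (pi * y (i + c))) / 2 = 2 * pi * y i - pi * real c / real b"
        using b by (simp add: y_def field_simps)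
      moreover have "sin (pi * real c / real b) > 0"
        using c cpos by (intro sin_gt_zero) (auto simp: divide_less_eq)
      ultimately show ?thesis using cos by simp
    qed
    define u where "u = 2 * pi * y 0 - pi * real c / real b"
    have "sin u = 0"
      unfolding u_def using b c by (intro sine) auto
    moreover have "sin (u - 2 * pi / real b) = 0"
    proof -
      have "sin (2 * pi * y 1 - pi * real c / real b) = 0"
        using b c2 cpos by (intro sine) auto
      moreover have "2 * pi * y 1 - pi * real c / real b = u - 2 * pi / real b"
        by (simp add: u_def y_def algebra_simps)
      ultimately show ?thesis by simp
    qed
    ultimately have "cos u * sin (2 * pi / real b) = 0"
      by (simp add: sin_diff)
    moreover have "cos u \<noteq> 0"
      using \<open>sin u = 0\<close> sin_cos_squared_add[of u] by auto
    moreover have "sin (2 * pi / real b) > 0"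
      using b by (intro sin_gt_zero) (auto simp: field_simps)
    ultimately show False by simp
  qed
qed

text \<open>By Parseval the sum is \<open>b / c\<close> minus half the sum of the squared differences of kernel values in
  the same class, hence less than \<open>b / c\<close> at every point. Continuity and periodicity make the gap
  uniform.\<close>

lemma digit_kernel_class_gap:
  assumes b: "b \<ge> 3" and c: "c dvd b" "c < b"
  shows "\<exists>\<delta>>0. \<forall>x. (\<Sum>i<b. \<Sum>j<b. of_bool (int c dvd int i - int j) *
    (norm (digit_kernel b (x - real i / real b)) * norm (digit_kernel b (x - real j / real b))))
      \<le> real b / real c * (1 - \<delta>)"
proof -
  have cpos: "c > 0" by (rule dvd_pos_nat[OF _ c(1)]) (use b in simp)
  define v where "v x i = norm (digit_kernel b (x - real i / real b))" for x i
  define G where "G x = (\<Sum>i<b. \<Sum>j<b. of_bool (int c dvd int i - int j) * (v x i * v x j))" for x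
  have sq: "(\<Sum>i<b. (v x i)\<^sup>2) = 1" for x
  proof -
    have "(\<Sum>i<b. (norm (digital_transform b (\<lambda>_. x) 1 (0 + real i / real b)))\<^sup>2) = real b / real b ^ 1"
      by (rule parseval_digital) (use b in auto)
    then show ?thesis using b by (simp add: digital_transform_def v_def)
  qed
  have strict: "G x < real b / real c" for x
  proof -
    define D where "D i j = of_bool (int c dvd int i - int j) * (v x i - v x j)\<^sup>2" for i j
    have sum1: "(\<Sum>i<b. \<Sum>j<b. of_bool (int c dvd int i - int j) * (v x i)\<^sup>2) = real b / real c"
    proof -
      have "(\<Sum>i<b. \<Sum>j<b. of_bool (int c dvd int i - int j) * (v x i)\<^sup>2) = (\<Sum>i<b. real b / real c * (v x i)\<^sup>2)"
        using b c by (simp only: sum_of_bool_class_card flip: sum_distrib_right) 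
      then show ?thesis by (simp only: sq mult_1_right flip: sum_distrib_left)
    qed
    moreover have "(\<Sum>i<b. \<Sum>j<b. of_bool (int c dvd int i - int j) * (v x j)\<^sup>2) = real b / real c"
      unfolding sum1[symmetric] by (subst sum.swap) (simp only: dvd_diff_commute)
    ultimately have "(\<Sum>i<b. \<Sum>j<b. D i j) = 2 * (real b / real c) - 2 * G x"
    proof -
      have "(\<Sum>i<b. \<Sum>j<b. D i j) = (\<Sum>i<b. \<Sum>j<b. of_bool (int c dvd int i - int j) * (v x i)\<^sup>2)
         + (\<Sum>i<b. \<Sum>j<b. of_bool (int c dvd int i - int j) * (v x j)\<^sup>2) - 2 * G x"
        unfolding D_def G_def sum_distrib_left sum.distrib[symmetric] sum_subtractf[symmetric]
        by (intro sum.cong refl) (simp only: power2_diff algebra_simps)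
      then show ?thesis using sum1 \<open>(\<Sum>i<b. \<Sum>j<b. of_bool (int c dvd int i - int j) * (v x j)\<^sup>2) = real b / real c\<close>
        by simp
    qed
    moreover have "(\<Sum>i<b. \<Sum>j<b. D i j) > 0"
    proof -
      obtain i j where ij: "i < b" "j < b" "int c dvd int i - int j" "v x i \<noteq> v x j"
        using digit_kernel_class_not_constant[OF assms, of x] unfolding v_def by blast
      then have "0 < D i j" by (simp add: D_def)
      also have "\<dots> \<le> (\<Sum>j<b. D i j)"
        using ij by (intro member_le_sum) (auto simp: D_def)
      also have "\<dots> \<le> (\<Sum>i<b. \<Sum>j<b. D i j)"
        using ij by (intro member_le_sum[of i _ "\<lambda>i. \<Sum>j<b. D i j"]) (auto simp: D_def intro!: sum_nonneg)
      finally show ?thesis .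
    qed
    ultimately show ?thesis by linarith
  qed
  have "continuous_on {0..1} G"
    unfolding G_def v_def by (intro continuous_intros)
  then have "\<exists>x\<in>{0..1}. \<forall>y\<in>{0..1}. G y \<le> G x"
    by (intro continuous_attains_sup) auto
  then obtain x0 where x0: "\<And>y. y \<in> {0..1} \<Longrightarrow> G y \<le> G x0"
    by blast
  have le: "G x \<le> G x0" for x
  proof -
    have "v x i = v (frac x) i" for i
    proof -
      have "x - real i / real b = frac x - real i / real b + of_int \<lfloor>x\<rfloor>"
        by (simp add: frac_def)
      then show ?thesis by (simp only: v_def digit_kernel_add_int)
    qed
    then have "G x = G (frac x)" by (simp add: G_def)
    also have "\<dots> \<le> G x0"
      by (intro x0) (auto simp: frac_ge_0 frac_lt_1 less_imp_le)
    finally show ?thesis .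
  qed
  define \<delta> where "\<delta> = 1 - G x0 * real c / real b"
  have "\<delta> > 0"
    using strict[of x0] b cpos by (simp add: \<delta>_def field_simps)
  moreover have "\<forall>x. G x \<le> real b / real c * (1 - \<delta>)"
    using b cpos le by (simp add: \<delta>_def)
  ultimately show ?thesis
    unfolding G_def v_def by blast
qed

text \<open>Every peeled digit gains: the part of \<open>g\<close> lost with the top digit is a proper divisor of \<open>b\<close>
  unless \<open>g\<close> is the full modulus.\<close>

lemma gcd_quotient_proper:
  fixes g b L :: nat
  assumes "b > 0" "g dvd b ^ Suc L" "g \<noteq> b ^ Suc L" "c * gcd g (b ^ L) = g"
  shows "c dvd b" "c < b"
proof -
  have g: "g > 0" by (rule dvd_pos_nat[OF _ assms(2)]) (use assms(1) in simp)
  have pos: "gcd g (b ^ L) > 0" using g by simp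
  have eq: "b * gcd g (b ^ L) = gcd (g * b) (b ^ Suc L)"
    by (metis gcd_mult_distrib_nat mult.commute power_Suc)
  have "g dvd gcd (g * b) (b ^ Suc L)" using assms by simp
  then have "c * gcd g (b ^ L) dvd b * gcd g (b ^ L)" using assms(4) eq by simp
  then show "c dvd b"
    using pos dvd_times_right_cancel_iff[of "gcd g (b ^ L)" c b] by blast
  have "c \<noteq> b"
  proof
    assume "c = b"
    then have *: "gcd (g * b) (b ^ Suc L) = g" using eq assms(4) by simp
    obtain q where q: "b ^ Suc L = g * q" using assms(2) by (elim dvdE)
    have "g * gcd b q = g" using * q by (metis gcd_mult_distrib_nat)
    then have "gcd b q = 1" using g mult_eq_self_implies_10[of g "gcd b q"] by (metis less_irrefl)
    then have "coprime q b" by (metis gcd.commute gcd_eq_1_imp_coprime)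
    then have "coprime q (b ^ Suc L)" by (metis coprime_power_right_iff)
    moreover have "q dvd b ^ Suc L" using q by simp
    ultimately have "q = 1" by (metis coprime_absorb_left nat_dvd_1_iff_1)
    then show False using q assms by simp
  qed
  then show "c < b" using \<open>c dvd b\<close> assms by (meson dvd_imp_le le_neq_implies_less)
qed

lemma class_energy_le_base_ge_3:
  assumes b: "b \<ge> 3"
  obtains \<delta> where "0 < \<delta>" "\<delta> < 1"
    and "\<And>a L J g. g dvd b ^ L \<Longrightarrow> \<not> b ^ J dvd g \<Longrightarrow> J \<le> L \<Longrightarrow>
      class_energy b a L g \<le> real b ^ L / real g * (1 - \<delta>) ^ (L - J)"
proof -
  define CS where "CS = {c. c dvd b \<and> c < b}"
  define gap where "gap c e \<longleftrightarrow> (\<forall>x. (\<Sum>i<b. \<Sum>j<b. of_bool (int c dvd int i - int j) *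
    (norm (digit_kernel b (x - real i / real b)) * norm (digit_kernel b (x - real j / real b))))
      \<le> real b / real c * (1 - e))" for c e
  have "\<forall>c\<in>CS. \<exists>e>0. gap c e"
    using digit_kernel_class_gap[OF b] unfolding gap_def CS_def by blast
  then obtain d where d: "\<And>c. c \<in> CS \<Longrightarrow> d c > 0" "\<And>c. c \<in> CS \<Longrightarrow> gap c (d c)"
    by metis
  define \<delta> where "\<delta> = Min (insert (1/2) (d ` CS))"
  have "finite CS" by (simp add: CS_def)
  then have \<delta>: "\<delta> > 0" "\<delta> \<le> 1 / 2" "\<And>c. c \<in> CS \<Longrightarrow> \<delta> \<le> d c"
    unfolding \<delta>_def using d(1) by (simp, blast intro: Min_le, simp)
  show ?thesis
  proof (rule that[of \<delta>])
    fix a L J g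
    assume "g dvd b ^ L" "\<not> b ^ J dvd g" "J \<le> L"
    then show "class_energy b a L g \<le> real b ^ L / real g * (1 - \<delta>) ^ (L - J)"
    proof (induction "L - J" arbitrary: a L g)
      case 0
      then show ?case using class_energy_trivial[of b g L a] b by simp
    next
      case (Suc n)
      then obtain L' where L: "L = Suc L'" by (cases L) auto
      define g' where "g' = gcd g (b ^ L')"
      have "g' dvd g" by (simp add: g'_def)
      then obtain c where c: "g = c * g'" by (metis dvdE mult.commute)
      have "g \<noteq> b ^ L" using Suc.prems by (auto intro: le_imp_power_dvd)
      then have c': "c dvd b" "c < b"
      proof -
        have *: "b > 0" "g dvd b ^ Suc L'" "g \<noteq> b ^ Suc L'" "c * gcd g (b ^ L') = g"
          using b Suc.prems(1) \<open>g \<noteq> b ^ L\<close> c unfolding L g'_def by (auto simp only:)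
        show "c dvd b" "c < b" using gcd_quotient_proper[OF *] by auto
      qed
      then have CS: "c \<in> CS" by (simp add: CS_def)
      have pos: "c > 0" by (rule dvd_pos_nat[OF _ c'(1)]) (use b in simp)
      have K: "(\<Sum>i<b ^ 1. \<Sum>j<b ^ 1. of_bool (int c dvd int i - int j) *
        (norm (digital_transform b a 1 (\<theta> + real i / real b ^ 1)) *
         norm (digital_transform b a 1 (\<theta> + real j / real b ^ 1)))) \<le> real b / real c * (1 - \<delta>)" for \<theta>
      proof -
        have "(\<Sum>i<b ^ 1. \<Sum>j<b ^ 1. of_bool (int c dvd int i - int j) *
            (norm (digital_transform b a 1 (\<theta> + real i / real b ^ 1)) *
             norm (digital_transform b a 1 (\<theta> + real j / real b ^ 1)))) \<le> real b / real c * (1 - d c)"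
          using d(2)[OF CS, unfolded gap_def, rule_format, of "a 0 - \<theta>"] by (simp add: digital_transform_def diff_diff_eq)
        also have "\<dots> \<le> real b / real c * (1 - \<delta>)"
          using \<delta>(3)[OF CS] by (intro mult_left_mono) auto
        finally show ?thesis .
      qed
      have "class_energy b a (1 + L') g \<le> real b / real c * (1 - \<delta>) * class_energy b (\<lambda>i. a (1 + i)) L' (gcd g (b ^ L'))"
      proof (rule class_energy_step[OF _ _ _ K])
        show "g dvd b ^ (1 + L')" using Suc.prems(1) by (simp add: L)
        show "c * gcd g (b ^ L') = g" using c unfolding g'_def by (rule sym)
      qed (use b \<delta> in auto)
      also have "\<dots> \<le> real b / real c * (1 - \<delta>) * (real b ^ L' / real g' * (1 - \<delta>) ^ (L' - J))"
      proof (intro mult_left_mono)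
        show "class_energy b (\<lambda>i. a (1 + i)) L' (gcd g (b ^ L')) \<le> real b ^ L' / real g' * (1 - \<delta>) ^ (L' - J)"
          unfolding g'_def[symmetric]
        proof (rule Suc.hyps(1))
          show "\<not> b ^ J dvd g'" using Suc.prems(2) c by (metis dvd_mult)
          show "g' dvd b ^ L'" by (simp add: g'_def)
        qed (use Suc.hyps(2) Suc.prems(3) L in auto)
      qed (use \<delta> in auto)
      also have "\<dots> = real b ^ L / real g * (1 - \<delta>) ^ (L - J)"
      proof -
        have "real g = real c * real g'" by (subst c) simp
        moreover have "L - J = Suc (L' - J)" using Suc.hyps(2) L by simp
        ultimately show ?thesis by (simp add: L)
      qed
      finally show ?case by (simp add: L)
    qed
  qed (use \<delta> in auto)
qed

lemma cauchy_schwarz_two: "(u * p + v * q)\<^sup>2 \<le> (u\<^sup>2 + v\<^sup>2) * (p\<^sup>2 + q\<^sup>2)" for u v p q :: real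
proof -
  have "(u\<^sup>2 + v\<^sup>2) * (p\<^sup>2 + q\<^sup>2) - (u * p + v * q)\<^sup>2 = (u * q - v * p)\<^sup>2"
    by (simp add: power2_eq_square algebra_simps)
  then show ?thesis using zero_le_power2[of "u * q - v * p"] by linarith
qed

text \<open>In base two a single kernel can be flat, with both values \<open>1 / sqrt 2\<close>. Two consecutive
  kernels cannot: their four products have sum at most \<open>sqrt (2 + sqrt 2)\<close>.\<close>

lemma sum_two_binary_kernels_le:
  "(\<Sum>i<4. norm (digital_transform 2 a 2 (\<theta> + real i / 4)))\<^sup>2 \<le> 2 + sqrt 2"
proof -
  have ker: "norm (digit_kernel 2 x) = \<bar>cos (pi * x)\<bar>" for x
  proof -
    have "{..<2::nat} = {0, 1}" by auto
    then show ?thesis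
      using norm_one_plus_ee[of x] by (simp add: digit_kernel_def norm_divide)
  qed
  define x where "x = pi * (a 0 - \<theta>)"
  define y where "y = pi * (a 1 - 2 * \<theta>)"
  have F: "norm (digital_transform 2 a 2 (\<theta> + real i / 4)) = \<bar>cos (x - pi * real i / 4)\<bar> * \<bar>cos (y - pi * real i / 2)\<bar>" for i
  proof -
    have two: "{..<2::nat} = {0, 1}" by auto
    have "pi * (a 0 - (\<theta> + real i / 4)) = x - pi * real i / 4"
      by (simp add: x_def algebra_simps)
    moreover have "pi * (a 1 - 2 * (\<theta> + real i / 4)) = y - pi * real i / 2"
      by (simp add: y_def algebra_simps)
    ultimately show ?thesis
      using ker[of "a 0 - (\<theta> + real i / 4)"] ker[of "a 1 - 2 * (\<theta> + real i / 4)"]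
      by (simp add: digital_transform_def two norm_mult)
  qed
  have four: "{..<4::nat} = {0, 1, 2, 3}" by auto
  have c: "cos (x - pi * 2 / 4) = sin x" "cos (y - pi / 2) = sin y" "cos (y - pi * 2 / 2) = - cos y"
     "cos (y - pi * 3 / 2) = - sin y" "cos (x - pi * 3 / 4) = sin (x - pi / 4)"
  proof -
    show "cos (x - pi * 2 / 4) = sin x" "cos (y - pi / 2) = sin y" "cos (y - pi * 2 / 2) = - cos y"
      by (simp_all add: cos_diff)
    have "pi * 3 / 2 = 3 / 2 * pi" by simp
    then show "cos (y - pi * 3 / 2) = - sin y" by (simp only: cos_diff cos_3over2_pi sin_3over2_pi)
    have "x - pi * 3 / 4 = (x - pi / 4) - pi / 2" by simp
    then show "cos (x - pi * 3 / 4) = sin (x - pi / 4)" by (simp only: cos_diff[of "x - pi / 4" "pi / 2"] cos_pi_half sin_pi_half)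
  qed
  define g where "g u = \<bar>cos u\<bar> + \<bar>sin u\<bar>" for u :: real
  have g2: "(g u)\<^sup>2 = 1 + \<bar>sin (2 * u)\<bar>" for u
    by (simp add: g_def power2_sum sin_double abs_mult)
  have "(\<Sum>i<4. norm (digital_transform 2 a 2 (\<theta> + real i / 4))) = \<bar>cos y\<bar> * g x + \<bar>sin y\<bar> * g (x - pi / 4)"
  proof -
    have "(\<Sum>i<4. norm (digital_transform 2 a 2 (\<theta> + real i / 4)))
      = \<bar>cos x\<bar> * \<bar>cos y\<bar> + \<bar>cos (x - pi / 4)\<bar> * \<bar>sin y\<bar> + \<bar>sin x\<bar> * \<bar>cos y\<bar> + \<bar>sin (x - pi / 4)\<bar> * \<bar>sin y\<bar>"
      unfolding F four using c by simp
    then show ?thesis by (simp only: g_def distrib_left mult.commute)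
  qed
  moreover have "(\<bar>cos y\<bar> * g x + \<bar>sin y\<bar> * g (x - pi / 4))\<^sup>2
      \<le> (\<bar>cos y\<bar>\<^sup>2 + \<bar>sin y\<bar>\<^sup>2) * ((g x)\<^sup>2 + (g (x - pi / 4))\<^sup>2)"
    by (rule cauchy_schwarz_two)
  moreover have "\<bar>cos y\<bar>\<^sup>2 + \<bar>sin y\<bar>\<^sup>2 = 1" by simp
  moreover have "(g x)\<^sup>2 + (g (x - pi / 4))\<^sup>2 \<le> 2 + sqrt 2"
  proof -
    have "2 * (x - pi / 4) = 2 * x - pi / 2" by simp
    then have "sin (2 * (x - pi / 4)) = - cos (2 * x)" by (simp only: sin_diff cos_pi_half sin_pi_half)
    moreover have "\<bar>sin (2 * x)\<bar> + \<bar>cos (2 * x)\<bar> \<le> sqrt 2"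
    proof (rule real_le_rsqrt)
      have "(\<bar>sin (2 * x)\<bar> + \<bar>cos (2 * x)\<bar>)\<^sup>2 + (\<bar>sin (2 * x)\<bar> - \<bar>cos (2 * x)\<bar>)\<^sup>2 = 2 * ((sin (2 * x))\<^sup>2 + (cos (2 * x))\<^sup>2)"
        by (simp add: power2_sum power2_diff)
      then show "(\<bar>sin (2 * x)\<bar> + \<bar>cos (2 * x)\<bar>)\<^sup>2 \<le> 2"
        using zero_le_power2[of "\<bar>sin (2 * x)\<bar> - \<bar>cos (2 * x)\<bar>"] by (simp only: sin_cos_squared_add)
    qed
    ultimately show ?thesis by (simp add: g2)
  qed
  ultimately show ?thesis by simp
qed

text \<open>Digits are removed in pairs, so one may remain when the gain stops; the constant \<open>C\<close> pays for it.\<close>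

lemma class_energy_le_base_2:
  obtains \<delta> C where "0 < \<delta>" "\<delta> < 1" "C \<ge> 1"
    and "\<And>a L J g. g dvd 2 ^ L \<Longrightarrow> \<not> 2 ^ J dvd g \<Longrightarrow> J \<le> L \<Longrightarrow>
      class_energy 2 a L g \<le> C * (2 ^ L / real g * (1 - \<delta>) ^ (L - J))"
proof -
  define \<gamma> where "\<gamma> = sqrt ((2 + sqrt 2) / 4)"
  have "sqrt 2 < 2" by (rule real_less_lsqrt) auto
  then have \<gamma>: "0 < \<gamma>" "\<gamma> < 1" "4 * \<gamma>\<^sup>2 = 2 + sqrt 2"
    unfolding \<gamma>_def by (auto intro!: real_less_lsqrt add_pos_pos)
  show ?thesis
  proof (rule that[of "1 - \<gamma>" "1 / \<gamma>"])
    fix a L J and g :: nat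
    assume "g dvd 2 ^ L" "\<not> 2 ^ J dvd g" "J \<le> L"
    then have "class_energy 2 a L g \<le> 1 / \<gamma> * (2 ^ L / real g * \<gamma> ^ (L - J))"
    proof (induction "L - J" arbitrary: a L g rule: less_induct)
      case less
      show ?case
      proof (cases "L \<le> Suc J")
        case True
        have "\<gamma> ^ 1 \<le> \<gamma> ^ (L - J)"
          using True \<gamma> by (intro power_decreasing) auto
        then have "1 \<le> 1 / \<gamma> * \<gamma> ^ (L - J)"
          using \<gamma> by (simp add: field_simps)
        then have "2 ^ L / real g * 1 \<le> 2 ^ L / real g * (1 / \<gamma> * \<gamma> ^ (L - J))"
          by (intro mult_left_mono) auto
        moreover have "class_energy 2 a L g \<le> 2 ^ L / real g"
          using class_energy_trivial[of 2 g L a] less.prems by simp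
        ultimately show ?thesis by (simp add: mult_ac)
      next
        case False
        define L' where "L' = L - 2"
        have L: "L = 2 + L'" "J \<le> L'" using False by (auto simp: L'_def)
        obtain i where i: "g = 2 ^ i"
          using less.prems(1) by (metis divides_primepow_nat two_is_prime_nat)
        have "i < J" using less.prems(2) i by (metis le_imp_power_dvd not_le)
        then have g: "g dvd 2 ^ L'" using i L by (simp add: le_imp_power_dvd)
        then have gcd: "gcd g (2 ^ L') = g" by (simp add: gcd_nat.absorb1)
        have K: "(\<Sum>i<2 ^ 2. \<Sum>j<2 ^ 2. of_bool (int 1 dvd int i - int j) *
          (norm (digital_transform 2 a 2 (\<theta> + real i / real 2 ^ 2)) *
           norm (digital_transform 2 a 2 (\<theta> + real j / real 2 ^ 2)))) \<le> 4 * \<gamma>\<^sup>2" for \<theta>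
          using sum_two_binary_kernels_le[of a \<theta>] \<gamma>(3) by (simp add: power2_eq_square sum_product)
        have "class_energy 2 a (2 + L') g \<le> 4 * \<gamma>\<^sup>2 * class_energy 2 (\<lambda>i. a (2 + i)) L' (gcd g (2 ^ L'))"
          by (rule class_energy_step[OF _ _ _ K]) (use less.prems L gcd in auto)
        also have "\<dots> \<le> 4 * \<gamma>\<^sup>2 * (1 / \<gamma> * (2 ^ L' / real g * \<gamma> ^ (L' - J)))"
          unfolding gcd using False L g less.prems by (intro mult_left_mono less.hyps) auto
        also have "\<dots> = 1 / \<gamma> * (2 ^ L / real g * \<gamma> ^ (L - J))"
        proof -
          have "L - J = 2 + (L' - J)" using L by simp
          then show ?thesis by (simp only: power_add L(1)) (simp add: mult_ac)
        qed
        finally show ?thesis by (simp add: L)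
      qed
    qed
    then show "class_energy 2 a L g \<le> 1 / \<gamma> * (2 ^ L / real g * (1 - (1 - \<gamma>)) ^ (L - J))" by simp
  qed (use \<gamma> in auto)
qed

lemma class_energy_le:
  fixes b :: nat
  assumes "b \<ge> 2"
  obtains \<delta> C where "0 < \<delta>" "\<delta> < 1" "C \<ge> 1"
    and "\<And>a L J g. g dvd b ^ L \<Longrightarrow> \<not> b ^ J dvd g \<Longrightarrow> J \<le> L \<Longrightarrow>
      class_energy b a L g \<le> C * (real b ^ L / real g * (1 - \<delta>) ^ (L - J))"
proof (cases "b = 2")
  case True
  then show ?thesis using class_energy_le_base_2 that by (metis of_nat_numeral)
next
  case False
  then have "b \<ge> 3" using assms by simp
  from class_energy_le_base_ge_3[OF this] show ?thesis using that[of _ 1] by (metis mult_1 order_refl)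
qed

section \<open>Sums over multiples of a small modulus\<close>

lemma norm_sum_interval_le_iota:
  assumes "j \<le> Q" "Q > 0"
  shows "norm (\<Sum>n\<in>{i..<j}. f n) \<le> (\<Sum>z<Q. iota Q z * norm (\<Sum>n<Q. f n * ee (real z * real n / real Q)))"
proof -
  obtain H where H: "\<And>m. m < Q \<Longrightarrow> (\<Sum>z<Q. H z * ee (real z * real m / real Q)) = of_bool (m \<in> {i..<j})"
    and Hn: "\<And>z. z < Q \<Longrightarrow> norm (H z) \<le> iota Q z"
    using interval_indicator_expansion[OF assms(1,2)] by blast
  have "(\<Sum>n\<in>{i..<j}. f n) = (\<Sum>n<Q. of_bool (n \<in> {i..<j}) * f n)"
    using assms(1) by (intro sum.mono_neutral_cong_left) auto
  also have "\<dots> = (\<Sum>n<Q. \<Sum>z<Q. H z * (f n * ee (real z * real n / real Q)))"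
  proof (intro sum.cong refl)
    fix n assume "n \<in> {..<Q}"
    then have "of_bool (n \<in> {i..<j}) * f n = (\<Sum>z<Q. H z * ee (real z * real n / real Q)) * f n"
      by (simp only: H lessThan_iff)
    also have "\<dots> = (\<Sum>z<Q. H z * (f n * ee (real z * real n / real Q)))"
      unfolding sum_distrib_right by (intro sum.cong refl) (simp only: mult_ac)
    finally show "of_bool (n \<in> {i..<j}) * f n = (\<Sum>z<Q. H z * (f n * ee (real z * real n / real Q)))" .
  qed
  also have "\<dots> = (\<Sum>z<Q. H z * (\<Sum>n<Q. f n * ee (real z * real n / real Q)))"
    by (subst sum.swap) (simp add: sum_distrib_left)
  finally have eq: "(\<Sum>n\<in>{i..<j}. f n) = (\<Sum>z<Q. H z * (\<Sum>n<Q. f n * ee (real z * real n / real Q)))" .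
  show ?thesis
    unfolding eq using Hn by (intro sum_norm_le) (auto simp: norm_mult intro!: mult_right_mono)
qed

lemma norm_sum_interval_le:
  assumes "j \<le> Q" "Q > 0"
    and "\<And>z. z < Q \<Longrightarrow> norm (\<Sum>n<Q. f n * ee (real z * real n / real Q)) \<le> B"
  shows "norm (\<Sum>n\<in>{i..<j}. f n) \<le> (3 + 2 * ln (real Q)) * B"
proof -
  have "B \<ge> 0" using assms(3)[of 0] assms(2) norm_ge_zero order.trans by blast
  have "norm (\<Sum>n\<in>{i..<j}. f n) \<le> (\<Sum>z<Q. iota Q z * norm (\<Sum>n<Q. f n * ee (real z * real n / real Q)))"
    by (rule norm_sum_interval_le_iota[OF assms(1,2)])
  also have "\<dots> \<le> (\<Sum>z<Q. iota Q z * B)"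
    by (intro sum_mono mult_left_mono) (auto simp: assms(3) iota_nonneg)
  also have "\<dots> = (\<Sum>z<Q. iota Q z) * B" by (simp add: sum_distrib_right)
  also have "\<dots> \<le> (3 + 2 * ln (real Q)) * B"
    using \<open>B \<ge> 0\<close> assms by (intro mult_right_mono sum_iota_le) auto
  finally show ?thesis .
qed

lemma norm_sum_multiples_le:
  assumes "d > 0"
  shows "norm (\<Sum>n<N. of_bool (d dvd n) * f n)
    \<le> (\<Sum>i<d. norm (\<Sum>n<N. f n * ee (- (real n * (real i / real d))))) / real d"
proof -
  have ind: "of_bool (d dvd n) = (\<Sum>i<d. ee (- (real n * (real i / real d)))) / of_nat d" for n
    using sum_ee_orthogonality[OF assms, of "- int n"] assms by (simp add: mult.commute)
  have "(\<Sum>n<N. of_bool (d dvd n) * f n) = (\<Sum>n<N. \<Sum>i<d. f n * ee (- (real n * (real i / real d)))) / of_nat d"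
    unfolding ind sum_divide_distrib[symmetric] sum_distrib_left
    by (simp add: sum_divide_distrib sum_distrib_left sum_distrib_right mult.commute)
  also have "\<dots> = (\<Sum>i<d. \<Sum>n<N. f n * ee (- (real n * (real i / real d)))) / of_nat d"
    by (subst sum.swap) simp
  finally show ?thesis
    by (simp add: norm_divide divide_right_mono norm_sum)
qed

text \<open>Restricting to \<open>n\<close> coprime to \<open>b\<close> makes every divisor of \<open>n\<close> coprime to \<open>b\<close>. The restriction
  concerns the lowest digit, so it only perturbs the frequency by multiples of \<open>1 / b\<close>.\<close>

lemma norm_sum_coprime_le:
  assumes "b > 0" and B: "\<And>\<theta>. norm (\<Sum>n<N. f n * ee (real n * \<theta>)) \<le> B"
  shows "norm (\<Sum>n<N. of_bool (coprime n b) * f n) \<le> real b * B"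
proof -
  define R where "R = {e. e < b \<and> coprime e b}"
  have R: "finite R" "card R \<le> b"
    unfolding R_def using card_mono[of "{..<b}" "{e. e < b \<and> coprime e b}"] by auto
  have "B \<ge> 0" using B[of 0] norm_ge_zero order.trans by blast
  have ind: "of_bool (coprime n b) = (\<Sum>e\<in>R. of_bool (int b dvd int n - int e) :: complex)" for n
  proof -
    have eq: "int b dvd int n - int e \<longleftrightarrow> e = n mod b" if "e \<in> R" for e
      using that assms by (auto simp: R_def mod_eq_dvd_iff[symmetric] simp flip: of_nat_mod)
    have "(\<Sum>e\<in>R. of_bool (int b dvd int n - int e) :: complex) = (\<Sum>e\<in>R. if e = n mod b then 1 else 0)"
      by (intro sum.cong refl) (simp add: eq)
    also have "\<dots> = of_bool (n mod b \<in> R)"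
      using R by simp
    also have "n mod b \<in> R \<longleftrightarrow> coprime n b"
      using assms by (simp add: R_def coprime_commute[of _ b] coprime_mod_right_iff)
    finally show ?thesis by simp
  qed
  have each: "norm (\<Sum>n<N. of_bool (int b dvd int n - int e) * f n) \<le> B" for e
  proof -
    have ind2: "of_bool (int b dvd int n - int e)
        = (\<Sum>i<b. ee (real n * (real i / real b)) * ee (- (real i * real e / real b))) / of_nat b" for n
      using sum_ee_orthogonality[OF assms(1), of "int n - int e"] assms
      by (simp add: ee_add[symmetric] algebra_simps diff_divide_distrib)
    have "(\<Sum>n<N. of_bool (int b dvd int n - int e) * f n)
       = (\<Sum>n<N. \<Sum>i<b. ee (- (real i * real e / real b)) * (f n * ee (real n * (real i / real b)))) / of_nat b"
      unfolding ind2 by (simp add: sum_divide_distrib sum_distrib_right sum_distrib_left mult_ac)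
    also have "\<dots> = (\<Sum>i<b. ee (- (real i * real e / real b)) * (\<Sum>n<N. f n * ee (real n * (real i / real b)))) / of_nat b"
      by (subst sum.swap) (simp add: sum_distrib_left)
    also have "norm \<dots> \<le> (\<Sum>i<b. B) / real b"
      unfolding norm_divide norm_of_nat
      by (intro divide_right_mono sum_norm_le) (auto simp: norm_mult simp del: times_divide_eq_right intro!: B)
    finally show ?thesis using assms by simp
  qed
  have "(\<Sum>n<N. of_bool (coprime n b) * f n) = (\<Sum>e\<in>R. \<Sum>n<N. of_bool (int b dvd int n - int e) * f n)"
    unfolding ind sum_distrib_right by (rule sum.swap)
  also have "norm \<dots> \<le> (\<Sum>e\<in>R. B)"
    by (intro sum_norm_le each)
  also have "\<dots> \<le> real b * B"
    using R \<open>B \<ge> 0\<close> by (simp add: mult_right_mono)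
  finally show ?thesis .
qed

lemma sum_multiply_residues:
  fixes g :: "nat \<Rightarrow> 'a :: comm_monoid_add"
  assumes "coprime c d" and "\<And>x. g (x mod d) = g x"
  shows "(\<Sum>i<d. g (c * i)) = (\<Sum>i<d. g i)"
proof (cases "d = 0")
  case False
  have "inj_on (\<lambda>i. c * i mod d) {..<d}"
  proof (rule inj_onI)
    fix x y assume "x \<in> {..<d}" "y \<in> {..<d}" "c * x mod d = c * y mod d"
    then have "[c * x = c * y] (mod d)" by (simp add: cong_def)
    then have "[x = y] (mod d)" using assms(1) by (simp add: cong_mult_lcancel_nat)
    then show "x = y" using \<open>x \<in> {..<d}\<close> \<open>y \<in> {..<d}\<close> by (simp add: cong_def)
  qed
  then have bij: "bij_betw (\<lambda>i. c * i mod d) {..<d} {..<d}"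
    using False by (intro bij_betw_imageI endo_inj_surj) auto
  have "(\<Sum>i<d. g (c * i)) = (\<Sum>i<d. g (c * i mod d))" by (simp add: assms(2))
  also have "\<dots> = (\<Sum>i<d. g i)"
    by (rule sum.reindex_bij_betw[OF bij])
  finally show ?thesis .
qed simp

text \<open>Two disjoint blocks of \<open>J\<close> digits are each square-summable over the fractions with
  denominator \<open>d \<approx> b^J\<close>, the second because \<open>b^J\<close> permutes the residues modulo \<open>d\<close>. Their
  product is therefore summable with a bounded sum, and the other digits supply the decay.\<close>

lemma sum_digital_transform_fractions_le:
  assumes b: "b \<ge> 2" and d: "coprime d b" "b ^ J \<le> d" "d < b ^ Suc J" and J: "2 * J \<le> l"
    and E: "\<And>k L \<theta>. k + L \<le> l \<Longrightarrow> norm (digital_transform b (\<lambda>i. a (k + i)) L \<theta>) \<le> E L"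
  shows "(\<Sum>i<d. norm (digital_transform b a l (\<theta> + real i / real d))) \<le> real b * E (l - 2 * J)"
proof -
  have dpos: "d > 0" using d(2) b by (metis gr0I less_irrefl not_less_eq_eq zero_less_power le_0_eq zero_less_numeral order_less_le_trans)
  define F1 where "F1 i = norm (digital_transform b a J (\<theta> + real i / real d))" for i
  define F2 where "F2 i = norm (digital_transform b (\<lambda>i. a (J + i)) J (real b ^ J * \<theta> + real i / real d))" for i :: nat
  have ratio: "real d / real b ^ J \<le> real b"
  proof -
    have "real d \<le> real (b ^ Suc J)" using d(3) by (simp only: of_nat_le_iff less_imp_le)
    then show ?thesis using b by (simp add: divide_le_eq)
  qed
  have s1: "(\<Sum>i<d. (F1 i)\<^sup>2) \<le> real b"
    unfolding F1_def using parseval_digital[of b J d a \<theta>] b d ratio by simp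
  have "F2 (i mod d) = F2 i" for i
  proof -
    have "real i = real (i mod d) + real d * real (i div d)"
      by (metis add.commute mult_div_mod_eq of_nat_add of_nat_mult)
    then have "real b ^ J * \<theta> + real i / real d = real b ^ J * \<theta> + real (i mod d) / real d + of_int (int (i div d))"
      using dpos by (simp add: field_simps)
    then show ?thesis by (simp only: F2_def digital_transform_add_int)
  qed
  then have "(\<Sum>i<d. (F2 (b ^ J * i))\<^sup>2) = (\<Sum>i<d. (F2 i)\<^sup>2)"
    using d(1) by (intro sum_multiply_residues) (auto simp: coprime_commute)
  also have "\<dots> \<le> real b"
    unfolding F2_def using parseval_digital[of b J d "\<lambda>i. a (J + i)" "real b ^ J * \<theta>"] b d ratio by simp
  finally have s2: "(\<Sum>i<d. (F2 (b ^ J * i))\<^sup>2) \<le> real b" .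
  have Epos: "E (l - 2 * J) \<ge> 0"
    using E[of 0 "l - 2 * J" 0] norm_ge_zero order.trans by (metis add_0 diff_le_self)
  have "norm (digital_transform b a l (\<theta> + real i / real d)) \<le> (F1 i * F2 (b ^ J * i)) * E (l - 2 * J)" for i
  proof -
    have l: "l = J + (J + (l - 2 * J))" using J by simp
    have arg: "real b ^ J * (\<theta> + real i / real d) = real b ^ J * \<theta> + real (b ^ J * i) / real d"
      by (simp add: algebra_simps)
    have "norm (digital_transform b a l (\<theta> + real i / real d)) = F1 i * (F2 (b ^ J * i) *
       norm (digital_transform b (\<lambda>i. a (2 * J + i)) (l - 2 * J) (real b ^ J * (real b ^ J * (\<theta> + real i / real d)))))"
      by (subst l) (simp add: digital_transform_split norm_mult F1_def F2_def arg add.assoc mult_2)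
    also have "\<dots> \<le> F1 i * (F2 (b ^ J * i) * E (l - 2 * J))"
      using J by (intro mult_left_mono E) (auto simp: F1_def F2_def)
    finally show ?thesis by (simp add: mult_ac)
  qed
  then have "(\<Sum>i<d. norm (digital_transform b a l (\<theta> + real i / real d)))
      \<le> (\<Sum>i<d. (F1 i * F2 (b ^ J * i)) * E (l - 2 * J))"
    by (intro sum_mono)
  also have "\<dots> \<le> (\<Sum>i<d. (((F1 i)\<^sup>2 + (F2 (b ^ J * i))\<^sup>2) / 2) * E (l - 2 * J))"
    using Epos by (intro sum_mono mult_right_mono mult_le_half_squares)
  also have "\<dots> = ((\<Sum>i<d. (F1 i)\<^sup>2) + (\<Sum>i<d. (F2 (b ^ J * i))\<^sup>2)) / 2 * E (l - 2 * J)"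
    by (simp add: sum.distrib flip: sum_distrib_right sum_divide_distrib)
  also have "\<dots> \<le> real b * E (l - 2 * J)"
    using s1 s2 Epos by (intro mult_right_mono) auto
  finally show ?thesis .
qed

lemma norm_sum_digital_char_multiples_le:
  assumes b: "b \<ge> 2" and d: "coprime d b" "b ^ J \<le> d" "d < b ^ Suc J" and J: "2 * J \<le> l"
    and E: "\<And>k L \<theta>. k + L \<le> l \<Longrightarrow> norm (digital_transform b (\<lambda>i. a (k + i)) L \<theta>) \<le> E L"
    and X: "X1 \<le> b ^ l"
  shows "norm (\<Sum>n\<in>{X0..<X1}. of_bool (d dvd n) * of_bool (coprime n b) * digital_char b a l n)
    \<le> (3 + 2 * ln (real b ^ l)) * ((real b)\<^sup>2 * real b ^ l / real d * E (l - 2 * J))"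
proof -
  define N where "N = b ^ l"
  have N: "N > 0" using b by (simp add: N_def)
  have dpos: "d > 0" using d(2) b by (metis gr0I less_irrefl not_less_eq_eq zero_less_power le_0_eq zero_less_numeral order_less_le_trans)
  define B where "B = real N / real d * (real b * E (l - 2 * J))"
  have 1: "norm (\<Sum>n<N. of_bool (d dvd n) * (digital_char b a l n * ee (real n * \<theta>))) \<le> B" for \<theta>
  proof -
    have "norm (\<Sum>n<N. of_bool (d dvd n) * (digital_char b a l n * ee (real n * \<theta>)))
      \<le> (\<Sum>i<d. norm (\<Sum>n<N. digital_char b a l n * ee (real n * \<theta>) * ee (- (real n * (real i / real d))))) / real d"
      by (rule norm_sum_multiples_le[OF dpos])
    also have "\<dots> = (\<Sum>i<d. norm (of_nat N * digital_transform b a l (- \<theta> + real i / real d))) / real d"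
    proof -
      have "ee (real n * \<theta>) * ee (- (real n * (real i / real d))) = ee (- (real n * (- \<theta> + real i / real d)))" for n i
        by (subst ee_add[symmetric]) (simp add: algebra_simps)
      moreover have "b > 0" using b by simp
      ultimately have "(\<Sum>n<N. digital_char b a l n * ee (real n * \<theta>) * ee (- (real n * (real i / real d))))
          = of_nat N * digital_transform b a l (- \<theta> + real i / real d)" for i
        unfolding N_def by (simp only: mult.assoc sum_digital_char_ee)
      then show ?thesis by (simp only:)
    qed
    also have "(\<Sum>i<d. norm (of_nat N * digital_transform b a l (- \<theta> + real i / real d))) / real d
        = real N / real d * (\<Sum>i<d. norm (digital_transform b a l (- \<theta> + real i / real d)))"
      by (simp add: norm_mult sum_distrib_left sum_divide_distrib)
    also have "\<dots> \<le> B"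
      unfolding B_def by (intro mult_left_mono sum_digital_transform_fractions_le b d J E) auto
    finally show ?thesis .
  qed
  have "norm (\<Sum>n\<in>{X0..<X1}. of_bool (d dvd n) * of_bool (coprime n b) * digital_char b a l n) \<le> (3 + 2 * ln (real N)) * (real b * B)"
  proof (rule norm_sum_interval_le)
    fix z
    have "norm (\<Sum>n<N. of_bool (coprime n b) * (of_bool (d dvd n) * digital_char b a l n * ee (real z * real n / real N))) \<le> real b * B"
    proof (rule norm_sum_coprime_le)
      fix \<theta>
      have "(\<Sum>n<N. of_bool (d dvd n) * digital_char b a l n * ee (real z * real n / real N) * ee (real n * \<theta>))
         = (\<Sum>n<N. of_bool (d dvd n) * (digital_char b a l n * ee (real n * (real z / real N + \<theta>))))"
        by (simp add: ee_add algebra_simps)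
      then show "norm (\<Sum>n<N. of_bool (d dvd n) * digital_char b a l n * ee (real z * real n / real N) * ee (real n * \<theta>)) \<le> B"
        using 1[of "real z / real N + \<theta>"] by (simp only:)
    qed (use b in auto)
    then show "norm (\<Sum>n<N. of_bool (d dvd n) * of_bool (coprime n b) * digital_char b a l n * ee (real z * real n / real N)) \<le> real b * B"
      by (simp only: mult.assoc mult.left_commute[of "of_bool (coprime _ b)" "of_bool (d dvd _)"])
  qed (use X N in \<open>auto simp: N_def\<close>)
  then show ?thesis by (simp add: B_def N_def power2_eq_square mult_ac)
qed

section \<open>Correlations of a digital character along two progressions\<close>

text \<open>The left-hand side is \<open>gcd w Q\<close> or zero. Summing over all divisors \<open>g\<close> instead of singling out
  the greatest one lets the sums over \<open>w\<close> and \<open>y\<close> be estimated for each \<open>g\<close> separately.\<close>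

lemma sum_linear_congruence_le:
  assumes "Q > 0"
  shows "(\<Sum>k<Q. of_bool (int Q dvd w * int k + y))
    \<le> (\<Sum>g | g dvd Q. real g * (of_bool (int g dvd w) * of_bool (int g dvd y)) :: real)"
proof (cases "\<exists>k. int Q dvd w * int k + y")
  case True
  then obtain k0 where k0: "int Q dvd w * int k0 + y" by blast
  define g where "g = nat (gcd w (int Q))"
  have g: "int g = gcd w (int Q)" by (simp add: g_def)
  have g0: "int g > 0" unfolding g using assms by simp
  obtain Q' where Q': "Q = g * Q'"
  proof -
    have "int g dvd int Q" unfolding g by simp
    then have "g dvd Q" by simp
    then show ?thesis using that by (elim dvdE)
  qed
  obtain w' where w': "w = int g * w'"
  proof -
    have "int g dvd w" unfolding g by simp
    then show ?thesis using that by (elim dvdE)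
  qed
  have cop: "coprime w' (int Q')"
  proof -
    have "int g * gcd w' (int Q') = gcd (int g * w') (int g * int Q')"
      using gcd_mult_distrib_int[of "int g" w' "int Q'"] by simp
    also have "\<dots> = int g" unfolding g[symmetric] using g by (simp add: Q' w')
    finally have "int g * gcd w' (int Q') = int g * 1" by simp
    then have "gcd w' (int Q') = 1" using g0 by (metis less_irrefl mult_cancel_left)
    then show ?thesis by (rule gcd_eq_1_imp_coprime)
  qed
  have "int g dvd y"
  proof -
    have "int g dvd int Q" using Q' by simp
    then have "int g dvd w * int k0 + y" using k0 by (rule dvd_trans)
    moreover have "int g dvd w * int k0" using w' by simp
    ultimately show ?thesis by (simp add: dvd_add_right_iff)
  qed
  have imp: "int Q' dvd int k0 - int k" if "int Q dvd w * int k + y" for k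
  proof -
    have "int Q dvd (w * int k0 + y) - (w * int k + y)" using k0 that by (rule dvd_diff)
    then have "int g * int Q' dvd int g * (w' * (int k0 - int k))"
      by (simp add: Q' w' algebra_simps)
    then have "int Q' dvd w' * (int k0 - int k)" using g0 by simp
    then show ?thesis using cop by (simp add: coprime_dvd_mult_right_iff coprime_commute)
  qed
  have "(\<Sum>k<Q. of_bool (int Q dvd w * int k + y)) \<le> (\<Sum>k<Q. of_bool (int Q' dvd int k0 - int k) :: real)"
    using imp by (intro sum_mono) (simp add: of_bool_less_eq_iff)
  also have "\<dots> = real Q / real Q'"
    using assms Q' by (intro sum_of_bool_class_card) auto
  also have "\<dots> = real g"
    using assms by (simp add: Q')
  also have "\<dots> = (\<Sum>g\<in>{g}. real g * (of_bool (int g dvd w) * of_bool (int g dvd y)))"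
    using w' \<open>int g dvd y\<close> by simp
  also have "\<dots> \<le> (\<Sum>g | g dvd Q. real g * (of_bool (int g dvd w) * of_bool (int g dvd y)))"
    using assms Q' by (intro sum_mono2) auto
  finally show ?thesis .
next
  case False
  then have "(\<Sum>k<Q. of_bool (int Q dvd w * int k + y)) = (0 :: real)" by simp
  then show ?thesis by (simp add: sum_nonneg)
qed

text \<open>Modulo 1, the arguments of the last \<open>J\<close> kernels depend only on the frequency modulo \<open>b^J\<close>; these
  kernels give the factor \<open>E\<^sup>2\<close>, and Parseval sums the others to \<open>1\<close>.\<close>

lemma digital_transform_class_mass_le:
  assumes b: "b \<ge> 2" and E: "\<And>\<theta>. norm (digital_transform b (\<lambda>i. a (M + i)) J \<theta>) \<le> E"
  shows "(\<Sum>h<b ^ (M + J). of_bool (int (b ^ J) dvd int h - int s) *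
    (norm (digital_transform b a (M + J) (real h / real b ^ (M + J))))\<^sup>2) \<le> E\<^sup>2"
proof -
  define B where "B = b ^ J"
  define s0 where "s0 = s mod B"
  have B: "B > 0" using b by (simp add: B_def)
  have E0: "E \<ge> 0" using E norm_ge_zero order.trans by blast
  define F where "F h = norm (digital_transform b a M (real h / real b ^ (M + J)))" for h :: nat
  have le: "norm (digital_transform b a (M + J) (real h / real b ^ (M + J))) \<le> F h * E" for h
    unfolding digital_transform_split norm_mult F_def by (intro mult_left_mono E) auto
  have eq: "int B dvd int (n + B * i) - int s \<longleftrightarrow> n = s0" if "n < B" for n i
  proof -
    have "int B dvd int (n + B * i) - int s \<longleftrightarrow> (n + B * i) mod B = s mod B"
      by (metis mod_eq_dvd_iff of_nat_eq_iff zmod_int)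
    then show ?thesis using that by (simp add: s0_def)
  qed
  have "(\<Sum>h<b ^ (M + J). of_bool (int (b ^ J) dvd int h - int s) *
      (norm (digital_transform b a (M + J) (real h / real b ^ (M + J))))\<^sup>2)
    \<le> (\<Sum>h<b ^ (M + J). of_bool (int B dvd int h - int s) * (F h * E)\<^sup>2)"
    unfolding B_def by (intro sum_mono mult_left_mono power_mono le) auto
  also have "\<dots> = (\<Sum>h<B * b ^ M. of_bool (int B dvd int h - int s) * (F h * E)\<^sup>2)"
    by (simp add: B_def power_add mult.commute)
  also have "\<dots> = (\<Sum>i<b ^ M. \<Sum>n<B. of_bool (int B dvd int (n + B * i) - int s) * (F (n + B * i) * E)\<^sup>2)"
    by (rule sum_lessThan_mult)
  also have "\<dots> = (\<Sum>i<b ^ M. \<Sum>n<B. if n = s0 then (F (n + B * i) * E)\<^sup>2 else 0)"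
    by (intro sum.cong refl) (simp only: eq lessThan_iff, simp)
  also have "\<dots> = (\<Sum>i<b ^ M. (F (s0 + B * i))\<^sup>2) * E\<^sup>2"
    using B by (simp add: s0_def power_mult_distrib sum_distrib_right)
  also have "(\<Sum>i<b ^ M. (F (s0 + B * i))\<^sup>2) = 1"
  proof -
    have "real (s0 + B * i) / real b ^ (M + J) = real s0 / real b ^ (M + J) + real i / real (b ^ M)" for i
      using b by (simp add: B_def field_simps power_add)
    then show ?thesis
      unfolding F_def using parseval_digital[of b M "b ^ M" a "real s0 / real b ^ (M + J)"] b by simp
  qed
  finally show ?thesis by simp
qed

text \<open>As \<open>s\<close> varies, the values \<open>z - s r\<close> are distinct and lie in an interval of length less than
  \<open>g r\<close>, which contains at most \<open>r\<close> multiples of \<open>g\<close>.\<close>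

lemma card_linear_congruence_le:
  assumes "r \<ge> 1" "g > 0"
  shows "card {s. s < g \<and> int g dvd z - int s * int r} \<le> r"
proof -
  define S where "S = {s. s < g \<and> int g dvd z - int s * int r}"
  define f where "f s = (z - int s * int r) div int g" for s :: nat
  have f: "f s * int g = z - int s * int r" if "s \<in> S" for s
    using that by (simp add: S_def f_def)
  have "inj_on f S"
  proof (rule inj_onI)
    fix s t assume "s \<in> S" "t \<in> S" "f s = f t"
    then have "int s * int r = int t * int r" using f by (smt (verit))
    then show "s = t" using assms by simp
  qed
  moreover have "f ` S \<subseteq> {z div int g - int r<..z div int g}"
  proof
    fix t assume "t \<in> f ` S"
    then obtain s where s: "s \<in> S" "t = f s" by blast
    have t: "t * int g = z - int s * int r" using f s by simp
    have lo: "z - int g * int r < t * int g"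
    proof -
      have "int s * int r < int g * int r"
        using s assms by (intro mult_strict_right_mono) (auto simp: S_def)
      then show ?thesis using t by linarith
    qed
    have "t \<le> z div int g"
    proof -
      have "t * int g \<le> z" using t by simp
      then show ?thesis using assms by (metis nonzero_mult_div_cancel_right of_nat_0_less_iff zdiv_mono1 less_irrefl)
    qed
    moreover have "z div int g - int r < t"
    proof -
      have "(z div int g) * int g \<le> z"
        using assms by (metis add.commute div_mult_mod_eq le_add_same_cancel1 of_nat_0_less_iff pos_mod_sign)
      then have "(z div int g - int r) * int g < t * int g"
        using lo by (simp only: left_diff_distrib mult.commute[of "int r"])
      then show ?thesis using assms by simp
    qed
    ultimately show "t \<in> {z div int g - int r<..z div int g}" by simp
  qed
  ultimately have "card S \<le> card {z div int g - int r<..z div int g}"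
    by (metis card_inj_on_le finite_greaterThanAtMost_int)
  then show ?thesis by (simp add: S_def)
qed

text \<open>The key dichotomy. If \<open>b^J\<close> does not divide \<open>g\<close>, the energy gap applies. If it does, the second
  condition leaves at most \<open>r\<close> classes modulo \<open>g\<close>, and each of them carries little mass because
  the product of the last \<open>J\<close> kernels is constant on it and small.\<close>

lemma restricted_class_energy_le:
  assumes b: "b \<ge> 2" and g: "g dvd b ^ L" and J: "J \<le> L" and r: "r \<ge> 1"
    and gap: "\<not> b ^ J dvd g \<Longrightarrow> class_energy b a L g \<le> real b ^ L / real g * D"
    and E: "\<And>\<theta>. norm (digital_transform b (\<lambda>i. a (L - J + i)) J \<theta>) \<le> E"
    and \<Omega>: "D \<le> \<Omega>" "real r * E\<^sup>2 \<le> \<Omega>"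
  shows "real g * (\<Sum>h<b ^ L. \<Sum>l<b ^ L. of_bool (int g dvd int h - int l) * of_bool (int g dvd z - int l * int r) *
     (norm (digital_transform b a L (real h / real b ^ L)) * norm (digital_transform b a L (real l / real b ^ L))))
    \<le> real b ^ L * \<Omega>"
proof -
  have gpos: "g > 0" by (rule dvd_pos_nat[OF _ g]) (use b in simp)
  define Q where "Q = b ^ L"
  define F where "F h = norm (digital_transform b a L (real h / real b ^ L))" for h :: nat
  show ?thesis
  proof (cases "b ^ J dvd g")
    case False
    have "(\<Sum>h<Q. \<Sum>l<Q. of_bool (int g dvd int h - int l) * of_bool (int g dvd z - int l * int r) * (F h * F l))
        \<le> (\<Sum>h<Q. \<Sum>l<Q. of_bool (int g dvd int h - int l) * (F h * F l))"
      by (intro sum_mono mult_right_mono) (auto simp: F_def)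
    also have "\<dots> = class_energy b a L g"
      by (simp add: class_energy_def Q_def F_def)
    also have "\<dots> \<le> real b ^ L / real g * D" by (rule gap[OF False])
    finally have "real g * (\<Sum>h<Q. \<Sum>l<Q. of_bool (int g dvd int h - int l) * of_bool (int g dvd z - int l * int r) * (F h * F l))
       \<le> real g * (real b ^ L / real g * D)"
      by (intro mult_left_mono) auto
    also have "\<dots> = real b ^ L * D" using gpos by simp
    also have "\<dots> \<le> real b ^ L * \<Omega>" using \<Omega> by (intro mult_left_mono) auto
    finally show ?thesis by (simp add: Q_def F_def)
  next
    case True
    define A where "A = {l. l < Q \<and> int g dvd z - int l * int r}"
    define S where "S = {s. s < g \<and> int g dvd z - int s * int r}"
    have fin: "finite A" "finite S" by (auto simp: A_def S_def)
    have trans: "int g dvd z - int h * int r" if "int g dvd int h - int l" "int g dvd z - int l * int r" for h l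
    proof -
      have "int g dvd (z - int l * int r) - (int h - int l) * int r"
        using that by (metis dvd_diff dvd_mult2)
      then show ?thesis by (simp add: algebra_simps)
    qed
    have "(\<Sum>h<Q. \<Sum>l<Q. of_bool (int g dvd int h - int l) * of_bool (int g dvd z - int l * int r) * (F h * F l))
        = (\<Sum>h\<in>A. \<Sum>l\<in>A. of_bool (int g dvd int h - int l) * (F h * F l))"
    proof (rule sum.mono_neutral_cong_right)
      show "\<forall>h\<in>{..<Q} - A. (\<Sum>l<Q. of_bool (int g dvd int h - int l) * of_bool (int g dvd z - int l * int r) * (F h * F l)) = 0"
      proof
        fix h assume "h \<in> {..<Q} - A"
        then have "of_bool (int g dvd int h - int l) * of_bool (int g dvd z - int l * int r) = (0 :: real)" for l
          using trans[of h l] by (auto simp: A_def)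
        then show "(\<Sum>l<Q. of_bool (int g dvd int h - int l) * of_bool (int g dvd z - int l * int r) * (F h * F l)) = 0"
          by (simp only: mult_zero_left sum.neutral_const)
      qed
      show "(\<Sum>l<Q. of_bool (int g dvd int h - int l) * of_bool (int g dvd z - int l * int r) * (F h * F l))
        = (\<Sum>l\<in>A. of_bool (int g dvd int h - int l) * (F h * F l))" for h
        by (intro sum.mono_neutral_cong_right) (auto simp: A_def)
    qed (auto simp: A_def)
    also have "\<dots> \<le> real Q / real g * (\<Sum>h\<in>A. (F h)\<^sup>2)"
    proof (rule sum_symmetric_relation_le)
      fix h
      have "(\<Sum>l\<in>A. of_bool (int g dvd int h - int l)) \<le> (\<Sum>l<Q. of_bool (int g dvd int h - int l) :: real)"
        by (intro sum_mono2) (auto simp: A_def)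
      also have "\<dots> = real Q / real g"
        using g b by (intro sum_of_bool_class_card) (auto simp: Q_def)
      finally show "(\<Sum>l\<in>A. of_bool (int g dvd int h - int l)) \<le> real Q / real g" .
    qed (auto simp: dvd_diff_commute fin)
    also have "\<dots> \<le> real Q / real g * \<Omega>"
    proof (rule mult_left_mono)
      have mem: "h mod g \<in> S \<and> int (b ^ J) dvd int h - int (h mod g)" if "h \<in> A" for h
      proof -
        have *: "int g dvd int h - int (h mod g)"
          by (metis dvd_minus_mod of_nat_diff mod_less_eq_dividend int_dvd_int_iff)
        have "int (b ^ J) dvd int g" using True by (simp only: int_dvd_int_iff)
        then have "int (b ^ J) dvd int h - int (h mod g)" using * by (rule dvd_trans)
        moreover have "int g dvd z - int (h mod g) * int r"
          using trans[of "h mod g" h] * that by (simp add: A_def dvd_diff_commute)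
        ultimately show ?thesis using gpos by (simp add: S_def)
      qed
      have "(\<Sum>h\<in>A. (F h)\<^sup>2) \<le> (\<Sum>h\<in>A. \<Sum>s\<in>S. of_bool (int (b ^ J) dvd int h - int s) * (F h)\<^sup>2)"
      proof (intro sum_mono)
        fix h assume "h \<in> A"
        then have "(F h)\<^sup>2 = of_bool (int (b ^ J) dvd int h - int (h mod g)) * (F h)\<^sup>2" "h mod g \<in> S"
          using mem by auto
        moreover have "of_bool (int (b ^ J) dvd int h - int (h mod g)) * (F h)\<^sup>2
            \<le> (\<Sum>s\<in>S. of_bool (int (b ^ J) dvd int h - int s) * (F h)\<^sup>2)"
          using \<open>h mod g \<in> S\<close> fin by (intro member_le_sum) auto
        ultimately show "(F h)\<^sup>2 \<le> (\<Sum>s\<in>S. of_bool (int (b ^ J) dvd int h - int s) * (F h)\<^sup>2)"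
          by (simp only:)
      qed
      also have "\<dots> \<le> (\<Sum>h<Q. \<Sum>s\<in>S. of_bool (int (b ^ J) dvd int h - int s) * (F h)\<^sup>2)"
        by (intro sum_mono2) (auto simp: A_def intro!: sum_nonneg)
      also have "\<dots> = (\<Sum>s\<in>S. \<Sum>h<Q. of_bool (int (b ^ J) dvd int h - int s) * (F h)\<^sup>2)"
        by (rule sum.swap)
      also have "\<dots> \<le> (\<Sum>s\<in>S. E\<^sup>2)"
        using digital_transform_class_mass_le[OF b E] J by (intro sum_mono) (simp add: Q_def F_def)
      also have "\<dots> \<le> real r * E\<^sup>2"
        using card_linear_congruence_le[OF r gpos, of z] by (simp add: S_def mult_right_mono)
      finally show "(\<Sum>h\<in>A. (F h)\<^sup>2) \<le> \<Omega>" using \<Omega> by simp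
    qed simp
    finally have "real g * (\<Sum>h<Q. \<Sum>l<Q. of_bool (int g dvd int h - int l) * of_bool (int g dvd z - int l * int r) * (F h * F l))
        \<le> real g * (real Q / real g * \<Omega>)"
      by (rule mult_left_mono) simp
    then show ?thesis using gpos by (simp add: Q_def F_def)
  qed
qed

text \<open>After completion of the sum over \<open>n\<close>, the frequencies \<open>h\<close> and \<open>l\<close> of the two factors at the
  twist \<open>z\<close> contribute only if \<open>(h - l) k + z - l r\<close> is divisible by \<open>Q\<close>. With \<open>g = gcd (h - l) Q\<close>,
  this happens for at most \<open>g\<close> values of \<open>k\<close> per period, and none unless \<open>g\<close> divides \<open>z - l r\<close>.\<close>

lemma sum_correlation_le:
  assumes b: "b \<ge> 2" and J: "J \<le> L" and r: "r \<ge> 1"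
    and gap: "\<And>g. g dvd b ^ L \<Longrightarrow> \<not> b ^ J dvd g \<Longrightarrow> class_energy b a L g \<le> real b ^ L / real g * D"
    and E: "\<And>\<theta>. norm (digital_transform b (\<lambda>i. a (L - J + i)) J \<theta>) \<le> E"
    and \<Omega>: "D \<le> \<Omega>" "real r * E\<^sup>2 \<le> \<Omega>"
    and j: "\<And>k. j k \<le> b ^ L"
  shows "(\<Sum>k<b ^ L * m. norm (\<Sum>n\<in>{i k..<j k}. digital_char b a L (n * k) * cnj (digital_char b a L (n * (k + r)))))
    \<le> real m * (real b ^ L)\<^sup>2 * (3 + 2 * ln (real b ^ L)) * real (card {g. g dvd b ^ L}) * \<Omega>"
proof -
  define Q where "Q = b ^ L"
  have Q: "Q > 0" "real b ^ L = real Q" using b by (auto simp: Q_def)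
  define F where "F h = digital_transform b a L (real h / real Q)" for h :: nat
  define f where "f k n = digital_char b a L (n * k) * cnj (digital_char b a L (n * (k + r)))" for k n
  define c where "c k z = (\<Sum>h<Q. \<Sum>l<Q. of_bool (int Q dvd (int h - int l) * int k + (int z - int l * int r)) * (norm (F h) * norm (F l)))" for k z :: nat
  have inv: "digital_char b a L n = (\<Sum>h<Q. F h * ee (real h * real n / real Q))" for n
    unfolding F_def Q(2)[symmetric] using digital_char_inversion[of b a L n] b by (simp add: Q_def)
  have comp: "norm (\<Sum>n<Q. f k n * ee (real z * real n / real Q)) \<le> real Q * c k z" for k z
  proof -
    have "f k n * ee (real z * real n / real Q) = (\<Sum>h<Q. \<Sum>l<Q. F h * cnj (F l) *
        ee (real n * of_int ((int h - int l) * int k + (int z - int l * int r)) / real Q))" for n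
    proof -
      have "f k n * ee (real z * real n / real Q) = (\<Sum>h<Q. \<Sum>l<Q. (F h * ee (real h * real (n * k) / real Q)) *
          (cnj (F l) * ee (- (real l * real (n * (k + r)) / real Q)))) * ee (real z * real n / real Q)"
        unfolding f_def inv by (simp only: cnj_sum complex_cnj_mult cnj_ee sum_product)
      also have "\<dots> = (\<Sum>h<Q. \<Sum>l<Q. F h * cnj (F l) *
        (ee (real h * real (n * k) / real Q) * ee (- (real l * real (n * (k + r)) / real Q)) * ee (real z * real n / real Q)))"
        unfolding sum_distrib_right by (intro sum.cong refl) (simp only: mult_ac)
      moreover have "ee (real h * real (n * k) / real Q) * ee (- (real l * real (n * (k + r)) / real Q)) * ee (real z * real n / real Q)
          = ee (real n * of_int ((int h - int l) * int k + (int z - int l * int r)) / real Q)" for h l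
        unfolding ee_add[symmetric] by (rule arg_cong[of _ _ ee]) (simp add: algebra_simps add_divide_distrib diff_divide_distrib)
      ultimately show ?thesis by (simp only:)
    qed
    then have "(\<Sum>n<Q. f k n * ee (real z * real n / real Q)) = (\<Sum>h<Q. \<Sum>l<Q. \<Sum>n<Q. F h * cnj (F l) *
        ee (real n * of_int ((int h - int l) * int k + (int z - int l * int r)) / real Q))"
      by (simp only:) (rule trans[OF sum.swap sum.cong[OF refl sum.swap]])
    also have "\<dots> = (\<Sum>h<Q. \<Sum>l<Q. F h * cnj (F l) *
        (of_nat Q * of_bool (int Q dvd (int h - int l) * int k + (int z - int l * int r))))"
      by (simp only: sum_ee_orthogonality[OF Q(1)] flip: sum_distrib_left) (simp add: of_bool_def if_distrib cong: if_cong)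
    finally have eq: "(\<Sum>n<Q. f k n * ee (real z * real n / real Q)) = (\<Sum>h<Q. \<Sum>l<Q. F h * cnj (F l) *
        (of_nat Q * of_bool (int Q dvd (int h - int l) * int k + (int z - int l * int r))))" .
    have "norm (\<Sum>n<Q. f k n * ee (real z * real n / real Q)) \<le> (\<Sum>h<Q. \<Sum>l<Q. real Q *
        (of_bool (int Q dvd (int h - int l) * int k + (int z - int l * int r)) * (norm (F h) * norm (F l))))"
      unfolding eq by (intro sum_norm_le) (simp add: norm_mult)
    then show ?thesis
      unfolding c_def sum_distrib_left .
  qed
  have per: "c (k + Q * i) z = c k z" for k i z
  proof -
    have "int Q dvd (int h - int l) * int (k + Q * i) + (int z - int l * int r)
       \<longleftrightarrow> int Q dvd (int h - int l) * int k + (int z - int l * int r)" for h l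
    proof -
      have "(int h - int l) * int (k + Q * i) + (int z - int l * int r)
         = int Q * (int i * (int h - int l)) + ((int h - int l) * int k + (int z - int l * int r))"
        by (simp add: algebra_simps)
      then show ?thesis by (simp only: dvd_add_right_iff dvd_triv_left)
    qed
    then show ?thesis by (simp only: c_def)
  qed
  have cz: "(\<Sum>k<Q. c k z) \<le> real (card {g. g dvd Q}) * (real Q * \<Omega>)" for z
  proof -
    have "(\<Sum>k<Q. c k z) = (\<Sum>h<Q. \<Sum>l<Q. (\<Sum>k<Q. of_bool (int Q dvd (int h - int l) * int k + (int z - int l * int r))) * (norm (F h) * norm (F l)))"
      unfolding c_def sum_distrib_right by (rule trans[OF sum.swap sum.cong[OF refl sum.swap]])
    also have "\<dots> \<le> (\<Sum>h<Q. \<Sum>l<Q. (\<Sum>g | g dvd Q. real g * (of_bool (int g dvd int h - int l) * of_bool (int g dvd int z - int l * int r))) * (norm (F h) * norm (F l)))"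
      by (intro sum_mono mult_right_mono sum_linear_congruence_le Q) auto
    also have "\<dots> = (\<Sum>g | g dvd Q. \<Sum>h<Q. \<Sum>l<Q. real g * (of_bool (int g dvd int h - int l) * of_bool (int g dvd int z - int l * int r)) * (norm (F h) * norm (F l)))"
      unfolding sum_distrib_right
      by (rule trans[OF sum.cong[OF refl sum.swap] sum.swap])
    also have "\<dots> = (\<Sum>g | g dvd Q. real g * (\<Sum>h<Q. \<Sum>l<Q. of_bool (int g dvd int h - int l) * of_bool (int g dvd int z - int l * int r) * (norm (F h) * norm (F l))))"
      by (simp only: sum_distrib_left mult.assoc)
    also have "\<dots> \<le> (\<Sum>g | g dvd Q. real Q * \<Omega>)"
    proof (rule sum_mono)
      fix g assume "g \<in> {g. g dvd Q}"
      then have g: "g dvd b ^ L" by (simp add: Q_def)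
      show "real g * (\<Sum>h<Q. \<Sum>l<Q. of_bool (int g dvd int h - int l) * of_bool (int g dvd int z - int l * int r) * (norm (F h) * norm (F l))) \<le> real Q * \<Omega>"
        using restricted_class_energy_le[OF b g J r gap[OF g] E \<Omega>, of "int z"]
        unfolding F_def Q(2) Q_def[symmetric] by simp
    qed
    finally show ?thesis by simp
  qed
  have \<Omega>0: "\<Omega> \<ge> 0" using \<Omega>(2) by (rule order.trans[rotated]) simp
  have "(\<Sum>k<Q * m. norm (\<Sum>n\<in>{i k..<j k}. f k n)) \<le> (\<Sum>k<Q * m. \<Sum>z<Q. iota Q z * (real Q * c k z))"
  proof (rule sum_mono)
    fix k
    have "norm (\<Sum>n\<in>{i k..<j k}. f k n) \<le> (\<Sum>z<Q. iota Q z * norm (\<Sum>n<Q. f k n * ee (real z * real n / real Q)))"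
      using j Q by (intro norm_sum_interval_le_iota) (auto simp: Q_def)
    also have "\<dots> \<le> (\<Sum>z<Q. iota Q z * (real Q * c k z))"
      by (intro sum_mono mult_left_mono comp iota_nonneg)
    finally show "norm (\<Sum>n\<in>{i k..<j k}. f k n) \<le> (\<Sum>z<Q. iota Q z * (real Q * c k z))" .
  qed
  also have "\<dots> = (\<Sum>i<m. \<Sum>k<Q. \<Sum>z<Q. iota Q z * (real Q * c (k + Q * i) z))"
    by (rule sum_lessThan_mult)
  also have "\<dots> = real m * (\<Sum>k<Q. \<Sum>z<Q. iota Q z * (real Q * c k z))"
    by (simp add: per)
  also have "(\<Sum>k<Q. \<Sum>z<Q. iota Q z * (real Q * c k z)) = (\<Sum>z<Q. iota Q z * (real Q * (\<Sum>k<Q. c k z)))"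
    by (subst sum.swap) (simp add: sum_distrib_left)
  also have "\<dots> \<le> (\<Sum>z<Q. iota Q z * (real Q * (real (card {g. g dvd Q}) * (real Q * \<Omega>))))"
    by (intro sum_mono mult_left_mono cz iota_nonneg) auto
  also have "\<dots> = (\<Sum>z<Q. iota Q z) * (real Q * (real (card {g. g dvd Q}) * (real Q * \<Omega>)))"
    by (simp add: sum_distrib_right)
  also have "\<dots> \<le> (3 + 2 * ln (real Q)) * (real Q * (real (card {g. g dvd Q}) * (real Q * \<Omega>)))"
    using Q \<Omega>0 by (intro mult_right_mono sum_iota_le) auto
  finally have "(\<Sum>k<Q * m. norm (\<Sum>n\<in>{i k..<j k}. f k n)) \<le>
      real m * ((3 + 2 * ln (real Q)) * (real Q * (real (card {g. g dvd Q}) * (real Q * \<Omega>))))"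
    by (simp add: mult_left_mono)
  then show ?thesis
    unfolding f_def Q(2) Q_def[symmetric] by (simp add: power2_eq_square mult_ac)
qed

section \<open>Bilinear sums\<close>

lemma card_filter_eq_sum: "finite A \<Longrightarrow> card {x \<in> A. P x} = (\<Sum>x\<in>A. of_bool (P x))"
  by (simp add: Collect_conj_eq)

text \<open>This counts the \<open>k\<close> for which adding a number up to \<open>Y\<close> to \<open>m * k\<close> can carry past the modulus
  \<open>Q\<close>: multiples of \<open>m\<close> in \<open>P\<close> intervals of length \<open>Y\<close>.\<close>

lemma card_near_multiple_le:
  fixes m K Q P Y :: nat
  assumes "m \<ge> 1" "m * K \<le> Q * P" "Q > 0"
  shows "card {k. k < K \<and> Q \<le> (m * k) mod Q + Y} \<le> P * (Y div m + 1)"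
proof -
  define T where "T q = {k. k < K \<and> q * Q + Q \<le> m * k + Y \<and> m * k < q * Q + Q}" for q
  have fin: "finite (T q)" for q by (simp add: T_def)
  have card: "card (T q) \<le> Y div m + 1" for q
  proof (cases "T q = {}")
    case False
    define k0 where "k0 = Min (T q)"
    have k0: "k0 \<in> T q" unfolding k0_def by (rule Min_in[OF fin False])
    have "T q \<subseteq> {k0..k0 + Y div m}"
    proof
      fix k assume k: "k \<in> T q"
      then have le: "k0 \<le> k" unfolding k0_def by (rule Min_le[OF fin])
      have "m * k \<le> m * k0 + Y" using k k0 by (simp add: T_def)
      then have "m * (k - k0) \<le> Y" by (simp add: diff_mult_distrib2)
      then have "k - k0 \<le> Y div m"
        using assms(1) by (metis div_le_mono div_mult_self1_is_m less_le_trans zero_less_one)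
      then show "k \<in> {k0..k0 + Y div m}" using le by simp
    qed
    then have "card (T q) \<le> card {k0..k0 + Y div m}" by (intro card_mono) auto
    then show ?thesis by simp
  qed simp
  have "{k. k < K \<and> Q \<le> (m * k) mod Q + Y} \<subseteq> (\<Union>q<P. T q)"
  proof
    fix k assume "k \<in> {k. k < K \<and> Q \<le> (m * k) mod Q + Y}"
    then have k: "k < K" "Q \<le> (m * k) mod Q + Y" by auto
    define q where "q = m * k div Q"
    have mk: "m * k = q * Q + (m * k) mod Q" by (simp add: q_def)
    have "m * k < m * K" using k assms(1) by simp
    then have "m * k < P * Q" using assms(2) by (metis less_le_trans mult.commute)
    then have "q < P" unfolding q_def by (rule less_mult_imp_div_less)
    moreover have "k \<in> T q"
      using k mk mod_less_divisor[OF assms(3), of "m * k"] unfolding T_def by auto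
    ultimately show "k \<in> (\<Union>q<P. T q)" by blast
  qed
  then have "card {k. k < K \<and> Q \<le> (m * k) mod Q + Y} \<le> card (\<Union>q<P. T q)"
    by (intro card_mono) (auto simp: fin)
  also have "\<dots> \<le> (\<Sum>q<P. card (T q))" by (rule card_UN_le) simp
  also have "\<dots> \<le> (\<Sum>q<P. Y div m + 1)" by (intro sum_mono card)
  finally show ?thesis by simp
qed

text \<open>Unless a carry passes position \<open>L\<close>, adding \<open>y\<close> changes only the digits below \<open>L\<close>.\<close>

lemma digital_char_correlation_no_carry:
  assumes "b > 0" "L \<le> l" "n mod b ^ L + y < b ^ L"
  shows "digital_char b a l n * cnj (digital_char b a l (n + y))
    = digital_char b a L n * cnj (digital_char b a L (n + y))"
proof -
  define Q where "Q = b ^ L"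
  have "n + y = Q * (n div Q) + (n mod Q + y)" by simp
  moreover have "n mod Q + y < Q" using assms(3) by (simp add: Q_def)
  ultimately have "(n + y) div Q = n div Q"
    by (metis add.right_neutral div_less div_mult_self2 assms(1) Q_def add.commute
        less_numeral_extra(3) zero_less_power)
  then have eq: "(n + y) div b ^ L = n div b ^ L" by (simp add: Q_def)
  obtain M where M: "l = L + M" using assms(2) by (metis le_add_diff_inverse)
  define h where "h = digital_char b (\<lambda>i. a (L + i)) M (n div b ^ L)"
  have "h * cnj h = 1"
    using complex_norm_square[of h] by (simp add: h_def)
  moreover have "digital_char b a l n * cnj (digital_char b a l (n + y))
     = (digital_char b a L n * cnj (digital_char b a L (n + y))) * (h * cnj h)"
    unfolding M digital_char_split eq h_def complex_cnj_mult by (simp only: mult_ac)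
  ultimately show ?thesis by simp
qed

lemma norm_correlation_truncate_le:
  assumes "b > 0" "L \<le> l" "finite I"
  shows "norm (\<Sum>n\<in>I. digital_char b a l (n * k) * cnj (digital_char b a l (n * (k + r))))
    \<le> norm (\<Sum>n\<in>I. digital_char b a L (n * k) * cnj (digital_char b a L (n * (k + r))))
      + 2 * real (card {n \<in> I. b ^ L \<le> (n * k) mod b ^ L + n * r})"
proof -
  define D where "D n = digital_char b a l (n * k) * cnj (digital_char b a l (n * (k + r)))
      - digital_char b a L (n * k) * cnj (digital_char b a L (n * (k + r)))" for n
  have D: "norm (D n) \<le> 2 * of_bool (b ^ L \<le> (n * k) mod b ^ L + n * r)" for n
  proof (cases "b ^ L \<le> (n * k) mod b ^ L + n * r")
    case True
    have "norm (D n) \<le> 1 + 1"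
      unfolding D_def by (rule norm_triangle_le_diff) (simp add: norm_mult)
    then show ?thesis using True by simp
  next
    case False
    then have "D n = 0"
      using digital_char_correlation_no_carry[OF assms(1,2), of "n * k" "n * r" a]
      by (simp add: D_def distrib_left)
    then show ?thesis by simp
  qed
  have "norm (\<Sum>n\<in>I. D n) \<le> (\<Sum>n\<in>I. 2 * of_bool (b ^ L \<le> (n * k) mod b ^ L + n * r))"
    by (intro sum_norm_le D)
  also have "\<dots> = 2 * real (card {n \<in> I. b ^ L \<le> (n * k) mod b ^ L + n * r})"
    using assms(3) by (simp add: Collect_conj_eq flip: sum_distrib_left)
  finally have "norm (\<Sum>n\<in>I. D n) \<le> 2 * real (card {n \<in> I. b ^ L \<le> (n * k) mod b ^ L + n * r})" .
  moreover have "(\<Sum>n\<in>I. digital_char b a l (n * k) * cnj (digital_char b a l (n * (k + r))))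
     = (\<Sum>n\<in>I. digital_char b a L (n * k) * cnj (digital_char b a L (n * (k + r)))) + (\<Sum>n\<in>I. D n)"
    by (simp add: D_def sum_subtractf)
  ultimately show ?thesis
    using norm_triangle_ineq by (metis (no_types, lifting) add_left_mono order.trans)
qed

lemma sum_square_le_card:
  "(\<Sum>x\<in>A. u x)\<^sup>2 \<le> real (card A) * (\<Sum>x\<in>A. (u x)\<^sup>2)" for u :: "'a \<Rightarrow> real"
proof -
  have "(\<Sum>x\<in>A. u x)\<^sup>2 = (\<Sum>x\<in>A. \<Sum>y\<in>A. u x * u y)"
    by (simp add: power2_eq_square sum_product)
  also have "\<dots> \<le> (\<Sum>x\<in>A. \<Sum>y\<in>A. ((u x)\<^sup>2 + (u y)\<^sup>2) / 2)"
    by (intro sum_mono mult_le_half_squares)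
  also have "\<dots> = real (card A) * (\<Sum>x\<in>A. (u x)\<^sup>2)"
    by (simp add: add_divide_distrib sum.distrib sum_distrib_left sum_divide_distrib)
  finally show ?thesis .
qed

lemma norm_sum_square_le_card:
  "(norm (\<Sum>x\<in>A. f x))\<^sup>2 \<le> real (card A) * (\<Sum>x\<in>A. (norm (f x))\<^sup>2)" for f :: "'a \<Rightarrow> complex"
proof -
  have "(norm (\<Sum>x\<in>A. f x))\<^sup>2 \<le> (\<Sum>x\<in>A. norm (f x))\<^sup>2"
    by (intro power_mono norm_sum) auto
  also have "\<dots> \<le> real (card A) * (\<Sum>x\<in>A. (norm (f x))\<^sup>2)"
    by (rule sum_square_le_card)
  finally show ?thesis .
qed

lemma sum_symmetric_pairs_le:
  fixes T :: "nat \<Rightarrow> nat \<Rightarrow> real"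
  assumes "\<And>i j. T i j = T j i" "\<And>i j. T i j \<ge> 0"
  shows "(\<Sum>i<R. \<Sum>j<R. T i j) \<le> 2 * (\<Sum>i<R. \<Sum>r<R. T i (i + r))"
proof -
  have half: "(\<Sum>i<R. \<Sum>j<R. of_bool (i \<le> j) * T i j) \<le> (\<Sum>i<R. \<Sum>r<R. T i (i + r))"
  proof (rule sum_mono)
    fix i assume "i \<in> {..<R}"
    have "(\<Sum>j<R. of_bool (i \<le> j) * T i j) = (\<Sum>j\<in>{i..<R}. T i j)"
      by (intro sum.mono_neutral_cong_right) auto
    also have "\<dots> = (\<Sum>r<R - i. T i (i + r))"
      by (rule sum.reindex_bij_witness[of _ "\<lambda>r. i + r" "\<lambda>j. j - i"]) auto
    also have "\<dots> \<le> (\<Sum>r<R. T i (i + r))"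
      by (intro sum_mono2) (auto simp: assms)
    finally show "(\<Sum>j<R. of_bool (i \<le> j) * T i j) \<le> (\<Sum>r<R. T i (i + r))" .
  qed
  have "(\<Sum>i<R. \<Sum>j<R. T i j) \<le> (\<Sum>i<R. \<Sum>j<R. of_bool (i \<le> j) * T i j + of_bool (j \<le> i) * T j i)"
    using assms by (intro sum_mono) (auto simp: of_bool_def)
  also have "\<dots> = (\<Sum>i<R. \<Sum>j<R. of_bool (i \<le> j) * T i j) + (\<Sum>i<R. \<Sum>j<R. of_bool (j \<le> i) * T j i)"
    by (simp add: sum.distrib)
  also have "(\<Sum>i<R. \<Sum>j<R. of_bool (j \<le> i) * T j i) = (\<Sum>i<R. \<Sum>j<R. of_bool (i \<le> j) * T i j)"
    by (rule sum.swap)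
  finally show ?thesis using half by simp
qed

lemma convex_nat_set_interval:
  fixes S :: "nat set"
  assumes "S \<subseteq> {..<N}" "\<And>x y z. x \<in> S \<Longrightarrow> z \<in> S \<Longrightarrow> x \<le> y \<Longrightarrow> y \<le> z \<Longrightarrow> y \<in> S"
  shows "\<exists>i j. j \<le> N \<and> S = {i..<j}"
proof (cases "S = {}")
  case True
  then show ?thesis by (intro exI[of _ 0]) auto
next
  case False
  have fin: "finite S" using assms(1) by (rule finite_subset) simp
  have mem: "Min S \<in> S" "Max S \<in> S" using fin False by auto
  have "S = {Min S..<Suc (Max S)}"
    using fin assms(2)[OF mem] by (auto simp: less_Suc_eq_le)
  moreover have "Suc (Max S) \<le> N" using mem assms(1) by auto
  ultimately show ?thesis by blast
qed

text \<open>The conditions on \<open>m\<close> for given \<open>k\<close> and \<open>r\<close> define an interval, so completion handles the cutoffs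
  \<open>X0\<close> and \<open>X1\<close> at no extra cost. The term \<open>4 * b / b^\<rho>\<close> accounts for carries past position
  \<open>\<mu> + 2 * \<rho>\<close>, since \<open>m * r\<close> has at most \<open>\<mu> + \<rho>\<close> digits.\<close>

lemma sum_correlation_interval_le:
  fixes b l \<mu> \<rho> r X0 X1 :: nat
  defines "L \<equiv> \<mu> + 2 * \<rho>"
  defines "M \<equiv> {b ^ (\<mu> - 1)..<b ^ \<mu>}"
  assumes b: "b \<ge> 2" and \<mu>: "\<mu> \<ge> 1" "2 * \<mu> \<le> l + 2" and L: "L \<le> l" and J: "J \<le> L"
    and r: "r \<ge> 1" "r < b ^ \<rho>"
    and gap: "\<And>g. g dvd b ^ L \<Longrightarrow> \<not> b ^ J dvd g \<Longrightarrow> class_energy b a L g \<le> real b ^ L / real g * D"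
    and E: "\<And>\<theta>. norm (digital_transform b (\<lambda>i. a (L - J + i)) J \<theta>) \<le> E"
    and \<Omega>: "D \<le> \<Omega>" "real b ^ \<rho> * E\<^sup>2 \<le> \<Omega>"
  shows "(\<Sum>k<b ^ (l + 1 - \<mu>). norm (\<Sum>m | m \<in> M \<and> X0 \<le> m * k \<and> m * k < X1 \<and> X0 \<le> m * (k + r) \<and> m * (k + r) < X1.
      digital_char b a l (m * k) * cnj (digital_char b a l (m * (k + r)))))
    \<le> real b ^ (l + 1) * (real b ^ (4 * \<rho> + 1) * (3 + 2 * ln (real b ^ L)) * real (card {g. g dvd b ^ L}) * \<Omega>
        + 4 * real b / real b ^ \<rho>)"
proof -
  define Q where "Q = b ^ L"
  define K where "K = b ^ (l + 1 - \<mu>)"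
  define I where "I k = {m. m \<in> M \<and> X0 \<le> m * k \<and> m * k < X1 \<and> X0 \<le> m * (k + r) \<and> m * (k + r) < X1}" for k
  have bpos: "b > 0" using b by simp
  have Q: "Q > 0" using bpos by (simp add: Q_def)
  have finI: "finite (I k)" for k by (rule finite_subset[of _ M]) (auto simp: I_def M_def)
  have \<mu>l: "\<mu> \<le> l + 1" using \<mu> by simp
  have KM: "K * b ^ \<mu> = b ^ (l + 1)"
    unfolding K_def using \<mu>l by (simp add: power_add[symmetric])
  have "\<exists>i j. j \<le> Q \<and> I k = {i..<j}" for k
  proof (rule convex_nat_set_interval)
    have "b ^ \<mu> \<le> Q" unfolding Q_def L_def using bpos by (intro power_increasing) auto
    then show "I k \<subseteq> {..<Q}" by (auto simp: I_def M_def)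
    fix x y z assume "x \<in> I k" "z \<in> I k" and xy: "x \<le> y" "y \<le> z"
    moreover have "x * k \<le> y * k" "y * k \<le> z * k" "x * (k + r) \<le> y * (k + r)" "y * (k + r) \<le> z * (k + r)"
      using xy by (auto intro: mult_le_mono1)
    ultimately show "y \<in> I k"
      unfolding I_def M_def mem_Collect_eq atLeastLessThan_iff by (meson le_less_trans order.trans)
  qed
  then obtain i j where ij: "\<And>k. j k \<le> Q" "\<And>k. I k = {i k..<j k}" by metis
  (* The range of k may be shorter than a period Q; it is extended to b^e full periods, which costs
     the factor b^(2 * \<rho> + 1) and uses that m is at most of the order of the square root. *)
  define e where "e = l + 2 - 2 * \<mu>"
  have Qe: "Q * b ^ e = K * b ^ (2 * \<rho> + 1)"
  proof -
    have "L + e = (l + 1 - \<mu>) + (2 * \<rho> + 1)" using \<mu> by (simp add: L_def e_def)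
    then show ?thesis unfolding Q_def K_def by (simp only: power_add[symmetric])
  qed
  have main: "(\<Sum>k<K. norm (\<Sum>m\<in>I k. digital_char b a L (m * k) * cnj (digital_char b a L (m * (k + r)))))
     \<le> real b ^ (l + 1) * (real b ^ (4 * \<rho> + 1) * (3 + 2 * ln (real b ^ L)) * real (card {g. g dvd b ^ L}) * \<Omega>)"
  proof -
    have r\<Omega>: "real r * E\<^sup>2 \<le> \<Omega>"
    proof -
      have "real r \<le> real (b ^ \<rho>)" using r(2) by (simp only: of_nat_le_iff less_imp_le)
      then have "real r * E\<^sup>2 \<le> real b ^ \<rho> * E\<^sup>2" by (intro mult_right_mono) auto
      then show ?thesis using \<Omega>(2) by linarith
    qed
    have "(\<Sum>k<K. norm (\<Sum>m\<in>I k. digital_char b a L (m * k) * cnj (digital_char b a L (m * (k + r)))))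
       \<le> (\<Sum>k<Q * b ^ e. norm (\<Sum>m\<in>I k. digital_char b a L (m * k) * cnj (digital_char b a L (m * (k + r)))))"
      unfolding Qe using bpos by (intro sum_mono2) (auto simp: Suc_leI)
    also have "\<dots> \<le> real (b ^ e) * (real b ^ L)\<^sup>2 * (3 + 2 * ln (real b ^ L)) * real (card {g. g dvd b ^ L}) * \<Omega>"
      unfolding ij(2) Q_def
      by (rule sum_correlation_le[OF b J r(1) gap E \<Omega>(1) r\<Omega>]) (use ij(1) in \<open>auto simp: Q_def\<close>)
    also have "real (b ^ e) * (real b ^ L)\<^sup>2 = real b ^ (l + 1) * real b ^ (4 * \<rho> + 1)"
    proof -
      have "e + 2 * L = (l + 1) + (4 * \<rho> + 1)" using \<mu> by (simp add: e_def L_def)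
      then have "real b ^ e * real b ^ (2 * L) = real b ^ (l + 1) * real b ^ (4 * \<rho> + 1)"
        by (simp only: power_add[symmetric])
      then show ?thesis by (simp add: power_mult power_even_eq mult.commute)
    qed
    finally show ?thesis by (simp only: mult.assoc)
  qed
  have bad: "(\<Sum>k<K. real (card {m \<in> I k. Q \<le> (m * k) mod Q + m * r})) \<le> real b ^ (l + 1) * (2 * real b / real b ^ \<rho>)"
  proof -
    define Y where "Y = b ^ (\<mu> + \<rho>)"
    define P where "P = b ^ (l + 1 - L)"
    have QP: "Q * P = b ^ (l + 1)"
      unfolding Q_def P_def using L by (simp add: power_add[symmetric])
    have "(\<Sum>k<K. card {m \<in> I k. Q \<le> (m * k) mod Q + m * r}) \<le> (\<Sum>k<K. card {m \<in> M. Q \<le> (m * k) mod Q + Y})"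
    proof (intro sum_mono card_mono)
      fix k
      show "{m \<in> I k. Q \<le> (m * k) mod Q + m * r} \<subseteq> {m \<in> M. Q \<le> (m * k) mod Q + Y}"
      proof
        fix m assume m: "m \<in> {m \<in> I k. Q \<le> (m * k) mod Q + m * r}"
        then have "m \<in> M" by (simp add: I_def)
        then have "m * r \<le> Y"
          unfolding Y_def power_add using r by (intro mult_le_mono) (auto simp: M_def)
        then show "m \<in> {m \<in> M. Q \<le> (m * k) mod Q + Y}" using m \<open>m \<in> M\<close> by auto
      qed
    qed (simp add: M_def)
    also have "\<dots> = (\<Sum>m\<in>M. card {k. k < K \<and> Q \<le> (m * k) mod Q + Y})"
    proof -
      have "(\<Sum>k<K. card {m \<in> M. Q \<le> (m * k) mod Q + Y}) = (\<Sum>k<K. \<Sum>m\<in>M. of_bool (Q \<le> (m * k) mod Q + Y))"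
        by (intro sum.cong refl card_filter_eq_sum) (simp add: M_def)
      also have "\<dots> = (\<Sum>m\<in>M. \<Sum>k<K. of_bool (Q \<le> (m * k) mod Q + Y))"
        by (rule sum.swap)
      also have "\<dots> = (\<Sum>m\<in>M. card {k. k < K \<and> Q \<le> (m * k) mod Q + Y})"
        using card_filter_eq_sum[of "{..<K}"] by simp
      finally show ?thesis .
    qed
    also have "\<dots> \<le> (\<Sum>m\<in>M. P * (2 * b ^ (\<rho> + 1)))"
    proof (rule sum_mono)
      fix m assume m: "m \<in> M"
      have m1: "m \<ge> 1"
      proof -
        have "1 \<le> b ^ (\<mu> - 1)" using bpos by (simp add: Suc_leI)
        then show ?thesis using m by (simp add: M_def)
      qed
      have "m * K \<le> Q * P"
      proof -
        have "m * K \<le> b ^ \<mu> * K" using m by (intro mult_le_mono1) (simp add: M_def)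
        then show ?thesis using KM QP by (simp add: mult.commute)
      qed
      then have "card {k. k < K \<and> Q \<le> (m * k) mod Q + Y} \<le> P * (Y div m + 1)"
        by (rule card_near_multiple_le[OF m1 _ Q])
      also have "Y div m + 1 \<le> 2 * b ^ (\<rho> + 1)"
      proof -
        have "Y = b ^ (\<rho> + 1) * b ^ (\<mu> - 1)"
          unfolding Y_def power_add[symmetric] using \<mu> by (intro arg_cong[of _ _ "power b"]) simp
        also have "\<dots> \<le> b ^ (\<rho> + 1) * m" using m by (intro mult_le_mono2) (simp add: M_def)
        finally have "Y div m \<le> b ^ (\<rho> + 1)"
          using m1 by (metis div_le_mono nonzero_mult_div_cancel_right not_one_le_zero)
        moreover have "1 \<le> b ^ (\<rho> + 1)" by (rule one_le_power) (use bpos in simp)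
        ultimately show ?thesis by linarith
      qed
      then have "P * (Y div m + 1) \<le> P * (2 * b ^ (\<rho> + 1))" by (rule mult_le_mono2)
      finally show "card {k. k < K \<and> Q \<le> (m * k) mod Q + Y} \<le> P * (2 * b ^ (\<rho> + 1))" .
    qed
    also have "\<dots> \<le> b ^ \<mu> * (P * (2 * b ^ (\<rho> + 1)))"
      by (simp add: M_def)
    finally have "(\<Sum>k<K. real (card {m \<in> I k. Q \<le> (m * k) mod Q + m * r})) \<le> real (b ^ \<mu> * (P * (2 * b ^ (\<rho> + 1))))"
      by (simp only: of_nat_sum[symmetric] of_nat_le_iff)
    also have "\<dots> = real b ^ (l + 1) * (2 * real b / real b ^ \<rho>)"
    proof -
      have "\<mu> + (l + 1 - L) + (\<rho> + 1) + \<rho> = (l + 1) + 1" using L by (simp add: L_def)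
      then have "real b ^ \<mu> * real b ^ (l + 1 - L) * real b ^ (\<rho> + 1) * real b ^ \<rho> = real b ^ (l + 1) * real b"
        by (simp only: power_add[symmetric]) simp
      then show ?thesis using bpos by (simp add: P_def field_simps)
    qed
    finally show ?thesis .
  qed
  have "(\<Sum>k<K. norm (\<Sum>m\<in>I k. digital_char b a l (m * k) * cnj (digital_char b a l (m * (k + r)))))
     \<le> (\<Sum>k<K. norm (\<Sum>m\<in>I k. digital_char b a L (m * k) * cnj (digital_char b a L (m * (k + r))))
        + 2 * real (card {m \<in> I k. Q \<le> (m * k) mod Q + m * r}))"
    unfolding Q_def by (intro sum_mono norm_correlation_truncate_le bpos L finI)
  also have "\<dots> = (\<Sum>k<K. norm (\<Sum>m\<in>I k. digital_char b a L (m * k) * cnj (digital_char b a L (m * (k + r)))))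
        + 2 * (\<Sum>k<K. real (card {m \<in> I k. Q \<le> (m * k) mod Q + m * r}))"
    by (simp add: sum.distrib sum_distrib_left)
  also have "\<dots> \<le> real b ^ (l + 1) * (real b ^ (4 * \<rho> + 1) * (3 + 2 * ln (real b ^ L)) * real (card {g. g dvd b ^ L}) * \<Omega>)
      + 2 * (real b ^ (l + 1) * (2 * real b / real b ^ \<rho>))"
    using main bad by (intro add_mono mult_left_mono) auto
  also have "\<dots> = real b ^ (l + 1) * (real b ^ (4 * \<rho> + 1) * (3 + 2 * ln (real b ^ L)) * real (card {g. g dvd b ^ L}) * \<Omega>
        + 4 * real b / real b ^ \<rho>)"
    by (simp add: distrib_left)
  finally show ?thesis unfolding I_def K_def .
qed

text \<open>The coefficients \<open>x\<close> disappear in the Cauchy-Schwarz inequality over \<open>m\<close>. A second one over blocks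
  of \<open>R = b^\<rho>\<close> consecutive \<open>k\<close> produces pairs \<open>k\<close>, \<open>k + r\<close> with \<open>r < R\<close>, whose coefficients \<open>y\<close> are
  removed by taking absolute values outside the sum over \<open>m\<close>. The diagonal \<open>r = 0\<close> is a proportion
  \<open>1 / R\<close> of all pairs.\<close>

lemma bilinear_sum_le:
  fixes b l \<mu> \<rho> X0 X1 :: nat
  defines "L \<equiv> \<mu> + 2 * \<rho>"
  defines "M \<equiv> {b ^ (\<mu> - 1)..<b ^ \<mu>}"
  assumes b: "b \<ge> 2" and \<mu>: "\<mu> \<ge> 1" "2 * \<mu> \<le> l + 2" and L: "L \<le> l" and J: "J \<le> L"
    and gap: "\<And>g. g dvd b ^ L \<Longrightarrow> \<not> b ^ J dvd g \<Longrightarrow> class_energy b a L g \<le> real b ^ L / real g * D"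
    and E: "\<And>\<theta>. norm (digital_transform b (\<lambda>i. a (L - J + i)) J \<theta>) \<le> E"
    and \<Omega>: "D \<le> \<Omega>" "real b ^ \<rho> * E\<^sup>2 \<le> \<Omega>"
    and xy: "\<And>m. norm (x m) \<le> 1" "\<And>k. norm (y k) \<le> 1"
  shows "(norm (\<Sum>m\<in>M. \<Sum>k<b ^ (l + 1 - \<mu>). x m * y k * of_bool (X0 \<le> m * k \<and> m * k < X1) * digital_char b a l (m * k)))\<^sup>2
    \<le> 2 * (real b ^ (l + 1))\<^sup>2 * ((1 + 4 * real b) / real b ^ \<rho>
        + real b ^ (4 * \<rho> + 1) * (3 + 2 * ln (real b ^ L)) * real (card {g. g dvd b ^ L}) * \<Omega>)"
proof -
  define K R P where "K = b ^ (l + 1 - \<mu>)" and "R = b ^ \<rho>" and "P = b ^ (l + 1 - \<mu> - \<rho>)"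
  define N1 where "N1 = real b ^ (l + 1)"
  define Z where "Z = real b ^ (4 * \<rho> + 1) * (3 + 2 * ln (real b ^ L)) * real (card {g. g dvd b ^ L}) * \<Omega>"
  have bpos: "b > 0" using b by simp
  have KRP: "K = R * P"
  proof -
    have "l + 1 - \<mu> = \<rho> + (l + 1 - \<mu> - \<rho>)" using L by (simp add: L_def)
    then show ?thesis unfolding K_def R_def P_def by (metis power_add)
  qed
  have KN: "real b ^ \<mu> * real K = N1"
    unfolding K_def N1_def using \<mu> by (simp add: power_add[symmetric])
  have Rpos: "real R > 0" "R > 0" using bpos by (auto simp: R_def)
  define g where "g m k = y k * (of_bool (X0 \<le> m * k \<and> m * k < X1) * digital_char b a l (m * k))" for m k
  define I where "I k k' = {m. m \<in> M \<and> X0 \<le> m * k \<and> m * k < X1 \<and> X0 \<le> m * k' \<and> m * k' < X1}" for k k'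
  define T where "T k k' = norm (\<Sum>m\<in>I k k'. digital_char b a l (m * k) * cnj (digital_char b a l (m * k')))" for k k'
  have finM: "finite M" by (simp add: M_def)
  have cardM: "real (card M) \<le> real b ^ \<mu>"
  proof -
    have "card M \<le> b ^ \<mu>" by (simp add: M_def)
    then have "real (card M) \<le> real (b ^ \<mu>)" by (simp only: of_nat_le_iff)
    then show ?thesis by simp
  qed
  have finI: "finite (I k k')" "card (I k k') \<le> card M" for k k'
    using finM by (auto simp: I_def intro: card_mono)
  have Tsym: "T k k' = T k' k" for k k'
  proof -
    have "I k k' = I k' k" by (auto simp: I_def)
    then have "(\<Sum>m\<in>I k' k. digital_char b a l (m * k') * cnj (digital_char b a l (m * k)))
       = cnj (\<Sum>m\<in>I k k'. digital_char b a l (m * k) * cnj (digital_char b a l (m * k')))"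
      by (simp add: mult.commute)
    then show ?thesis unfolding T_def by (metis complex_mod_cnj)
  qed
  have corr: "norm (\<Sum>m\<in>M. g m k * cnj (g m k')) \<le> T k k'" for k k'
  proof -
    have "(\<Sum>m\<in>M. g m k * cnj (g m k')) = (\<Sum>m\<in>I k k'. y k * cnj (y k') * (digital_char b a l (m * k) * cnj (digital_char b a l (m * k'))))"
    proof (rule sum.mono_neutral_cong_right)
      show "\<forall>m\<in>M - I k k'. g m k * cnj (g m k') = 0"
        by (auto simp: g_def I_def)
      show "g m k * cnj (g m k') = y k * cnj (y k') * (digital_char b a l (m * k) * cnj (digital_char b a l (m * k')))" if "m \<in> I k k'" for m
      proof -
        have "X0 \<le> m * k \<and> m * k < X1" "X0 \<le> m * k' \<and> m * k' < X1" using that by (auto simp: I_def)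
        then show ?thesis unfolding g_def by simp
      qed
    qed (use finM in \<open>auto simp: I_def\<close>)
    also have "norm \<dots> = norm (y k) * norm (y k') * T k k'"
      by (simp add: T_def norm_mult flip: sum_distrib_left)
    also have "\<dots> \<le> 1 * 1 * T k k'"
      using xy(2) by (intro mult_mono) (auto simp: T_def)
    finally show ?thesis by simp
  qed
  have block: "(\<Sum>m\<in>M. (norm (\<Sum>r<R. g m (r + R * B)))\<^sup>2) \<le> 2 * (\<Sum>i<R. \<Sum>r<R. T (i + R * B) (i + R * B + r))" for B
  proof -
    have "complex_of_real (\<Sum>m\<in>M. (norm (\<Sum>r<R. g m (r + R * B)))\<^sup>2)
        = (\<Sum>m\<in>M. \<Sum>i<R. \<Sum>j<R. g m (i + R * B) * cnj (g m (j + R * B)))"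
      by (simp only: of_real_sum norm_square_sum)
    also have "\<dots> = (\<Sum>i<R. \<Sum>j<R. \<Sum>m\<in>M. g m (i + R * B) * cnj (g m (j + R * B)))"
      by (rule trans[OF sum.swap sum.cong[OF refl sum.swap]])
    finally have eq: "complex_of_real (\<Sum>m\<in>M. (norm (\<Sum>r<R. g m (r + R * B)))\<^sup>2)
        = (\<Sum>i<R. \<Sum>j<R. \<Sum>m\<in>M. g m (i + R * B) * cnj (g m (j + R * B)))" .
    have "(\<Sum>m\<in>M. (norm (\<Sum>r<R. g m (r + R * B)))\<^sup>2) \<le> norm (complex_of_real (\<Sum>m\<in>M. (norm (\<Sum>r<R. g m (r + R * B)))\<^sup>2))"
      by (simp only: norm_of_real abs_ge_self)
    also have "\<dots> \<le> (\<Sum>i<R. \<Sum>j<R. T (i + R * B) (j + R * B))"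
      unfolding eq by (intro sum_norm_le corr)
    also have "\<dots> \<le> 2 * (\<Sum>i<R. \<Sum>r<R. T (i + R * B) (i + r + R * B))"
      by (rule sum_symmetric_pairs_le) (rule Tsym, simp add: T_def)
    also have "(\<lambda>i r. T (i + R * B) (i + r + R * B)) = (\<lambda>i r. T (i + R * B) (i + R * B + r))"
      by (simp add: add_ac)
    finally show ?thesis .
  qed
  have diag: "(\<Sum>k<K. T k (k + 0)) \<le> N1"
  proof -
    have "T k k \<le> real b ^ \<mu>" for k
    proof -
      have "T k k \<le> (\<Sum>m\<in>I k k. 1)"
        unfolding T_def by (intro sum_norm_le) (simp add: norm_mult)
      also have "\<dots> \<le> real (card M)" using finI by simp
      finally show ?thesis using cardM by (rule order.trans)
    qed
    then have "(\<Sum>k<K. T k (k + 0)) \<le> (\<Sum>k<K. real b ^ \<mu>)" by (intro sum_mono) simp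
    then show ?thesis using KN by (simp add: mult.commute)
  qed
  have off: "(\<Sum>k<K. T k (k + r)) \<le> N1 * (Z + 4 * real b / real R)" if "r \<ge> 1" "r < R" for r
    unfolding T_def I_def K_def N1_def Z_def R_def of_nat_power M_def L_def
    by (rule sum_correlation_interval_le[OF b \<mu> L[unfolded L_def] J[unfolded L_def] that(1) that(2)[unfolded R_def]
          gap[unfolded L_def] E[unfolded L_def] \<Omega>])
  have Z0: "Z \<ge> 0"
  proof -
    have "\<Omega> \<ge> 0" using \<Omega>(2) by (rule order.trans[rotated]) simp
    moreover have "ln (real b ^ L) \<ge> 0" using b by simp
    ultimately show ?thesis unfolding Z_def by (intro mult_nonneg_nonneg) auto
  qed
  have all: "(\<Sum>r<R. \<Sum>k<K. T k (k + r)) \<le> N1 * (1 + 4 * real b + real R * Z)"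
  proof -
    have "{..<R} = insert 0 {1..<R}" using Rpos by auto
    then have "(\<Sum>r<R. \<Sum>k<K. T k (k + r)) = (\<Sum>k<K. T k (k + 0)) + (\<Sum>r\<in>{1..<R}. \<Sum>k<K. T k (k + r))"
      by simp
    also have "\<dots> \<le> N1 + (\<Sum>r\<in>{1..<R}. N1 * (Z + 4 * real b / real R))"
      by (intro add_mono diag sum_mono off) auto
    also have "\<dots> \<le> N1 + real R * (N1 * (Z + 4 * real b / real R))"
      using Z0 by (simp add: N1_def mult_right_mono)
    also have "\<dots> = N1 * (1 + 4 * real b + real R * Z)"
      using Rpos by (simp add: algebra_simps)
    finally show ?thesis .
  qed
  have "(norm (\<Sum>m\<in>M. x m * (\<Sum>k<K. g m k)))\<^sup>2 \<le> real (card M) * (\<Sum>m\<in>M. (norm (x m * (\<Sum>k<K. g m k)))\<^sup>2)"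
    by (rule norm_sum_square_le_card)
  also have "\<dots> \<le> real b ^ \<mu> * (\<Sum>m\<in>M. real P * (\<Sum>B<P. (norm (\<Sum>r<R. g m (r + R * B)))\<^sup>2))"
  proof (intro mult_mono cardM sum_mono)
    fix m
    have "norm (x m * (\<Sum>k<K. g m k)) \<le> norm (\<Sum>k<K. g m k)"
      using xy(1)[of m] by (simp add: norm_mult mult_left_le_one_le)
    then have "(norm (x m * (\<Sum>k<K. g m k)))\<^sup>2 \<le> (norm (\<Sum>B<P. \<Sum>r<R. g m (r + R * B)))\<^sup>2"
      unfolding KRP sum_lessThan_mult by (intro power_mono) auto
    also have "\<dots> \<le> real (card {..<P}) * (\<Sum>B<P. (norm (\<Sum>r<R. g m (r + R * B)))\<^sup>2)"
      by (rule norm_sum_square_le_card)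
    finally show "(norm (x m * (\<Sum>k<K. g m k)))\<^sup>2 \<le> real P * (\<Sum>B<P. (norm (\<Sum>r<R. g m (r + R * B)))\<^sup>2)"
      by simp
  qed (auto intro!: sum_nonneg)
  also have "(\<Sum>m\<in>M. real P * (\<Sum>B<P. (norm (\<Sum>r<R. g m (r + R * B)))\<^sup>2)) = real P * (\<Sum>B<P. \<Sum>m\<in>M. (norm (\<Sum>r<R. g m (r + R * B)))\<^sup>2)"
    unfolding sum_distrib_left[symmetric] by (subst sum.swap) (rule refl)
  also have "real b ^ \<mu> * \<dots> \<le> real b ^ \<mu> * (real P * (\<Sum>B<P. 2 * (\<Sum>i<R. \<Sum>r<R. T (i + R * B) (i + R * B + r))))"
    by (intro mult_left_mono sum_mono block) auto
  also have "(\<Sum>B<P. 2 * (\<Sum>i<R. \<Sum>r<R. T (i + R * B) (i + R * B + r))) = 2 * (\<Sum>r<R. \<Sum>k<K. T k (k + r))"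
    unfolding sum_distrib_left[symmetric] KRP sum_lessThan_mult
    by (rule arg_cong[OF trans[OF sum.cong[OF refl sum.swap] sum.swap]])
  also have "real b ^ \<mu> * (real P * (2 * (\<Sum>r<R. \<Sum>k<K. T k (k + r))))
      \<le> real b ^ \<mu> * (real P * (2 * (N1 * (1 + 4 * real b + real R * Z))))"
    using all by (intro mult_left_mono) auto
  also have "\<dots> = 2 * N1\<^sup>2 * ((1 + 4 * real b) / real R + Z)"
  proof -
    have "real b ^ \<mu> * real P = N1 / real R"
      using KN KRP Rpos by (simp add: field_simps)
    then have "real b ^ \<mu> * (real P * (2 * (N1 * (1 + 4 * real b + real R * Z)))) = N1 / real R * (2 * (N1 * (1 + 4 * real b + real R * Z)))"
      by (simp only: mult.assoc[symmetric])
    also have "\<dots> = 2 * N1\<^sup>2 * ((1 + 4 * real b) / real R + Z)"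
      using Rpos by (simp add: power2_eq_square field_simps)
    finally show ?thesis .
  qed
  finally have "(norm (\<Sum>m\<in>M. x m * (\<Sum>k<K. g m k)))\<^sup>2 \<le> 2 * N1\<^sup>2 * ((1 + 4 * real b) / real R + Z)" .
  moreover have "(\<Sum>m\<in>M. x m * (\<Sum>k<K. g m k))
      = (\<Sum>m\<in>M. \<Sum>k<K. x m * y k * of_bool (X0 \<le> m * k \<and> m * k < X1) * digital_char b a l (m * k))"
    unfolding g_def sum_distrib_left by (simp only: mult.assoc)
  ultimately show ?thesis
    unfolding K_def N1_def R_def Z_def of_nat_power by (simp only:)
qed

section \<open>A combinatorial identity for primes\<close>

definition moebius :: "nat \<Rightarrow> int" where
  "moebius n = (if squarefree n then (- 1) ^ card (prime_factors n) else 0)"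

definition least_prime :: "nat \<Rightarrow> nat" where
  "least_prime n = (LEAST p. prime p \<and> p dvd n)"

lemma abs_moebius_le_1: "\<bar>moebius n\<bar> \<le> 1"
  by (simp add: moebius_def)

lemma moebius_prime_mult:
  assumes "prime q" "\<not> q dvd u" "squarefree u"
  shows "squarefree (q * u)" "moebius (q * u) = - moebius u"
proof -
  have cop: "coprime q u" using assms by (simp add: prime_imp_coprime)
  then show sq: "squarefree (q * u)"
    using assms by (simp add: squarefree_mult_coprime squarefree_prime)
  have "u > 0" using assms(2) by (metis dvd_0_right gr0I)
  then have "prime_factors (q * u) = insert q (prime_factors u)"
    using assms by (simp add: prime_factors_product prime_factorization_prime prime_gt_0_nat)
  moreover have "q \<notin> prime_factors u" using assms(2) by auto
  ultimately show "moebius (q * u) = - moebius u"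
    using sq assms(3) by (simp add: moebius_def)
qed

lemma least_prime_prime:
  assumes "n > 1"
  shows "prime (least_prime n)" "least_prime n dvd n"
proof -
  obtain p where "prime p \<and> p dvd n" using prime_factor_nat[of n] assms by auto
  then have "prime (least_prime n) \<and> least_prime n dvd n"
    unfolding least_prime_def by (rule LeastI)
  then show "prime (least_prime n)" "least_prime n dvd n" by auto
qed

lemma least_prime_le: "prime p \<Longrightarrow> p dvd n \<Longrightarrow> least_prime n \<le> p"
  unfolding least_prime_def by (rule Least_le) simp

text \<open>Let \<open>q\<close> be the least prime factor of \<open>n\<close>. Pairing \<open>u\<close> with \<open>q * u\<close> cancels the divisors
  up to \<open>D\<close> except for those \<open>u \<le> D\<close> with \<open>q * u > D\<close>. The partners \<open>m = q * u\<close> are the divisors in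
  the second sum: they exceed \<open>D\<close>, but not after removal of their least prime factor, which is \<open>q\<close>
  if and only if it is at most every prime factor of the cofactor.\<close>

lemma sum_moebius_cut:
  assumes n: "n > 1" and D: "D \<ge> 1"
  shows "(\<Sum>d | d dvd n \<and> d \<le> D. moebius d) +
    (\<Sum>m | m dvd n \<and> D < m \<and> m div least_prime m \<le> D \<and> (\<forall>p. prime p \<longrightarrow> p dvd n div m \<longrightarrow> least_prime m \<le> p).
      moebius m) = 0"
proof -
  define q where "q = least_prime n"
  have q: "prime q" "q dvd n" using least_prime_prime[OF n] by (auto simp: q_def)
  have qmin: "q \<le> p" if "prime p" "p dvd n" for p
    using that least_prime_le unfolding q_def by blast
  have qpos: "q > 0" using q prime_gt_0_nat by blast
  define U where "U = {u. u dvd n \<and> squarefree u \<and> \<not> q dvd u}"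
  have finn: "finite {d. d dvd n}" using n by simp
  have finU: "finite U" by (rule finite_subset[OF _ finn]) (auto simp: U_def)
  have qU: "q * u dvd n" "squarefree (q * u)" "moebius (q * u) = - moebius u" if "u \<in> U" for u
  proof -
    have "coprime q u" using that q by (auto simp: U_def intro: prime_imp_coprime)
    then show "q * u dvd n" using that q by (auto simp: U_def intro: divides_mult)
    show "squarefree (q * u)" "moebius (q * u) = - moebius u"
      using moebius_prime_mult[OF q(1)] that by (auto simp: U_def)
  qed
  have decomp: "\<exists>u\<in>U. m = q * u" if m: "m dvd n" "squarefree m" "q dvd m" for m
  proof -
    obtain u where u: "m = q * u" using m(3) by (elim dvdE)
    have "\<not> q dvd u"
    proof
      assume "q dvd u"
      then have "q\<^sup>2 dvd m" using u by (simp add: power2_eq_square)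
      then show False using m(2) q(1) by (metis not_prime_unit squarefreeD)
    qed
    moreover have "u dvd n" using u m(1) by (metis dvd_mult_right)
    moreover have "squarefree u" using u m(2) by (metis dvd_triv_right squarefree_mono)
    ultimately show ?thesis using u by (auto simp: U_def)
  qed
  have injq: "inj_on ((*) q) A" for A using qpos by (intro inj_onI) simp
  have "(\<Sum>d | d dvd n \<and> d \<le> D. moebius d) = (\<Sum>d\<in>{u\<in>U. u \<le> D} \<union> (*) q ` {u\<in>U. q * u \<le> D}. moebius d)"
  proof (rule sum.mono_neutral_right)
    show "finite {d. d dvd n \<and> d \<le> D}" by (rule finite_subset[OF _ finn]) auto
    show "{u\<in>U. u \<le> D} \<union> (*) q ` {u\<in>U. q * u \<le> D} \<subseteq> {d. d dvd n \<and> d \<le> D}"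
      using qU by (auto simp: U_def)
    show "\<forall>d\<in>{d. d dvd n \<and> d \<le> D} - ({u\<in>U. u \<le> D} \<union> (*) q ` {u\<in>U. q * u \<le> D}). moebius d = 0"
    proof
      fix d assume d: "d \<in> {d. d dvd n \<and> d \<le> D} - ({u\<in>U. u \<le> D} \<union> (*) q ` {u\<in>U. q * u \<le> D})"
      have "\<not> squarefree d"
      proof
        assume "squarefree d"
        then show False using d decomp[of d] by (cases "q dvd d") (auto simp: U_def)
      qed
      then show "moebius d = 0" by (simp add: moebius_def)
    qed
  qed
  also have "\<dots> = (\<Sum>u | u \<in> U \<and> u \<le> D. moebius u) + (\<Sum>d\<in>(*) q ` {u\<in>U. q * u \<le> D}. moebius d)"
    using finU by (intro sum.union_disjoint) (simp, simp, auto simp: U_def)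
  also have "(\<Sum>d\<in>(*) q ` {u\<in>U. q * u \<le> D}. moebius d) = - (\<Sum>u | u \<in> U \<and> q * u \<le> D. moebius u)"
    by (subst sum.reindex[OF injq]) (simp add: qU(3) sum_negf)
  finally have A: "(\<Sum>d | d dvd n \<and> d \<le> D. moebius d)
      = (\<Sum>u | u \<in> U \<and> u \<le> D. moebius u) - (\<Sum>u | u \<in> U \<and> q * u \<le> D. moebius u)" by simp
  have "(\<Sum>u | u \<in> U \<and> u \<le> D. moebius u) = (\<Sum>u\<in>{u. u \<in> U \<and> q * u \<le> D} \<union> {u. u \<in> U \<and> u \<le> D \<and> D < q * u}. moebius u)"
  proof (rule sum.cong)
    have le: "u \<le> q * u" for u using qpos by simp
    show "{u. u \<in> U \<and> u \<le> D} = {u. u \<in> U \<and> q * u \<le> D} \<union> {u. u \<in> U \<and> u \<le> D \<and> D < q * u}"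
      by (auto dest: order.trans[OF le])
  qed simp
  also have "\<dots> = (\<Sum>u | u \<in> U \<and> q * u \<le> D. moebius u) + (\<Sum>u | u \<in> U \<and> u \<le> D \<and> D < q * u. moebius u)"
    using finU by (intro sum.union_disjoint) auto
  finally have B: "(\<Sum>d | d dvd n \<and> d \<le> D. moebius d) = (\<Sum>u | u \<in> U \<and> u \<le> D \<and> D < q * u. moebius u)"
    using A by simp
  define S where "S = {m. m dvd n \<and> D < m \<and> m div least_prime m \<le> D \<and> (\<forall>p. prime p \<longrightarrow> p dvd n div m \<longrightarrow> least_prime m \<le> p)}"
  have "(\<Sum>m\<in>S. moebius m) = (\<Sum>m\<in>(*) q ` {u\<in>U. u \<le> D \<and> D < q * u}. moebius m)"
  proof (rule sum.mono_neutral_right)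
    show "finite S" by (rule finite_subset[OF _ finn]) (auto simp: S_def)
    show "(*) q ` {u\<in>U. u \<le> D \<and> D < q * u} \<subseteq> S"
    proof
      fix m assume "m \<in> (*) q ` {u\<in>U. u \<le> D \<and> D < q * u}"
      then obtain u where u: "u \<in> U" "u \<le> D" "D < q * u" "m = q * u" by auto
      have m: "m dvd n" "m > 1" using qU(1)[OF u(1)] u D by auto
      have "least_prime m = q"
      proof (rule antisym)
        show "least_prime m \<le> q" using u q by (intro least_prime_le) auto
        show "q \<le> least_prime m"
          using least_prime_prime[OF m(2)] m(1) by (intro qmin) (auto intro: dvd_trans)
      qed
      moreover have "p dvd n" if "p dvd n div m" for p
        using that m(1) by (metis dvd_div_mult_self dvd_mult2)
      ultimately show "m \<in> S" using u m qpos qmin by (auto simp: S_def)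
    qed
    show "\<forall>m\<in>S - (*) q ` {u\<in>U. u \<le> D \<and> D < q * u}. moebius m = 0"
    proof
      fix m assume m: "m \<in> S - (*) q ` {u\<in>U. u \<le> D \<and> D < q * u}"
      then have m': "m dvd n" "D < m" "m div least_prime m \<le> D"
        "\<And>p. prime p \<Longrightarrow> p dvd n div m \<Longrightarrow> least_prime m \<le> p" by (auto simp: S_def)
      have m1: "m > 1" using m' D by simp
      have lp: "least_prime m = q"
      proof (rule antisym)
        show "q \<le> least_prime m"
          using least_prime_prime[OF m1] m'(1) by (intro qmin) (auto intro: dvd_trans)
        have "q dvd m * (n div m)" using q m'(1) by simp
        then have "q dvd m \<or> q dvd n div m" using q(1) by (simp add: prime_dvd_mult_iff)
        then show "least_prime m \<le> q" using least_prime_le[OF q(1)] m'(4)[OF q(1)] by blast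
      qed
      have "\<not> squarefree m"
      proof
        assume "squarefree m"
        moreover have "q dvd m" using least_prime_prime(2)[OF m1] lp by simp
        ultimately obtain u where "u \<in> U" "m = q * u" using decomp[of m] m'(1) by blast
        then have "m \<in> (*) q ` {u\<in>U. u \<le> D \<and> D < q * u}"
          using m'(2,3) lp qpos by auto
        then show False using m by blast
      qed
      then show "moebius m = 0" by (simp add: moebius_def)
    qed
  qed
  also have "\<dots> = - (\<Sum>u | u \<in> U \<and> u \<le> D \<and> D < q * u. moebius u)"
    by (subst sum.reindex[OF injq]) (simp add: qU(3) sum_negf)
  finally show ?thesis using B unfolding S_def by simp
qed

text \<open>A squarefree composite number has a prime factor above the least one, so its least prime factor is
  smaller than the cofactor.\<close>

lemma cofactor_bound_squarefree:
  assumes "squarefree m" "m > 1" "\<not> prime m" "m div least_prime m \<le> D"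
  shows "m < D\<^sup>2"
proof -
  define q where "q = least_prime m"
  have q: "prime q" "q dvd m" using least_prime_prime[OF assms(2)] by (auto simp: q_def)
  obtain u where u: "m = q * u" using q(2) by (elim dvdE)
  have "u \<noteq> 1" using u q assms(3) by auto
  moreover have "u \<noteq> 0" using u assms(2) by (metis mult_0_right not_less_zero)
  ultimately obtain p where p: "prime p" "p dvd u" using prime_factor_nat[of u] by auto
  have "q \<le> p" unfolding q_def using p u by (intro least_prime_le) auto
  moreover have "q \<noteq> p"
  proof
    assume "q = p"
    then have "q\<^sup>2 dvd m" using p u by (simp add: power2_eq_square)
    then show False using assms(1) q(1) by (metis not_prime_unit squarefreeD)
  qed
  moreover have "p \<le> u" using p \<open>u \<noteq> 0\<close> by (simp add: dvd_imp_le)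
  ultimately have "q < u" by simp
  have "m div q = u" using u prime_gt_0_nat[OF q(1)] by simp
  then have "u \<le> D" using assms(4) unfolding q_def[symmetric] by simp
  then have "m < D * D"
    using u \<open>q < u\<close> by (metis \<open>u \<noteq> 0\<close> gr0I less_le_trans mult_le_mono mult_less_mono1 order_refl)
  then show ?thesis by (simp add: power2_eq_square)
qed

definition cut_coefficient :: "nat \<Rightarrow> nat \<Rightarrow> int" where
  "cut_coefficient D m = (if D < m \<and> m div least_prime m \<le> D then moebius m else 0)"

text \<open>In \<open>sum_moebius_cut\<close> the divisor \<open>m = n\<close> satisfies the conditions with a nonzero coefficient
  exactly if \<open>n\<close> is prime; moved to the other side, it becomes the indicator.\<close>

lemma prime_indicator_decomposition:
  assumes n: "n > D\<^sup>2" and D: "D \<ge> 1"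
  shows "of_bool (prime n) = (\<Sum>d | d dvd n \<and> d \<le> D. moebius d) +
    (\<Sum>m | m dvd n \<and> m < n \<and> least_prime m \<le> least_prime (n div m). cut_coefficient D m)"
proof -
  have Dn: "D < n" using n D by (metis le_square power2_eq_square less_le_trans not_le order.strict_trans1)
  then have n1: "n > 1" using D by simp
  have finn: "finite {d. d dvd n}" using n1 by simp
  define S where "S = {m. m dvd n \<and> D < m \<and> m div least_prime m \<le> D \<and> (\<forall>p. prime p \<longrightarrow> p dvd n div m \<longrightarrow> least_prime m \<le> p)}"
  have finS: "finite S" by (rule finite_subset[OF _ finn]) (auto simp: S_def)
  have lp: "(\<forall>p. prime p \<longrightarrow> p dvd k \<longrightarrow> least_prime m \<le> p) \<longleftrightarrow> least_prime m \<le> least_prime k" if "k > 1" for k m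
    using least_prime_prime[OF that] least_prime_le[of _ k] by (meson order.trans)
  have "(\<Sum>m\<in>S. moebius m) = (\<Sum>m\<in>S - {n}. moebius m) - of_bool (prime n)"
  proof (cases "n \<in> S")
    case True
    then have eq: "(\<Sum>m\<in>S. moebius m) = (\<Sum>m\<in>S - {n}. moebius m) + moebius n"
      using finS by (simp add: sum.remove)
    have "moebius n = - of_bool (prime n)"
    proof (cases "prime n")
      case True
      then show ?thesis by (simp add: moebius_def squarefree_prime prime_factorization_prime)
    next
      case False
      have "\<not> squarefree n"
        using cofactor_bound_squarefree[of n D] False n n1 True by (auto simp: S_def)
      then show ?thesis using False by (simp add: moebius_def)
    qed
    then show ?thesis using eq by simp
  next
    case False
    have "\<not> prime n"
    proof
      assume p: "prime n"
      have "least_prime n = n"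
        using least_prime_prime[OF n1] p by (metis primes_dvd_imp_eq)
      then have "n \<in> S" using Dn D n1 by (auto simp: S_def)
      then show False using False by simp
    qed
    then show ?thesis using False by simp
  qed
  also have "(\<Sum>m\<in>S - {n}. moebius m) = (\<Sum>m | m dvd n \<and> m < n \<and> least_prime m \<le> least_prime (n div m). cut_coefficient D m)"
  proof (rule sum.mono_neutral_cong_left)
    have k1: "n div m > 1" if "m dvd n" "m < n" for m
      using that by (metis One_nat_def div_by_0 dvd_div_mult_self gr0I less_one linorder_neqE_nat mult_1 mult_0 n1 not_less_zero less_irrefl)
    show "finite {m. m dvd n \<and> m < n \<and> least_prime m \<le> least_prime (n div m)}"
      by (rule finite_subset[OF _ finn]) auto
    have lt: "m < n" if "m \<in> S - {n}" for m
      using that n1 by (auto simp: S_def dest: dvd_imp_le intro: le_neq_implies_less)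
    show "S - {n} \<subseteq> {m. m dvd n \<and> m < n \<and> least_prime m \<le> least_prime (n div m)}"
    proof
      fix m assume m: "m \<in> S - {n}"
      then show "m \<in> {m. m dvd n \<and> m < n \<and> least_prime m \<le> least_prime (n div m)}"
        using lt[OF m] k1[of m] lp[of "n div m" m] by (simp add: S_def)
    qed
    show "\<forall>m\<in>{m. m dvd n \<and> m < n \<and> least_prime m \<le> least_prime (n div m)} - (S - {n}). cut_coefficient D m = 0"
    proof
      fix m assume m: "m \<in> {m. m dvd n \<and> m < n \<and> least_prime m \<le> least_prime (n div m)} - (S - {n})"
      then have "\<not> (D < m \<and> m div least_prime m \<le> D)"
        using k1[of m] lp[of "n div m" m] by (auto simp: S_def)
      then show "cut_coefficient D m = 0" unfolding cut_coefficient_def by (rule if_not_P)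
    qed
    show "moebius m = cut_coefficient D m" if "m \<in> S - {n}" for m
      using that by (simp add: S_def cut_coefficient_def)
  qed
  finally show ?thesis
    using sum_moebius_cut[OF n1 D] unfolding S_def by linarith
qed

text \<open>A prime \<open>m\<close> is its own least prime factor, so the relation gives \<open>m \<le> k\<close>; a composite \<open>m\<close>
  is less than \<open>D\<^sup>2\<close>. In the bilinear sums \<open>m\<close> is therefore always the short variable.\<close>

lemma cut_coefficient_square_le:
  assumes "cut_coefficient D m \<noteq> 0" "least_prime m \<le> least_prime k" "k > 1" "D \<ge> 1"
  shows "m\<^sup>2 \<le> max (m * k) (D ^ 4)"
proof -
  have m: "D < m" "m div least_prime m \<le> D" "squarefree m"
    using assms(1) by (auto simp: cut_coefficient_def moebius_def split: if_splits)
  show ?thesis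
  proof (cases "prime m")
    case True
    then have "least_prime m = m"
      using least_prime_prime[of m] by (metis prime_gt_1_nat primes_dvd_imp_eq)
    moreover have "least_prime k \<le> k"
      using least_prime_prime(2)[OF assms(3)] assms(3) by (intro dvd_imp_le) auto
    ultimately have "m * m \<le> m * k" using assms(2) by simp
    then show ?thesis unfolding power2_eq_square by (rule max.coboundedI1)
  next
    case False
    have "m < D\<^sup>2"
      using m assms(4) False by (intro cofactor_bound_squarefree) auto
    then have "m\<^sup>2 \<le> (D\<^sup>2)\<^sup>2" by (intro power_mono) auto
    then show ?thesis by (simp add: power_mult[symmetric])
  qed
qed

section \<open>Exponential sums over primes\<close>

lemma sum_blocks:
  fixes f :: "nat \<Rightarrow> 'a :: comm_monoid_add"
  assumes "b > 0"
  shows "(\<Sum>m\<in>{1..<b ^ V}. f m) = (\<Sum>\<mu>=1..V. \<Sum>m\<in>{b ^ (\<mu> - 1)..<b ^ \<mu>}. f m)"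
proof (induction V)
  case (Suc V)
  have "(\<Sum>m\<in>{1..<b ^ Suc V}. f m) = (\<Sum>m\<in>{1..<b ^ V}. f m) + (\<Sum>m\<in>{b ^ V..<b ^ Suc V}. f m)"
    using assms by (intro sum.atLeastLessThan_concat[symmetric]) (auto simp: Suc_leI)
  also have "\<dots> = (\<Sum>\<mu>=1..Suc V. \<Sum>m\<in>{b ^ (\<mu> - 1)..<b ^ \<mu>}. f m)"
    unfolding Suc by simp
  finally show ?case .
qed simp

lemma sum_primes_decomposition:
  fixes f :: "nat \<Rightarrow> complex"
  assumes b: "b \<ge> 2" and \<kappa>: "2 * \<kappa> < l - 1" "4 * \<kappa> \<le> l" and X1: "X1 \<le> b ^ l"
  shows "(\<Sum>n\<in>{b ^ (l - 1)..<X1}. of_bool (prime n) * of_bool (coprime n b) * f n)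
    = (\<Sum>d\<in>{1..b ^ \<kappa>}. of_int (moebius d) * (\<Sum>n\<in>{b ^ (l - 1)..<X1}. of_bool (d dvd n) * of_bool (coprime n b) * f n))
    + (\<Sum>\<mu>=1..l div 2 + 1. \<Sum>m\<in>{b ^ (\<mu> - 1)..<b ^ \<mu>}. \<Sum>k<b ^ (l + 1 - \<mu>).
        of_int (cut_coefficient (b ^ \<kappa>) m) * of_bool (1 < k \<and> least_prime m \<le> least_prime k) *
        of_bool (b ^ (l - 1) \<le> m * k \<and> m * k < X1) * of_bool (coprime (m * k) b) * f (m * k))"
proof -
  define D X0 V where "D = b ^ \<kappa>" and "X0 = b ^ (l - 1)" and "V = l div 2 + 1"
  have D: "D \<ge> 1" using b by (simp add: D_def)
  define T where "T = {X0..<X1}"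
  define w where "w n = of_bool (coprime n b) * f n" for n
  have Tn: "n > D\<^sup>2" "n < b ^ l" "n > 0" if "n \<in> T" for n
  proof -
    have "D\<^sup>2 = b ^ (2 * \<kappa>)" by (simp add: D_def power_mult[symmetric] mult.commute)
    also have "\<dots> < b ^ (l - 1)" using b \<kappa> by (intro power_strict_increasing) auto
    finally show "n > D\<^sup>2" using that by (simp add: T_def X0_def)
    then show "n > 0" by simp
    show "n < b ^ l" using that X1 by (simp add: T_def)
  qed
  have first: "(\<Sum>n\<in>T. of_int (\<Sum>d | d dvd n \<and> d \<le> D. moebius d) * w n)
      = (\<Sum>d\<in>{1..D}. of_int (moebius d) * (\<Sum>n\<in>T. of_bool (d dvd n) * w n))"
  proof -
    have "(\<Sum>n\<in>T. of_int (\<Sum>d | d dvd n \<and> d \<le> D. moebius d) * w n)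
        = (\<Sum>n\<in>T. \<Sum>d\<in>{1..D}. of_int (moebius d) * (of_bool (d dvd n) * w n))"
    proof (rule sum.cong[OF refl])
      fix n assume n: "n \<in> T"
      have eq: "(\<Sum>d | d dvd n \<and> d \<le> D. moebius d) = (\<Sum>d\<in>{1..D}. of_bool (d dvd n) * moebius d)"
        using Tn(3)[OF n] by (intro sum.mono_neutral_cong_left) (auto intro: Suc_leI gr0I)
      show "of_int (\<Sum>d | d dvd n \<and> d \<le> D. moebius d) * w n
          = (\<Sum>d\<in>{1..D}. of_int (moebius d) * (of_bool (d dvd n) * w n))"
        unfolding eq of_int_sum sum_distrib_right by (intro sum.cong refl) (simp add: of_bool_def)
    qed
    also have "\<dots> = (\<Sum>d\<in>{1..D}. of_int (moebius d) * (\<Sum>n\<in>T. of_bool (d dvd n) * w n))"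
      unfolding sum_distrib_left by (rule sum.swap)
    finally show ?thesis .
  qed
  define c where "c m = (of_int (cut_coefficient D m) :: complex)" for m
  define rel where "rel m n \<longleftrightarrow> m dvd n \<and> m < n \<and> least_prime m \<le> least_prime (n div m)" for m n
  have second: "(\<Sum>n\<in>T. of_int (\<Sum>m | rel m n. cut_coefficient D m) * w n)
      = (\<Sum>m\<in>{1..<b ^ V}. \<Sum>n | n \<in> T \<and> rel m n. c m * w n)"
  proof -
    have "(\<Sum>n\<in>T. of_int (\<Sum>m | rel m n. cut_coefficient D m) * w n)
        = (\<Sum>n\<in>T. \<Sum>m\<in>{1..<b ^ V}. of_bool (rel m n) * (c m * w n))"
    proof (rule sum.cong[OF refl])
      fix n assume n: "n \<in> T"
      have small: "m < b ^ V" if m: "rel m n" "cut_coefficient D m \<noteq> 0" for m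
      proof -
        have "n = m * (n div m)" using m by (simp add: rel_def)
        moreover have "n div m > 1"
          using m(1) Tn(3)[OF n] unfolding rel_def by (metis One_nat_def calculation gr0I less_one linorder_neqE_nat mult_0_right mult_1_right nat_neq_iff)
        ultimately have "m\<^sup>2 \<le> max n (D ^ 4)"
          using cut_coefficient_square_le[OF m(2), of "n div m"] m(1) D by (simp add: rel_def)
        also have "D ^ 4 \<le> b ^ l"
          unfolding D_def power_mult[symmetric] using b \<kappa> by (intro power_increasing) auto
        then have "max n (D ^ 4) \<le> b ^ l" using Tn(2)[OF n] by simp
        also have "b ^ l < b ^ (2 * V)"
          using b by (intro power_strict_increasing) (auto simp: V_def)
        finally have "m\<^sup>2 < (b ^ V)\<^sup>2" by (simp add: power_mult[symmetric] mult.commute)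
        then show ?thesis by (rule power_less_imp_less_base) simp
      qed
      have "(\<Sum>m | rel m n. cut_coefficient D m) = (\<Sum>m\<in>{m. rel m n} \<inter> {1..<b ^ V}. cut_coefficient D m)"
      proof (rule sum.mono_neutral_right)
        show "finite {m. rel m n}"
          by (rule finite_subset[of _ "{..<n}"]) (auto simp: rel_def)
        show "\<forall>m\<in>{m. rel m n} - {m. rel m n} \<inter> {1..<b ^ V}. cut_coefficient D m = 0"
          using small by (auto simp: cut_coefficient_def not_le Suc_le_eq)
      qed auto
      also have "\<dots> = (\<Sum>m\<in>{1..<b ^ V}. of_bool (rel m n) * cut_coefficient D m)"
        by (intro sum.mono_neutral_cong_left) auto
      finally have eq: "(\<Sum>m | rel m n. cut_coefficient D m) = (\<Sum>m\<in>{1..<b ^ V}. of_bool (rel m n) * cut_coefficient D m)" .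
      show "of_int (\<Sum>m | rel m n. cut_coefficient D m) * w n
        = (\<Sum>m\<in>{1..<b ^ V}. of_bool (rel m n) * (c m * w n))"
        unfolding eq of_int_sum sum_distrib_right c_def by (intro sum.cong refl) (simp add: of_bool_def)
    qed
    also have "\<dots> = (\<Sum>m\<in>{1..<b ^ V}. \<Sum>n\<in>T. of_bool (rel m n) * (c m * w n))"
      by (rule sum.swap)
    also have "\<dots> = (\<Sum>m\<in>{1..<b ^ V}. \<Sum>n | n \<in> T \<and> rel m n. c m * w n)"
      by (intro sum.cong refl sum.mono_neutral_cong_right) (auto simp: T_def)
    finally show ?thesis .
  qed
  have third: "(\<Sum>n | n \<in> T \<and> rel m n. c m * w n) = (\<Sum>k<b ^ (l + 1 - \<mu>).
        c m * of_bool (1 < k \<and> least_prime m \<le> least_prime k) *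
        of_bool (X0 \<le> m * k \<and> m * k < X1) * of_bool (coprime (m * k) b) * f (m * k))"
    if m: "m \<in> {b ^ (\<mu> - 1)..<b ^ \<mu>}" and \<mu>: "\<mu> \<ge> 1" "\<mu> \<le> V" for m \<mu>
  proof -
    define K where "K = b ^ (l + 1 - \<mu>)"
    define A where "A = {k. k < K \<and> (1 < k \<and> least_prime m \<le> least_prime k) \<and> (X0 \<le> m * k \<and> m * k < X1)}"
    have "b ^ (\<mu> - 1) > 0" using b by simp
    then have m0: "m > 0" using m by (metis atLeastLessThan_iff less_le_trans)
    have kK: "k < K" if "m * k < X1" for k
    proof -
      have "b ^ (\<mu> - 1) * k \<le> m * k" using m by (intro mult_le_mono1) simp
      also have "\<dots> < b ^ l" using that X1 by simp
      also have "b ^ l = b ^ (\<mu> - 1) * K"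
        unfolding K_def power_add[symmetric] using \<mu> by (intro arg_cong[of _ _ "power b"]) (simp add: V_def)
      finally show ?thesis by simp
    qed
    have "(\<Sum>n | n \<in> T \<and> rel m n. c m * w n) = (\<Sum>k\<in>A. c m * w (m * k))"
    proof (rule sum.reindex_bij_witness[of _ "\<lambda>k. m * k" "\<lambda>n. n div m"])
      fix n assume n: "n \<in> {n. n \<in> T \<and> rel m n}"
      then show "m * (n div m) = n" by (simp add: rel_def)
      then have eq: "m * (n div m) = n" .
      have "n div m > 1"
      proof (rule ccontr)
        assume "\<not> n div m > 1"
        then have "m * (n div m) \<le> m * 1" by (intro mult_le_mono2) simp
        then show False using eq n by (simp add: rel_def)
      qed
      then show "n div m \<in> A"
        using n eq kK[of "n div m"] by (auto simp: A_def rel_def T_def)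
      show "c m * w (m * (n div m)) = c m * w n" using eq by simp
    next
      fix k assume k: "k \<in> A"
      then show "m * k div m = k" using m0 by simp
      show "m * k \<in> {n. n \<in> T \<and> rel m n}"
        using k m0 by (auto simp: A_def T_def rel_def)
    qed
    also have "\<dots> = (\<Sum>k<K. of_bool (k \<in> A) * (c m * w (m * k)))"
      by (intro sum.mono_neutral_cong_left) (auto simp: A_def)
    also have "\<dots> = (\<Sum>k<K. c m * of_bool (1 < k \<and> least_prime m \<le> least_prime k) *
        of_bool (X0 \<le> m * k \<and> m * k < X1) * of_bool (coprime (m * k) b) * f (m * k))"
    proof (rule sum.cong[OF refl])
      fix k assume "k \<in> {..<K}"
      then have "of_bool (k \<in> A) = (of_bool (1 < k \<and> least_prime m \<le> least_prime k) * of_bool (X0 \<le> m * k \<and> m * k < X1) :: complex)"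
        by (auto simp: A_def)
      then show "of_bool (k \<in> A) * (c m * w (m * k)) = c m * of_bool (1 < k \<and> least_prime m \<le> least_prime k) *
        of_bool (X0 \<le> m * k \<and> m * k < X1) * of_bool (coprime (m * k) b) * f (m * k)"
        by (simp only: w_def mult_ac)
    qed
    finally show ?thesis by (simp only: K_def)
  qed
  have "(\<Sum>n\<in>T. of_bool (prime n) * w n)
      = (\<Sum>n\<in>T. of_int (\<Sum>d | d dvd n \<and> d \<le> D. moebius d) * w n + of_int (\<Sum>m | rel m n. cut_coefficient D m) * w n)"
  proof (rule sum.cong[OF refl])
    fix n assume n: "n \<in> T"
    have "(of_bool (prime n) :: complex) = of_int (of_bool (prime n))" by simp
    also have "(of_bool (prime n) :: int) = (\<Sum>d | d dvd n \<and> d \<le> D. moebius d) + (\<Sum>m | rel m n. cut_coefficient D m)"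
      unfolding rel_def by (rule prime_indicator_decomposition[OF Tn(1)[OF n] D])
    finally show "of_bool (prime n) * w n = of_int (\<Sum>d | d dvd n \<and> d \<le> D. moebius d) * w n + of_int (\<Sum>m | rel m n. cut_coefficient D m) * w n"
      by (simp only: of_int_add distrib_right)
  qed
  also have "\<dots> = (\<Sum>d\<in>{1..D}. of_int (moebius d) * (\<Sum>n\<in>T. of_bool (d dvd n) * w n))
      + (\<Sum>m\<in>{1..<b ^ V}. \<Sum>n | n \<in> T \<and> rel m n. c m * w n)"
    by (simp only: sum.distrib first second)
  also have "(\<Sum>m\<in>{1..<b ^ V}. \<Sum>n | n \<in> T \<and> rel m n. c m * w n)
      = (\<Sum>\<mu>=1..V. \<Sum>m\<in>{b ^ (\<mu> - 1)..<b ^ \<mu>}. \<Sum>n | n \<in> T \<and> rel m n. c m * w n)"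
    using b by (intro sum_blocks) simp
  also have "\<dots> = (\<Sum>\<mu>=1..V. \<Sum>m\<in>{b ^ (\<mu> - 1)..<b ^ \<mu>}. \<Sum>k<b ^ (l + 1 - \<mu>).
        c m * of_bool (1 < k \<and> least_prime m \<le> least_prime k) *
        of_bool (X0 \<le> m * k \<and> m * k < X1) * of_bool (coprime (m * k) b) * f (m * k))"
    by (intro sum.cong refl third) auto
  finally show ?thesis
    unfolding w_def T_def D_def X0_def V_def c_def by (simp only: mult.assoc)
qed

text \<open>The condition linking the least prime factors is an interval condition on \<open>least_prime m\<close>
  for each \<open>k\<close>. Its Fourier expansion separates the variables at logarithmic cost.\<close>

lemma norm_block_sum_le:
  fixes f :: "nat \<Rightarrow> complex"
  assumes b: "b \<ge> 2" and D: "D \<ge> 1" and \<mu>: "1 \<le> \<mu>" "\<mu> \<le> l + 1"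
    and B: "\<And>x y. (\<And>m. norm (x m) \<le> 1) \<Longrightarrow> (\<And>k. norm (y k) \<le> 1) \<Longrightarrow>
      norm (\<Sum>m\<in>{b ^ (\<mu> - 1)..<b ^ \<mu>}. \<Sum>k<b ^ (l + 1 - \<mu>).
        x m * y k * of_bool (X0 \<le> m * k \<and> m * k < X1) * f (m * k)) \<le> B"
  shows "norm (\<Sum>m\<in>{b ^ (\<mu> - 1)..<b ^ \<mu>}. \<Sum>k<b ^ (l + 1 - \<mu>).
        of_int (cut_coefficient D m) * of_bool (1 < k \<and> least_prime m \<le> least_prime k) *
        of_bool (X0 \<le> m * k \<and> m * k < X1) * of_bool (coprime (m * k) b) * f (m * k))
    \<le> (3 + 2 * ln (real b ^ (l + 1))) * B"
proof -
  define M K Q where "M = {b ^ (\<mu> - 1)..<b ^ \<mu>}" and "K = b ^ (l + 1 - \<mu>)" and "Q = b ^ (l + 1)"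
  have Q: "Q > 0" using b by (simp add: Q_def)
  have lpQ: "least_prime n < Q" if "n > 1" "n < Q" for n
  proof -
    have "least_prime n \<le> n" using least_prime_prime(2)[OF that(1)] that(1) by (intro dvd_imp_le) auto
    then show ?thesis using that by simp
  qed
  have KQ: "k < Q" if "k < K" for k
  proof -
    have "K \<le> Q" unfolding K_def Q_def using b by (intro power_increasing) auto
    then show ?thesis using that by simp
  qed
  have MQ: "m < Q" if "m \<in> M" for m
  proof -
    have "b ^ \<mu> \<le> Q" unfolding Q_def using b \<mu> by (intro power_increasing) auto
    then show ?thesis using that by (simp add: M_def)
  qed
  have "\<exists>H. \<forall>k. 1 < k \<and> k < K \<longrightarrow>
      (\<forall>p<Q. (\<Sum>z<Q. H k z * ee (real z * real p / real Q)) = of_bool (p \<in> {0..<Suc (least_prime k)})) \<and>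
      (\<forall>z<Q. norm (H k z) \<le> iota Q z)"
  proof (intro choice allI)
    fix k
    show "\<exists>h. 1 < k \<and> k < K \<longrightarrow>
      (\<forall>p<Q. (\<Sum>z<Q. h z * ee (real z * real p / real Q)) = of_bool (p \<in> {0..<Suc (least_prime k)})) \<and>
      (\<forall>z<Q. norm (h z) \<le> iota Q z)"
    proof (cases "1 < k \<and> k < K")
      case True
      then have "Suc (least_prime k) \<le> Q" using lpQ[of k] KQ[of k] by simp
      from interval_indicator_expansion[OF this Q, of 0] show ?thesis by metis
    next
      case False
      show ?thesis by (intro exI impI) (rule notE[OF False])
    qed
  qed
  then obtain H where H1: "\<And>k p. 1 < k \<Longrightarrow> k < K \<Longrightarrow> p < Q \<Longrightarrow>
      (\<Sum>z<Q. H k z * ee (real z * real p / real Q)) = of_bool (p \<in> {0..<Suc (least_prime k)})"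
    and H2: "\<And>k z. 1 < k \<Longrightarrow> k < K \<Longrightarrow> z < Q \<Longrightarrow> norm (H k z) \<le> iota Q z" by blast
  define x where "x z m = of_int (cut_coefficient D m) * of_bool (coprime m b) * ee (real z * real (least_prime m) / real Q)" for z m :: nat
  (* Dividing by the weight iota, which is positive, keeps the coefficients in the unit disc. *)
  define y where "y z k = (if 1 < k \<and> k < K \<and> z < Q then of_bool (coprime k b) * H k z / of_real (iota Q z) else 0)" for z k
  have nx: "norm (x z m) \<le> 1" for z m
  proof -
    have "\<bar>cut_coefficient D m\<bar> \<le> 1" using abs_moebius_le_1 by (simp add: cut_coefficient_def)
    then have "norm (of_int (cut_coefficient D m) :: complex) \<le> 1"
      by (simp only: norm_of_int)
    then show ?thesis by (simp add: x_def norm_mult of_bool_def)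
  qed
  have ny: "norm (y z k) \<le> 1" for z k
    using H2[of k z] iota_pos[of Q z] by (auto simp: y_def norm_mult norm_divide of_bool_def divide_le_eq)
  have B0: "B \<ge> 0" using B[of "\<lambda>_. 0" "\<lambda>_. 0"] by simp
  have sep: "of_int (cut_coefficient D m) * of_bool (1 < k \<and> least_prime m \<le> least_prime k) *
        of_bool (X0 \<le> m * k \<and> m * k < X1) * of_bool (coprime (m * k) b) * f (m * k)
      = (\<Sum>z<Q. of_real (iota Q z) * (x z m * y z k * of_bool (X0 \<le> m * k \<and> m * k < X1) * f (m * k)))"
    if m: "m \<in> M" and k: "k < K" for m k
  proof (cases "1 < k \<and> cut_coefficient D m \<noteq> 0")
    case True
    then have "D < m" by (auto simp: cut_coefficient_def split: if_splits)
    then have m1: "m > 1" using D by simp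
    have "(\<Sum>z<Q. of_real (iota Q z) * (x z m * y z k * of_bool (X0 \<le> m * k \<and> m * k < X1) * f (m * k)))
       = (\<Sum>z<Q. (of_int (cut_coefficient D m) * of_bool (X0 \<le> m * k \<and> m * k < X1) *
            (of_bool (coprime m b) * of_bool (coprime k b)) * f (m * k)) *
            (H k z * ee (real z * real (least_prime m) / real Q)))"
    proof (rule sum.cong[OF refl])
      fix z assume "z \<in> {..<Q}"
      then have "of_real (iota Q z) * y z k = of_bool (coprime k b) * H k z"
        using True k iota_pos[of Q z] by (simp add: y_def)
      moreover have "of_real (iota Q z) * (x z m * y z k * of_bool (X0 \<le> m * k \<and> m * k < X1) * f (m * k))
          = x z m * (of_real (iota Q z) * y z k) * of_bool (X0 \<le> m * k \<and> m * k < X1) * f (m * k)"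
        by (simp only: mult_ac)
      ultimately show "of_real (iota Q z) * (x z m * y z k * of_bool (X0 \<le> m * k \<and> m * k < X1) * f (m * k))
        = (of_int (cut_coefficient D m) * of_bool (X0 \<le> m * k \<and> m * k < X1) *
            (of_bool (coprime m b) * of_bool (coprime k b)) * f (m * k)) *
            (H k z * ee (real z * real (least_prime m) / real Q))"
        by (simp only: x_def mult_ac)
    qed
    also have "\<dots> = (of_int (cut_coefficient D m) * of_bool (X0 \<le> m * k \<and> m * k < X1) *
            (of_bool (coprime m b) * of_bool (coprime k b)) * f (m * k)) * of_bool (least_prime m \<in> {0..<Suc (least_prime k)})"
      unfolding sum_distrib_left[symmetric] using True k lpQ[OF m1 MQ[OF m]] by (simp only: H1)
    also have "of_bool (coprime m b) * of_bool (coprime k b) = (of_bool (coprime (m * k) b) :: complex)"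
      by (simp add: coprime_mult_left_iff of_bool_conj)
    finally show ?thesis using True by (simp add: less_Suc_eq_le mult_ac)
  next
    case False
    then show ?thesis by (auto simp: x_def y_def)
  qed
  have "(\<Sum>m\<in>M. \<Sum>k<K. of_int (cut_coefficient D m) * of_bool (1 < k \<and> least_prime m \<le> least_prime k) *
        of_bool (X0 \<le> m * k \<and> m * k < X1) * of_bool (coprime (m * k) b) * f (m * k))
     = (\<Sum>m\<in>M. \<Sum>k<K. \<Sum>z<Q. of_real (iota Q z) * (x z m * y z k * of_bool (X0 \<le> m * k \<and> m * k < X1) * f (m * k)))"
    by (intro sum.cong refl sep) auto
  also have "\<dots> = (\<Sum>z<Q. of_real (iota Q z) * (\<Sum>m\<in>M. \<Sum>k<K. x z m * y z k * of_bool (X0 \<le> m * k \<and> m * k < X1) * f (m * k)))"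
    unfolding sum_distrib_left by (rule trans[OF sum.cong[OF refl sum.swap] sum.swap])
  finally have eq: "(\<Sum>m\<in>M. \<Sum>k<K. of_int (cut_coefficient D m) * of_bool (1 < k \<and> least_prime m \<le> least_prime k) *
        of_bool (X0 \<le> m * k \<and> m * k < X1) * of_bool (coprime (m * k) b) * f (m * k))
     = (\<Sum>z<Q. of_real (iota Q z) * (\<Sum>m\<in>M. \<Sum>k<K. x z m * y z k * of_bool (X0 \<le> m * k \<and> m * k < X1) * f (m * k)))" .
  have "norm (\<Sum>m\<in>M. \<Sum>k<K. of_int (cut_coefficient D m) * of_bool (1 < k \<and> least_prime m \<le> least_prime k) *
        of_bool (X0 \<le> m * k \<and> m * k < X1) * of_bool (coprime (m * k) b) * f (m * k)) \<le> (\<Sum>z<Q. iota Q z * B)"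
    unfolding eq
  proof (rule sum_norm_le)
    fix z
    have "norm (\<Sum>m\<in>M. \<Sum>k<K. x z m * y z k * of_bool (X0 \<le> m * k \<and> m * k < X1) * f (m * k)) \<le> B"
      unfolding M_def K_def by (intro B nx ny)
    then show "norm (of_real (iota Q z) * (\<Sum>m\<in>M. \<Sum>k<K. x z m * y z k * of_bool (X0 \<le> m * k \<and> m * k < X1) * f (m * k))) \<le> iota Q z * B"
      by (simp add: norm_mult iota_nonneg mult_left_mono)
  qed
  also have "\<dots> = (\<Sum>z<Q. iota Q z) * B" by (simp add: sum_distrib_right)
  also have "\<dots> \<le> (3 + 2 * ln (real Q)) * B"
    using Q B0 by (intro mult_right_mono sum_iota_le) auto
  finally show ?thesis by (simp add: M_def K_def Q_def)
qed

text \<open>A divisor of \<open>b^L\<close> is determined by its multiplicities at the primes dividing \<open>b\<close>, so there are only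
  polynomially many in \<open>L\<close>.\<close>

lemma card_divisors_power_le:
  assumes b: "b \<ge> 2"
  shows "card {g. g dvd b ^ L} \<le> (b * L + 1) ^ b"
proof -
  define P where "P = prime_factors b"
  have finP: "finite P" by (simp add: P_def)
  have "P \<subseteq> {1..b}"
    unfolding P_def using b by (auto simp: prime_factors_dvd Suc_le_eq prime_gt_0_nat dest: dvd_imp_le)
  then have cardP: "card P \<le> b" using card_mono[of "{1..b}" P] by simp
  define m where "m g = restrict (\<lambda>p. multiplicity p g) P" for g :: nat
  have bL: "b ^ L > 0" using b by simp
  have le: "multiplicity p g \<le> b * L" if "p \<in> P" "g dvd b ^ L" for p g
  proof -
    have p: "prime p" using that by (auto simp: P_def)
    have "multiplicity p g \<le> multiplicity p (b ^ L)"
      using that bL by (intro dvd_imp_multiplicity_le) auto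
    also have "\<dots> = L * multiplicity p b"
      using p b by (intro prime_elem_multiplicity_power_distrib) auto
    also have "multiplicity p b \<le> b"
    proof -
      have "p ^ multiplicity p b \<le> b" using b by (intro dvd_imp_le multiplicity_dvd) auto
      moreover have "multiplicity p b < p ^ multiplicity p b"
        using prime_gt_1_nat[OF p] by (simp add: power_gt_expt)
      ultimately show ?thesis by simp
    qed
    finally show ?thesis by (simp add: mult.commute)
  qed
  have "inj_on m {g. g dvd b ^ L}"
  proof (rule inj_onI)
    fix g h assume g: "g \<in> {g. g dvd b ^ L}" and h: "h \<in> {g. g dvd b ^ L}" and eq: "m g = m h"
    show "g = h"
    proof (rule multiplicity_eq_nat)
      show "g > 0" "h > 0" using g h bL by (auto dest: dvd_pos_nat)
      fix p :: nat assume p: "prime p"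
      show "multiplicity p g = multiplicity p h"
      proof (cases "p \<in> P")
        case True
        then show ?thesis using fun_cong[OF eq, of p] by (simp add: m_def)
      next
        case False
        then have "\<not> p dvd b" using p b by (simp add: P_def prime_factors_dvd)
        then have "\<not> p dvd b ^ L" using p by (metis prime_dvd_power)
        then have "\<not> p dvd g" "\<not> p dvd h" using g h by (auto intro: dvd_trans)
        then show ?thesis by (simp add: not_dvd_imp_multiplicity_0)
      qed
    qed
  qed
  moreover have "m ` {g. g dvd b ^ L} \<subseteq> P \<rightarrow>\<^sub>E {..b * L}"
    using le by (auto simp: m_def)
  moreover have "finite (P \<rightarrow>\<^sub>E {..b * L})" using finP by (intro finite_PiE) auto
  ultimately have "card {g. g dvd b ^ L} \<le> card (P \<rightarrow>\<^sub>E {..b * L})"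
    by (rule card_inj_on_le)
  also have "\<dots> = (b * L + 1) ^ card P"
    using finP by (simp add: card_PiE)
  also have "\<dots> \<le> (b * L + 1) ^ b"
    using cardP by (intro power_increasing) auto
  finally show ?thesis .
qed

text \<open>A divisor \<open>d \<le> b^\<kappa>\<close> uses up at most \<open>2 * \<kappa>\<close> of the digits, which leaves at least \<open>l / 2\<close> for the
  decay. The harmonic sum over \<open>d\<close> costs a logarithm.\<close>

lemma norm_sum_small_divisors_le:
  fixes \<tau> :: real
  assumes b: "b \<ge> 2" and \<kappa>: "4 * \<kappa> \<le> l" and X: "X1 \<le> b ^ l" and \<tau>: "\<tau> \<ge> 0"
    and E: "\<And>k L \<theta>. k + L \<le> l \<Longrightarrow> norm (digital_transform b (\<lambda>i. a (k + i)) L \<theta>) \<le> 3 * exp (- (\<tau> * real L))"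
  shows "norm (\<Sum>d\<in>{1..b ^ \<kappa>}. of_int (moebius d) * (\<Sum>n\<in>{X0..<X1}. of_bool (d dvd n) * of_bool (coprime n b) * digital_char b a l n))
    \<le> (1 + ln (real b ^ \<kappa>)) * ((3 + 2 * ln (real b ^ l)) * ((real b)\<^sup>2 * real b ^ l * (3 * exp (- (\<tau> * real l / 2)))))"
proof -
  define c where "c = (3 + 2 * ln (real b ^ l)) * ((real b)\<^sup>2 * real b ^ l * (3 * exp (- (\<tau> * real l / 2))))"
  have ln0: "ln (real b ^ l) \<ge> 0" using b by simp
  have c0: "c \<ge> 0" unfolding c_def using ln0 by (intro mult_nonneg_nonneg) auto
  have each: "norm (of_int (moebius d) * (\<Sum>n\<in>{X0..<X1}. of_bool (d dvd n) * of_bool (coprime n b) * digital_char b a l n)) \<le> 1 / real d * c"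
    if d: "d \<in> {1..b ^ \<kappa>}" for d
  proof -
    have "norm (\<Sum>n\<in>{X0..<X1}. of_bool (d dvd n) * of_bool (coprime n b) * digital_char b a l n) \<le> 1 / real d * c"
    proof (cases "coprime d b")
      case True
      obtain J where J: "b ^ J \<le> d" "d < b ^ (J + 1)" using ex_power_ivl1[OF b, of d] d by auto
      have "b ^ J \<le> b ^ \<kappa>" using J d by simp
      then have "J \<le> \<kappa>" using b by simp
      then have J2: "2 * J \<le> l" "4 * J \<le> l" using \<kappa> by auto
      have "norm (\<Sum>n\<in>{X0..<X1}. of_bool (d dvd n) * of_bool (coprime n b) * digital_char b a l n)
        \<le> (3 + 2 * ln (real b ^ l)) * ((real b)\<^sup>2 * real b ^ l / real d * (3 * exp (- (\<tau> * real (l - 2 * J)))))"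
        using J by (intro norm_sum_digital_char_multiples_le b True J2 E X) auto
      also have "\<dots> \<le> (3 + 2 * ln (real b ^ l)) * ((real b)\<^sup>2 * real b ^ l / real d * (3 * exp (- (\<tau> * real l / 2))))"
      proof -
        have "real l / 2 \<le> real (l - 2 * J)" using J2 by (simp add: of_nat_diff)
        then have "\<tau> * (real l / 2) \<le> \<tau> * real (l - 2 * J)" using \<tau> by (rule mult_left_mono)
        then show ?thesis using ln0 by (intro mult_left_mono) auto
      qed
      also have "\<dots> = 1 / real d * c" by (simp add: c_def)
      finally show ?thesis .
    next
      case False
      then have "of_bool (d dvd n) * of_bool (coprime n b) = (0 :: complex)" for n
        by (auto simp: of_bool_def dest: coprime_divisors[of d n b b])
      then have "norm (\<Sum>n\<in>{X0..<X1}. of_bool (d dvd n) * of_bool (coprime n b) * digital_char b a l n) = 0"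
        by (simp only: mult_zero_left sum.neutral_const norm_zero)
      then show ?thesis using c0 by simp
    qed
    moreover have "norm (of_int (moebius d) :: complex) \<le> 1"
      using abs_moebius_le_1[of d] by (simp only: norm_of_int)
    ultimately show ?thesis
      unfolding norm_mult by (smt (verit) mult_left_le_one_le norm_ge_zero)
  qed
  have "norm (\<Sum>d\<in>{1..b ^ \<kappa>}. of_int (moebius d) * (\<Sum>n\<in>{X0..<X1}. of_bool (d dvd n) * of_bool (coprime n b) * digital_char b a l n))
     \<le> (\<Sum>d\<in>{1..b ^ \<kappa>}. 1 / real d * c)"
    by (rule sum_norm_le) (rule each)
  also have "\<dots> = (\<Sum>d=1..b ^ \<kappa>. 1 / real d) * c" by (simp only: sum_distrib_right)
  also have "\<dots> \<le> (1 + ln (real (b ^ \<kappa>))) * c"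
    using b by (intro mult_right_mono c0 sum_inverse_le) (simp add: Suc_leI)
  finally show ?thesis by (simp add: c_def)
qed

text \<open>The block length \<open>\<rho>\<close> is a small multiple of \<open>l / ln q\<close>: large enough for the van der Corput
  step to save \<open>b^\<rho>\<close>, and small enough that the losses \<open>b^(5 * \<rho>)\<close> are absorbed by the decay of
  the transform.\<close>

lemma typeII_parameters:
  fixes b :: nat and c \<delta> Cg :: real
  assumes b: "b \<ge> 2" and c: "c > 0" and \<delta>: "0 < \<delta>" "\<delta> < 1" and Cg: "Cg \<ge> 1"
  obtains c4 A where "c4 > 0" "c4 \<le> c / 8" "A \<ge> 0"
    and "\<And>q l. q \<ge> (2 :: nat) \<Longrightarrow> l \<ge> (4 :: nat) \<Longrightarrow> \<exists>\<rho>. \<forall>\<mu>. l div 4 < \<mu> \<longrightarrow> \<mu> \<le> l div 2 + 1 \<longrightarrow>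
      \<mu> + 2 * \<rho> \<le> l \<and> 1 / real b ^ \<rho> \<le> real b * exp (- (c4 * (real l / ln (real q)))) \<and>
      real b ^ (4 * \<rho>) * (Cg * (1 - \<delta>) ^ (\<mu> + 2 * \<rho> - (\<mu> + 2 * \<rho>) div 2)
          + real b ^ \<rho> * (3 * exp (- (c / ln (real q) * real ((\<mu> + 2 * \<rho>) div 2))))\<^sup>2)
        \<le> A * exp (- (c4 * (real l / ln (real q))))"
proof -
  define B where "B = ln (real b)"
  have B: "B > 0" using b by (simp add: B_def)
  define c3 where "c3 = min (ln 2 / 8) (min (c / (40 * B)) (\<delta> * ln 2 / (64 * B)))"
  define c4 where "c4 = min (c3 * B) (min (c / 8) (\<delta> * ln 2 / 16))"
  define A where "A = Cg + 9 * exp (c / ln 2)"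
  have c3: "c3 > 0" "c3 \<le> ln 2 / 8" "c3 \<le> c / (40 * B)" "c3 \<le> \<delta> * ln 2 / (64 * B)"
    using B c \<delta> by (auto simp: c3_def)
  have c3B: "40 * (c3 * B) \<le> c" "64 * (c3 * B) \<le> \<delta> * ln 2"
    using c3(3,4) B by (simp_all add: field_simps)
  have c4: "c4 > 0" "c4 \<le> c3 * B" "c4 \<le> c / 8" "c4 \<le> \<delta> * ln 2 / 16"
    using c3 B c \<delta> by (auto simp: c4_def)
  show ?thesis
  proof (rule that[of c4 A])
    show "c4 > 0" "c4 \<le> c / 8" by fact+
    show "A \<ge> 0" using Cg by (simp add: A_def)
    fix q l :: nat assume q: "q \<ge> 2" and l: "l \<ge> 4"
    define Y where "Y = real l / ln (real q)"
    have lnq: "ln (real q) \<ge> ln 2" "ln (real q) > 0" "ln (2 :: real) > 0" using q by auto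
    have Y: "Y > 0" unfolding Y_def using lnq(2) l by (intro divide_pos_pos) auto
    have Yl: "Y * ln 2 \<le> real l"
    proof -
      have "Y * ln 2 \<le> Y * ln (real q)" using Y lnq by (intro mult_left_mono) auto
      then show ?thesis using lnq by (simp add: Y_def)
    qed
    define \<rho> where "\<rho> = nat \<lfloor>c3 * Y\<rfloor>"
    have \<rho>: "real \<rho> \<le> c3 * Y" "c3 * Y - 1 \<le> real \<rho>"
      using c3 Y by (auto simp: \<rho>_def intro: of_nat_floor less_imp_le)
    have pow: "real b ^ n = exp (real n * B)" for n
      using b by (simp add: B_def exp_of_nat_mult)
    show "\<exists>\<rho>. \<forall>\<mu>. l div 4 < \<mu> \<longrightarrow> \<mu> \<le> l div 2 + 1 \<longrightarrow>
      \<mu> + 2 * \<rho> \<le> l \<and> 1 / real b ^ \<rho> \<le> real b * exp (- (c4 * (real l / ln (real q)))) \<and>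
      real b ^ (4 * \<rho>) * (Cg * (1 - \<delta>) ^ (\<mu> + 2 * \<rho> - (\<mu> + 2 * \<rho>) div 2)
          + real b ^ \<rho> * (3 * exp (- (c / ln (real q) * real ((\<mu> + 2 * \<rho>) div 2))))\<^sup>2)
        \<le> A * exp (- (c4 * (real l / ln (real q))))"
      unfolding Y_def[symmetric]
    proof (intro exI[of _ \<rho>] allI impI)
      fix \<mu> assume \<mu>: "l div 4 < \<mu>" "\<mu> \<le> l div 2 + 1"
      define L where "L = \<mu> + 2 * \<rho>"
      have \<rho>l: "8 * \<rho> \<le> l"
      proof -
        have "8 * (c3 * Y) \<le> 8 * (ln 2 / 8 * Y)"
          using c3 Y by (intro mult_left_mono mult_right_mono) auto
        then have "8 * real \<rho> \<le> real l" using \<rho>(1) Yl by (simp add: mult.commute)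
        then have "real (8 * \<rho>) \<le> real l" by simp
        then show ?thesis by (simp only: of_nat_le_iff)
      qed
      have "2 * \<mu> \<le> l + 2" using \<mu>(2) by simp
      then have Ll: "L \<le> l" using \<rho>l l unfolding L_def by linarith
      have L4: "real l \<le> 4 * real L"
      proof -
        have "l < \<mu> * 4" using \<mu>(1) by (simp add: div_less_iff_less_mult)
        then have "l \<le> 4 * L" unfolding L_def by simp
        then have "real l \<le> real (4 * L)" by (simp only: of_nat_le_iff)
        then show ?thesis by simp
      qed
      have half: "real L \<le> 2 * real (L - L div 2)" "real L \<le> 2 * real (L div 2) + 1"
      proof -
        have "L = 2 * (L div 2) + L mod 2" "L mod 2 \<le> 1" by simp_all
        then have "L \<le> 2 * (L - L div 2)" "L \<le> 2 * (L div 2) + 1" by linarith+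
        then have "real L \<le> real (2 * (L - L div 2))" "real L \<le> real (2 * (L div 2) + 1)"
          by (simp_all only: of_nat_le_iff)
        then show "real L \<le> 2 * real (L - L div 2)" "real L \<le> 2 * real (L div 2) + 1" by simp_all
      qed
      have first: "1 / real b ^ \<rho> \<le> real b * exp (- (c4 * Y))"
      proof -
        have "(c3 * Y - 1) * B \<le> real \<rho> * B" using \<rho>(2) B by (intro mult_right_mono) auto
        moreover have "c4 * Y \<le> c3 * B * Y" using c4 Y by (intro mult_right_mono) auto
        ultimately have "- (real \<rho> * B) \<le> B + - (c4 * Y)" by (simp add: algebra_simps)
        then have "exp (- (real \<rho> * B)) \<le> exp B * exp (- (c4 * Y))"
          by (simp flip: exp_add)
        then show ?thesis
          using b unfolding pow by (simp add: exp_minus field_simps B_def)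
      qed
      have second: "real b ^ (4 * \<rho>) * (Cg * (1 - \<delta>) ^ (L - L div 2)) \<le> Cg * exp (- (c4 * Y))"
      proof -
        have "(1 - \<delta>) ^ (L - L div 2) \<le> exp (- \<delta>) ^ (L - L div 2)"
          using \<delta> exp_ge_add_one_self[of "- \<delta>"] by (intro power_mono) auto
        also have "\<dots> = exp (- (\<delta> * real (L - L div 2)))"
          using exp_of_nat_mult[of "L - L div 2" "- \<delta>"] by (simp add: mult.commute)
        finally have 1: "(1 - \<delta>) ^ (L - L div 2) \<le> exp (- (\<delta> * real (L - L div 2)))" .
        have "real l / 8 \<le> real (L - L div 2)" using L4 half(1) by linarith
        then have "\<delta> * (real l / 8) \<le> \<delta> * real (L - L div 2)" using \<delta> by (intro mult_left_mono) auto
        moreover have "\<delta> * (Y * ln 2) \<le> \<delta> * real l" using Yl \<delta> by (intro mult_left_mono) auto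
        moreover have "4 * real \<rho> * B \<le> \<delta> * (Y * ln 2) / 16"
        proof -
          have "64 * (real \<rho> * B) \<le> 64 * (c3 * Y * B)" using \<rho>(1) B by (intro mult_left_mono mult_right_mono) auto
          also have "\<dots> = 64 * (c3 * B) * Y" by simp
          also have "\<dots> \<le> \<delta> * ln 2 * Y" using c3B Y by (intro mult_right_mono) auto
          finally show ?thesis by (simp add: mult_ac)
        qed
        moreover have "c4 * Y \<le> \<delta> * (Y * ln 2) / 16"
        proof -
          have "c4 * Y \<le> \<delta> * ln 2 / 16 * Y" using c4(4) Y by (intro mult_right_mono) auto
          then show ?thesis by (simp add: mult_ac)
        qed
        ultimately have "4 * real \<rho> * B - \<delta> * real (L - L div 2) \<le> - (c4 * Y)" by linarith
        then have 2: "exp (4 * real \<rho> * B) * exp (- (\<delta> * real (L - L div 2))) \<le> exp (- (c4 * Y))"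
          by (simp flip: exp_add)
        have "real b ^ (4 * \<rho>) * (Cg * (1 - \<delta>) ^ (L - L div 2)) \<le> exp (4 * real \<rho> * B) * (Cg * exp (- (\<delta> * real (L - L div 2))))"
          unfolding pow using 1 Cg by (intro mult_mono) (auto simp: \<delta> less_imp_le)
        also have "\<dots> = Cg * (exp (4 * real \<rho> * B) * exp (- (\<delta> * real (L - L div 2))))" by simp
        also have "\<dots> \<le> Cg * exp (- (c4 * Y))" using 2 Cg by (intro mult_left_mono) auto
        finally show ?thesis .
      qed
      have third: "real b ^ (4 * \<rho>) * (real b ^ \<rho> * (3 * exp (- (c / ln (real q) * real (L div 2))))\<^sup>2)
          \<le> 9 * exp (c / ln 2) * exp (- (c4 * Y))"
      proof -
        have "real b ^ (4 * \<rho>) * (real b ^ \<rho> * (3 * exp (- (c / ln (real q) * real (L div 2))))\<^sup>2)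
            = 9 * (exp (5 * real \<rho> * B) * exp (- (c / ln (real q) * (2 * real (L div 2)))))"
          unfolding pow by (simp add: power_mult_distrib power2_eq_square algebra_simps flip: exp_add)
        also have "\<dots> \<le> 9 * exp (c / ln 2 + - (c4 * Y))"
        proof -
          have "5 * (real \<rho> * B) \<le> 5 * (c3 * Y * B)" using \<rho>(1) B by (intro mult_left_mono mult_right_mono) auto
          also have "8 * \<dots> = 40 * (c3 * B) * Y" by simp
          also have "\<dots> \<le> c * Y" using c3B Y by (intro mult_right_mono) auto
          finally have 1: "8 * (5 * (real \<rho> * B)) \<le> c * Y" by simp
          have "real l / 4 - 1 \<le> 2 * real (L div 2)" using L4 half(2) by linarith
          then have "c / ln (real q) * (real l / 4 - 1) \<le> c / ln (real q) * (2 * real (L div 2))"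
            using c lnq(2) by (intro mult_left_mono divide_nonneg_pos) auto
          moreover have "c / ln (real q) * (real l / 4 - 1) = c * Y / 4 - c / ln (real q)"
            by (simp add: Y_def right_diff_distrib)
          moreover have "c / ln (real q) \<le> c / ln 2"
            by (rule divide_left_mono[OF lnq(1) less_imp_le[OF c] mult_pos_pos[OF lnq(2,3)]])
          moreover have "c4 * Y \<le> c * Y / 8" using mult_right_mono[OF c4(3), of Y] Y by simp
          moreover have "5 * real \<rho> * B - u \<le> w + - (c4 * Y)"
            if "v \<le> u" "v = c * Y / 4 - t" "t \<le> w" "c4 * Y \<le> c * Y / 8" for u v w t
            using that 1 by linarith
          ultimately have "5 * real \<rho> * B - c / ln (real q) * (2 * real (L div 2)) \<le> c / ln 2 + - (c4 * Y)"
            by blast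
          then show ?thesis by (simp flip: exp_add)
        qed
        finally show ?thesis by (simp only: exp_add mult.assoc)
      qed
      have "real b ^ (4 * \<rho>) * (Cg * (1 - \<delta>) ^ (L - L div 2) + real b ^ \<rho> * (3 * exp (- (c / ln (real q) * real (L div 2))))\<^sup>2)
        \<le> A * exp (- (c4 * Y))"
        unfolding A_def distrib_left distrib_right using second third by (rule add_mono)
      then show "\<mu> + 2 * \<rho> \<le> l \<and> 1 / real b ^ \<rho> \<le> real b * exp (- (c4 * Y)) \<and>
        real b ^ (4 * \<rho>) * (Cg * (1 - \<delta>) ^ (\<mu> + 2 * \<rho> - (\<mu> + 2 * \<rho>) div 2)
            + real b ^ \<rho> * (3 * exp (- (c / ln (real q) * real ((\<mu> + 2 * \<rho>) div 2))))\<^sup>2)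
          \<le> A * exp (- (c4 * Y))"
        using first Ll unfolding L_def by blast
    qed
  qed
qed

text \<open>The cut is at \<open>D = b^(l div 4)\<close>, so that \<open>D^4 \<le> b^l\<close> and every \<open>m\<close> of the bilinear sums has at
  least \<open>l / 4\<close> digits, enough for both the energy gap and the decay. Dyadic blocks in \<open>m\<close> become
  \<open>b\<close>-adic ones.\<close>

lemma norm_sum_primes_reversal_le:
  fixes b :: nat
  assumes b: "b \<ge> 2"
  obtains c A where "c > 0" "A \<ge> 0"
    and "\<And>q h l X1. q \<ge> 2 \<Longrightarrow> (\<And>e. \<not> q dvd h * (b\<^sup>2 - 1) * b ^ e) \<Longrightarrow> l \<ge> 4 \<Longrightarrow> X1 \<le> b ^ l \<Longrightarrow>
      norm (\<Sum>n\<in>{b ^ (l - 1)..<X1}. of_bool (prime n) * of_bool (coprime n b) * ee (real h / real q * real (digit_reverse b l n)))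
        \<le> A * real l ^ (b + 3) * real b ^ l * exp (- (c * (real l / ln (real q))))"
proof -
  obtain c where c: "c > 0"
    and decay: "\<And>q h l k L \<theta>. q \<ge> 2 \<Longrightarrow> (\<And>e. \<not> q dvd h * (b\<^sup>2 - 1) * b ^ e) \<Longrightarrow> k + L \<le> l \<Longrightarrow>
      norm (digital_transform b (\<lambda>i. reversal_phase b l (real h / real q) (k + i)) L \<theta>)
        \<le> 3 * exp (- (c * real L / ln (real q)))"
    using norm_digital_transform_reversal_le[OF b] by metis
  obtain \<delta> Cg where \<delta>: "0 < \<delta>" "\<delta> < 1" and Cg: "Cg \<ge> 1"
    and gap: "\<And>a L J g. g dvd b ^ L \<Longrightarrow> \<not> b ^ J dvd g \<Longrightarrow> J \<le> L \<Longrightarrow>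
      class_energy b a L g \<le> Cg * (real b ^ L / real g * (1 - \<delta>) ^ (L - J))"
    using class_energy_le[OF b] by metis
  obtain c4 A where c4: "c4 > 0" "c4 \<le> c / 8" and A: "A \<ge> 0"
    and par: "\<And>q l. q \<ge> (2 :: nat) \<Longrightarrow> l \<ge> (4 :: nat) \<Longrightarrow> \<exists>\<rho>. \<forall>\<mu>. l div 4 < \<mu> \<longrightarrow> \<mu> \<le> l div 2 + 1 \<longrightarrow>
      \<mu> + 2 * \<rho> \<le> l \<and> 1 / real b ^ \<rho> \<le> real b * exp (- (c4 * (real l / ln (real q)))) \<and>
      real b ^ (4 * \<rho>) * (Cg * (1 - \<delta>) ^ (\<mu> + 2 * \<rho> - (\<mu> + 2 * \<rho>) div 2)
          + real b ^ \<rho> * (3 * exp (- (c / ln (real q) * real ((\<mu> + 2 * \<rho>) div 2))))\<^sup>2)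
        \<le> A * exp (- (c4 * (real l / ln (real q))))"
    using typeII_parameters[OF b c \<delta> Cg] by metis
  define A1 where "A1 = 3 + 4 * ln (real b)"
  define A2 where "A2 = (1 + 4 * real b) * real b + real b * A * A1 * (real b + 1) ^ b"
  define A3 where "A3 = 3 * A1\<^sup>2 * (real b)\<^sup>2 + 2 * A1 * (A2 + 1) * real b"
  have lnb: "ln (real b) > 0" using b by simp
  have A1: "A1 \<ge> 0" using lnb by (simp add: A1_def)
  have A2: "A2 \<ge> 0" using A A1 by (simp add: A2_def)
  have A3: "A3 \<ge> 0" using A1 A2 by (simp add: A3_def)
  show ?thesis
  proof (rule that[of "c4 / 2" A3])
    show "c4 / 2 > 0" using c4 by simp
    show "A3 \<ge> 0" by fact
    fix q h l X1 :: nat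
    assume q: "q \<ge> 2" and h: "\<And>e. \<not> q dvd h * (b\<^sup>2 - 1) * b ^ e" and l: "l \<ge> 4" and X1: "X1 \<le> b ^ l"
    define Y where "Y = real l / ln (real q)"
    define x where "x = exp (- (c4 / 2 * Y))"
    define \<tau> where "\<tau> = c / ln (real q)"
    define a where "a = reversal_phase b l (real h / real q)"
    define \<kappa> where "\<kappa> = l div 4"
    define X0 where "X0 = b ^ (l - 1)"
    have lnq: "ln (real q) > 0" using q by simp
    have Y: "Y \<ge> 0" using lnq by (simp add: Y_def)
    have \<tau>: "\<tau> \<ge> 0" using c lnq by (simp add: \<tau>_def)
    have x: "x > 0" "exp (- (c4 * Y)) = x\<^sup>2"
      by (simp_all add: x_def power2_eq_square flip: exp_add)
    have l1: "real l \<ge> 1" using l by simp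
    have logs: "3 + 2 * ln (real b ^ n) \<le> A1 * real l" "1 + ln (real b ^ n) \<le> A1 * real l" if "n \<le> l + 1" for n
    proof -
      have "real n * ln (real b) \<le> (2 * real l) * ln (real b)"
        using that l lnb by (intro mult_right_mono) auto
      moreover have "0 \<le> real n * ln (real b)" using lnb by simp
      moreover have e: "ln (real b ^ n) = real n * ln (real b)" using b by (simp add: ln_realpow)
      moreover have "A1 * real l = 3 * real l + 2 * ((2 * real l) * ln (real b))"
        by (simp add: A1_def algebra_simps)
      ultimately show "3 + 2 * ln (real b ^ n) \<le> A1 * real l" "1 + ln (real b ^ n) \<le> A1 * real l"
        using l1 by linarith+
    qed
    have E: "norm (digital_transform b (\<lambda>i. a (k + i)) L \<theta>) \<le> 3 * exp (- (\<tau> * real L))" if "k + L \<le> l" for k L \<theta>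
      using decay[OF q h that, of \<theta>] by (simp add: a_def \<tau>_def)
    obtain \<rho> where \<rho>: "\<And>\<mu>. l div 4 < \<mu> \<Longrightarrow> \<mu> \<le> l div 2 + 1 \<Longrightarrow>
      \<mu> + 2 * \<rho> \<le> l \<and> 1 / real b ^ \<rho> \<le> real b * x\<^sup>2 \<and>
      real b ^ (4 * \<rho>) * (Cg * (1 - \<delta>) ^ (\<mu> + 2 * \<rho> - (\<mu> + 2 * \<rho>) div 2)
          + real b ^ \<rho> * (3 * exp (- (\<tau> * real ((\<mu> + 2 * \<rho>) div 2))))\<^sup>2) \<le> A * x\<^sup>2"
      using par[OF q l] unfolding Y_def[symmetric] x(2) \<tau>_def[symmetric] by blast
    (* W is chosen so that its square dominates the bilinear bound without a square root of constants. *)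
  define W where "W = real b ^ (l + 1) * (2 * (A2 + 1)) * real l ^ (b + 1) * x"
    have W: "W \<ge> 0" unfolding W_def using A2 x by simp
    have blk: "norm (\<Sum>m\<in>{b ^ (\<mu> - 1)..<b ^ \<mu>}. \<Sum>k<b ^ (l + 1 - \<mu>).
        of_int (cut_coefficient (b ^ \<kappa>) m) * of_bool (1 < k \<and> least_prime m \<le> least_prime k) *
        of_bool (X0 \<le> m * k \<and> m * k < X1) * of_bool (coprime (m * k) b) * digital_char b a l (m * k)) \<le> (A1 * real l) * W"
      if \<mu>: "\<mu> \<in> {1..l div 2 + 1}" for \<mu>
    proof (cases "\<mu> \<le> \<kappa>")
      case True
      have "b ^ \<mu> \<le> b ^ \<kappa>" using b True by (intro power_increasing) auto
      then have "cut_coefficient (b ^ \<kappa>) m = 0" if "m \<in> {b ^ (\<mu> - 1)..<b ^ \<mu>}" for m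
        using that by (simp add: cut_coefficient_def)
      then have "(\<Sum>m\<in>{b ^ (\<mu> - 1)..<b ^ \<mu>}. \<Sum>k<b ^ (l + 1 - \<mu>).
        of_int (cut_coefficient (b ^ \<kappa>) m) * of_bool (1 < k \<and> least_prime m \<le> least_prime k) *
        of_bool (X0 \<le> m * k \<and> m * k < X1) * of_bool (coprime (m * k) b) * digital_char b a l (m * k)) = 0"
        by (intro sum.neutral ballI) (simp only: of_int_0 mult_zero_left)
      then show ?thesis using A1 W l1 by (simp only: norm_zero) (intro mult_nonneg_nonneg, auto)
    next
      case False
      define L J where "L = \<mu> + 2 * \<rho>" and "J = L div 2"
      define Dg where "Dg = Cg * (1 - \<delta>) ^ (L - J)"
      define \<Omega> where "\<Omega> = Dg + real b ^ \<rho> * (3 * exp (- (\<tau> * real J)))\<^sup>2"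
      have p: "L \<le> l" "1 / real b ^ \<rho> \<le> real b * x\<^sup>2" "real b ^ (4 * \<rho>) * \<Omega> \<le> A * x\<^sup>2"
        using \<rho>[of \<mu>] False \<mu> by (auto simp: L_def J_def \<Omega>_def Dg_def \<kappa>_def)
      have JL: "J \<le> L" by (simp add: J_def)
      have \<mu>2: "\<mu> \<ge> 1" "2 * \<mu> \<le> l + 2" using \<mu> by auto
      have Dg0: "Dg \<ge> 0" using \<delta> Cg by (simp add: Dg_def)
      have \<Omega>0: "Dg \<le> \<Omega>" "real b ^ \<rho> * (3 * exp (- (\<tau> * real J)))\<^sup>2 \<le> \<Omega>" "\<Omega> \<ge> 0"
        using Dg0 by (auto simp: \<Omega>_def)
      have gap': "class_energy b a L g \<le> real b ^ L / real g * Dg" if "g dvd b ^ L" "\<not> b ^ J dvd g" for g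
        using gap[OF that JL, of a] by (simp add: Dg_def mult_ac)
      have EJ: "norm (digital_transform b (\<lambda>i. a (L - J + i)) J \<theta>) \<le> 3 * exp (- (\<tau> * real J))" for \<theta>
        using JL p(1) by (intro E) simp
      define card_div where "card_div = real (card {g. g dvd b ^ L})"
      have cd: "card_div \<le> (real b + 1) ^ b * real l ^ b"
      proof -
        have "b * L \<le> b * l" using p(1) by (rule mult_le_mono2)
        then have "b * L + 1 \<le> (b + 1) * l" using l unfolding add_mult_distrib mult_1 by linarith
        then have "(b * L + 1) ^ b \<le> ((b + 1) * l) ^ b" by (rule power_mono) simp
        then have "card {g. g dvd b ^ L} \<le> ((b + 1) * l) ^ b"
          using card_divisors_power_le[OF b, of L] by linarith
        then have "card_div \<le> real (((b + 1) * l) ^ b)" unfolding card_div_def by (simp only: of_nat_le_iff)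
        then show ?thesis by (simp only: of_nat_power of_nat_mult of_nat_add of_nat_1 power_mult_distrib)
      qed
      have Z: "(1 + 4 * real b) / real b ^ \<rho> + real b ^ (4 * \<rho> + 1) * (3 + 2 * ln (real b ^ L)) * card_div * \<Omega>
          \<le> A2 * real l ^ (b + 1) * x\<^sup>2"
      proof -
        have "(1 + 4 * real b) / real b ^ \<rho> \<le> (1 + 4 * real b) * (real b * x\<^sup>2)"
          using mult_left_mono[OF p(2), of "1 + 4 * real b"] by simp
        also have "\<dots> \<le> (1 + 4 * real b) * real b * x\<^sup>2 * real l ^ (b + 1)"
        proof -
          have "(1 + 4 * real b) * real b * x\<^sup>2 * 1 \<le> (1 + 4 * real b) * real b * x\<^sup>2 * real l ^ (b + 1)"
            by (rule mult_left_mono[OF one_le_power[OF l1]]) simp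
          then show ?thesis by (simp only: mult_1_right mult.assoc)
        qed
        finally have 1: "(1 + 4 * real b) / real b ^ \<rho> \<le> (1 + 4 * real b) * real b * x\<^sup>2 * real l ^ (b + 1)" .
        have ln0: "3 + 2 * ln (real b ^ L) \<ge> 0" using b by simp
        have "real b ^ (4 * \<rho> + 1) * (3 + 2 * ln (real b ^ L)) * card_div * \<Omega>
            = real b * (3 + 2 * ln (real b ^ L)) * card_div * (real b ^ (4 * \<rho>) * \<Omega>)"
          by simp
        also have "\<dots> \<le> real b * (A1 * real l) * ((real b + 1) ^ b * real l ^ b) * (A * x\<^sup>2)"
        proof -
          have "real b * (3 + 2 * ln (real b ^ L)) * card_div * v \<le> real b * (A1 * real l) * ((real b + 1) ^ b * real l ^ b) * v'"
            if "v \<le> v'" "0 \<le> v" for v v'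
            using that logs(1)[of L] p(1) cd ln0 A1 by (intro mult_mono) (auto simp: card_div_def)
          then show ?thesis using p(3) \<Omega>0(3) by simp
        qed
        also have "\<dots> = real b * A * A1 * (real b + 1) ^ b * x\<^sup>2 * real l ^ (b + 1)" by simp
        finally have 2: "real b ^ (4 * \<rho> + 1) * (3 + 2 * ln (real b ^ L)) * card_div * \<Omega>
            \<le> real b * A * A1 * (real b + 1) ^ b * x\<^sup>2 * real l ^ (b + 1)" .
        have "(1 + 4 * real b) * real b * x\<^sup>2 * real l ^ (b + 1) + real b * A * A1 * (real b + 1) ^ b * x\<^sup>2 * real l ^ (b + 1)
            = A2 * real l ^ (b + 1) * x\<^sup>2"
          by (simp add: A2_def algebra_simps)
        then show ?thesis using 1 2 by linarith
      qed
      have le: "2 * (real b ^ (l + 1))\<^sup>2 * (A2 * real l ^ (b + 1) * x\<^sup>2) \<le> W\<^sup>2"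
      proof -
        have "2 * A2 * real l ^ (b + 1) \<le> (2 * (A2 + 1))\<^sup>2 * (real l ^ (b + 1))\<^sup>2"
        proof (rule mult_mono)
          show "2 * A2 \<le> (2 * (A2 + 1))\<^sup>2" using A2 by (simp add: power2_eq_square algebra_simps)
          show "real l ^ (b + 1) \<le> (real l ^ (b + 1))\<^sup>2"
            using l1 by (intro self_le_power one_le_power) auto
        qed (use l1 in auto)
        then have "(real b ^ (l + 1))\<^sup>2 * x\<^sup>2 * (2 * A2 * real l ^ (b + 1)) \<le> (real b ^ (l + 1))\<^sup>2 * x\<^sup>2 * ((2 * (A2 + 1))\<^sup>2 * (real l ^ (b + 1))\<^sup>2)"
          by (intro mult_left_mono) auto
        then show ?thesis unfolding W_def power_mult_distrib by (simp only: mult_ac)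
      qed
      have "norm (\<Sum>m\<in>{b ^ (\<mu> - 1)..<b ^ \<mu>}. \<Sum>k<b ^ (l + 1 - \<mu>).
        of_int (cut_coefficient (b ^ \<kappa>) m) * of_bool (1 < k \<and> least_prime m \<le> least_prime k) *
        of_bool (X0 \<le> m * k \<and> m * k < X1) * of_bool (coprime (m * k) b) * digital_char b a l (m * k))
          \<le> (3 + 2 * ln (real b ^ (l + 1))) * W"
      proof (rule norm_block_sum_le[OF b])
        fix u v :: "nat \<Rightarrow> complex"
        assume uv: "\<And>m. norm (u m) \<le> 1" "\<And>k. norm (v k) \<le> 1"
        have "(norm (\<Sum>m\<in>{b ^ (\<mu> - 1)..<b ^ \<mu>}. \<Sum>k<b ^ (l + 1 - \<mu>). u m * v k * of_bool (X0 \<le> m * k \<and> m * k < X1) * digital_char b a l (m * k)))\<^sup>2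
           \<le> 2 * (real b ^ (l + 1))\<^sup>2 * ((1 + 4 * real b) / real b ^ \<rho> + real b ^ (4 * \<rho> + 1) * (3 + 2 * ln (real b ^ L)) * card_div * \<Omega>)"
          unfolding card_div_def L_def
          by (rule bilinear_sum_le[OF b \<mu>2 p(1)[unfolded L_def] JL[unfolded L_def] gap'[unfolded L_def] EJ[unfolded L_def] \<Omega>0(1,2) uv])
        also have "\<dots> \<le> 2 * (real b ^ (l + 1))\<^sup>2 * (A2 * real l ^ (b + 1) * x\<^sup>2)"
          using Z by (intro mult_left_mono) auto
        also have "\<dots> \<le> W\<^sup>2" by (rule le)
        finally show "norm (\<Sum>m\<in>{b ^ (\<mu> - 1)..<b ^ \<mu>}. \<Sum>k<b ^ (l + 1 - \<mu>). u m * v k * of_bool (X0 \<le> m * k \<and> m * k < X1) * digital_char b a l (m * k)) \<le> W"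
          using W by (rule power2_le_imp_le)
      qed (use \<mu> b in \<open>auto simp: Suc_leI\<close>)
      also have "\<dots> \<le> (A1 * real l) * W" using logs(1)[of "l + 1"] W by (intro mult_right_mono) auto
      finally show ?thesis .
    qed
    define S1 where "S1 = (\<Sum>d\<in>{1..b ^ \<kappa>}. of_int (moebius d) * (\<Sum>n\<in>{X0..<X1}. of_bool (d dvd n) * of_bool (coprime n b) * digital_char b a l n))"
    define S2 where "S2 = (\<Sum>\<mu>=1..l div 2 + 1. \<Sum>m\<in>{b ^ (\<mu> - 1)..<b ^ \<mu>}. \<Sum>k<b ^ (l + 1 - \<mu>).
        of_int (cut_coefficient (b ^ \<kappa>) m) * of_bool (1 < k \<and> least_prime m \<le> least_prime k) *
        of_bool (X0 \<le> m * k \<and> m * k < X1) * of_bool (coprime (m * k) b) * digital_char b a l (m * k))"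
    have \<kappa>4: "2 * \<kappa> < l - 1" "4 * \<kappa> \<le> l" using l by (auto simp: \<kappa>_def)
    have S: "(\<Sum>n\<in>{X0..<X1}. of_bool (prime n) * of_bool (coprime n b) * digital_char b a l n) = S1 + S2"
      unfolding S1_def S2_def X0_def by (rule sum_primes_decomposition[OF b \<kappa>4 X1])
    have "norm S1 \<le> (1 + ln (real b ^ \<kappa>)) * ((3 + 2 * ln (real b ^ l)) * ((real b)\<^sup>2 * real b ^ l * (3 * exp (- (\<tau> * real l / 2)))))"
      unfolding S1_def by (rule norm_sum_small_divisors_le[OF b \<kappa>4(2) X1 \<tau> E])
    also have "\<dots> \<le> (A1 * real l) * ((A1 * real l) * ((real b)\<^sup>2 * real b ^ l * (3 * x)))"
    proof -
      have "c4 / 2 * Y \<le> c / 2 * Y" using c4 c Y by (intro mult_right_mono) auto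
      then have "exp (- (\<tau> * real l / 2)) \<le> x" by (simp add: x_def \<tau>_def Y_def)
      moreover have "\<kappa> \<le> l + 1" using \<kappa>4 by simp
      moreover have "ln (real b ^ l) \<ge> 0" using b by simp
      ultimately show ?thesis
        using logs(1)[of l] logs(2)[of \<kappa>] A1 x by (intro mult_mono) auto
    qed
    finally have N1: "norm S1 \<le> 3 * A1\<^sup>2 * (real b)\<^sup>2 * (real l)\<^sup>2 * (real b ^ l * x)"
      by (simp add: power2_eq_square mult_ac)
    have "norm S2 \<le> (\<Sum>\<mu>=1..l div 2 + 1. (A1 * real l) * W)"
      unfolding S2_def by (intro sum_norm_le blk)
    also have "\<dots> = real (l div 2 + 1) * ((A1 * real l) * W)" by simp
    also have "\<dots> \<le> real l * ((A1 * real l) * W)"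
      using l A1 W by (intro mult_right_mono mult_nonneg_nonneg) auto
    also have "\<dots> = 2 * A1 * (A2 + 1) * real b * real l ^ (b + 3) * (real b ^ l * x)"
      by (simp add: W_def power_add eval_nat_numeral)
    finally have N2: "norm S2 \<le> 2 * A1 * (A2 + 1) * real b * real l ^ (b + 3) * (real b ^ l * x)" .
    have "3 * A1\<^sup>2 * (real b)\<^sup>2 * (real l)\<^sup>2 * (real b ^ l * x) \<le> 3 * A1\<^sup>2 * (real b)\<^sup>2 * real l ^ (b + 3) * (real b ^ l * x)"
      using l1 x by (intro mult_right_mono mult_left_mono power_increasing) auto
    moreover have "3 * A1\<^sup>2 * (real b)\<^sup>2 * real l ^ (b + 3) * (real b ^ l * x) + 2 * A1 * (A2 + 1) * real b * real l ^ (b + 3) * (real b ^ l * x)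
        = A3 * real l ^ (b + 3) * real b ^ l * x"
      by (simp add: A3_def algebra_simps)
    ultimately have "norm (S1 + S2) \<le> A3 * real l ^ (b + 3) * real b ^ l * x"
      using N1 N2 norm_triangle_ineq[of S1 S2] by linarith
    then show "norm (\<Sum>n\<in>{b ^ (l - 1)..<X1}. of_bool (prime n) * of_bool (coprime n b) * ee (real h / real q * real (digit_reverse b l n)))
        \<le> A3 * real l ^ (b + 3) * real b ^ l * exp (- (c4 / 2 * (real l / ln (real q))))"
      unfolding S[symmetric] a_def digital_char_reversal X0_def x_def Y_def .
  qed
qed

section \<open>Detecting residue classes of the reversal\<close>

lemma card_residue_eq_exponential_sum:
  assumes "finite P" "q > 0"
  shows "of_nat (card {p \<in> P. [int (R p) = a] (mod int q)})
    = (\<Sum>h<q. ee (- (real h * of_int a / real q)) * (\<Sum>p\<in>P. ee (real h / real q * real (R p)))) / of_nat q"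
proof -
  have "of_nat (card {p \<in> P. [int (R p) = a] (mod int q)}) = (\<Sum>p\<in>P. of_bool ([int (R p) = a] (mod int q)) :: complex)"
    by (subst card_filter_eq_sum[OF assms(1)]) (simp only: of_nat_sum of_nat_of_bool)
  also have "\<dots> = (\<Sum>p\<in>P. (\<Sum>h<q. ee (real h * of_int (int (R p) - a) / real q)) / of_nat q)"
    using assms(2) by (intro sum.cong refl) (simp only: sum_ee_orthogonality cong_iff_dvd_diff, simp)
  also have "\<dots> = (\<Sum>h<q. \<Sum>p\<in>P. ee (real h * of_int (int (R p) - a) / real q)) / of_nat q"
    unfolding sum_divide_distrib[symmetric] by (subst sum.swap) (rule refl)
  also have "\<dots> = (\<Sum>h<q. ee (- (real h * of_int a / real q)) * (\<Sum>p\<in>P. ee (real h / real q * real (R p)))) / of_nat q"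
  proof -
    have "ee (real h * of_int (int (R p) - a) / real q) = ee (- (real h * of_int a / real q)) * ee (real h / real q * real (R p))" for h p
      unfolding ee_add[symmetric] by (rule arg_cong[of _ _ ee]) (simp add: right_diff_distrib diff_divide_distrib)
    then show ?thesis by (simp only: sum_distrib_left)
  qed
  finally show ?thesis .
qed

text \<open>The frequencies divisible by \<open>e\<close> reproduce the count modulo \<open>m\<close> exactly; only the others
  contribute to the error.\<close>

lemma card_residue_difference_le:
  assumes "finite P" "e > 0" "m > 0"
    and B: "\<And>h. h < e * m \<Longrightarrow> \<not> e dvd h \<Longrightarrow> norm (\<Sum>p\<in>P. ee (real h / real (e * m) * real (R p))) \<le> B" and "B \<ge> 0"
  shows "\<bar>real (card {p \<in> P. [int (R p) = a] (mod int (e * m))})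
      - real m / real (e * m) * real (card {p \<in> P. [int (R p) = a] (mod int m)})\<bar> \<le> B"
proof -
  define q where "q = e * m"
  have q: "q > 0" using assms by (simp add: q_def)
  define G where "G h = ee (- (real h * of_int a / real q)) * (\<Sum>p\<in>P. ee (real h / real q * real (R p)))" for h
  define N where "N d = real (card {p \<in> P. [int (R p) = a] (mod int d)})" for d
  have Nq: "complex_of_real (N q) = (\<Sum>h<q. G h) / of_nat q"
    using card_residue_eq_exponential_sum[OF assms(1) q, of R a] by (simp add: N_def G_def)
  have Gem: "G (e * h) = ee (- (real h * of_int a / real m)) * (\<Sum>p\<in>P. ee (real h / real m * real (R p)))" for h
    using assms by (simp add: G_def q_def)
  have Nm: "complex_of_real (N m) = (\<Sum>h<m. G (e * h)) / of_nat m"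
    using card_residue_eq_exponential_sum[OF assms(1,3), of R a] by (simp add: N_def Gem)
  have img: "(\<Sum>h<m. G (e * h)) = (\<Sum>h | h < q \<and> e dvd h. G h)"
    using assms by (intro sum.reindex_bij_witness[of _ "\<lambda>h. h div e" "\<lambda>h. e * h"]) (auto simp: q_def elim!: dvdE)
  have "(\<Sum>h<q. G h) = (\<Sum>h | h < q \<and> e dvd h. G h) + (\<Sum>h | h < q \<and> \<not> e dvd h. G h)"
  proof -
    have "{..<q} = {h. h < q \<and> e dvd h} \<union> {h. h < q \<and> \<not> e dvd h}" by auto
    then show ?thesis by (simp only:) (intro sum.union_disjoint, auto)
  qed
  then have "complex_of_real (N q - real m / real q * N m) = (\<Sum>h | h < q \<and> \<not> e dvd h. G h) / of_nat q"
    using assms q by (simp add: Nq Nm img add_divide_distrib)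
  then have "\<bar>N q - real m / real q * N m\<bar> = norm (\<Sum>h | h < q \<and> \<not> e dvd h. G h) / real q"
    by (metis norm_divide norm_of_nat norm_of_real)
  also have "norm (\<Sum>h | h < q \<and> \<not> e dvd h. G h) \<le> (\<Sum>h | h < q \<and> \<not> e dvd h. B)"
    using B by (intro sum_norm_le) (simp add: G_def norm_mult q_def)
  then have "norm (\<Sum>h | h < q \<and> \<not> e dvd h. G h) / real q \<le> (\<Sum>h | h < q \<and> \<not> e dvd h. B) / real q"
    by (rule divide_right_mono) simp
  also have "\<dots> \<le> (real q * B) / real q"
  proof -
    have "card {h. h < q \<and> \<not> e dvd h} \<le> card {..<q}" by (intro card_mono) auto
    then show ?thesis using assms(5) by (intro divide_right_mono) (auto intro: mult_right_mono)
  qed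
  also have "\<dots> = B" using q by simp
  finally show ?thesis by (simp only: N_def q_def)
qed

text \<open>\<open>B\<close> is the largest divisor of \<open>q\<close> composed of primes dividing \<open>b\<close>.\<close>

lemma base_part_properties:
  fixes b q :: nat
  assumes "b \<ge> 1" "q \<ge> 1"
  defines "B \<equiv> (\<Prod>p | prime p \<and> p dvd b. p ^ multiplicity p q)"
  shows "B dvd q" "coprime (q div B) b" "coprime B (b\<^sup>2 - 1)"
proof -
  define S where "S = {p. prime p \<and> p dvd b}"
  have fin: "finite S"
    by (rule finite_subset[of _ "{..b}"]) (use assms in \<open>auto simp: S_def dest: dvd_imp_le\<close>)
  have mult: "multiplicity p B = (if p \<in> S then multiplicity p q else 0)" if "prime p" for p
    unfolding B_def S_def[symmetric] using that
    by (intro multiplicity_prod_prime_powers fin) (auto simp: S_def)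
  have B0: "B > 0" unfolding B_def by (intro prod_pos) (auto simp: prime_gt_0_nat)
  show dvd: "B dvd q"
    by (rule multiplicity_le_imp_dvd) (use B0 mult in auto)
  have no: "\<not> p dvd q div B" if p: "prime p" "p dvd b" for p
  proof
    assume "p dvd q div B"
    then have "p * B dvd q" using dvd by (simp add: dvd_div_iff_mult B0 mult.commute)
    then have "multiplicity p (p * B) \<le> multiplicity p q"
      using assms by (intro dvd_imp_multiplicity_le) auto
    also have "multiplicity p (p * B) = Suc (multiplicity p B)"
      using p(1) B0 by (intro multiplicity_times_same) auto
    finally show False using mult[OF p(1)] p by (simp add: S_def)
  qed
  have "gcd (q div B) b = 1"
  proof (rule ccontr)
    assume "gcd (q div B) b \<noteq> 1"
    then obtain p where "prime p" "p dvd gcd (q div B) b" using prime_factor_nat by blast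
    then show False using no[of p] by simp
  qed
  then show "coprime (q div B) b" by (rule gcd_eq_1_imp_coprime)
  have "coprime b (b\<^sup>2 - 1)"
  proof -
    have "b\<^sup>2 = Suc (b\<^sup>2 - 1)" using assms by simp
    then have "coprime (b\<^sup>2) (b\<^sup>2 - 1)" by (metis coprime_Suc_left_nat)
    then show ?thesis by simp
  qed
  then show "coprime B (b\<^sup>2 - 1)"
    unfolding B_def by (intro prod_coprime_left coprime_power_left_iff[THEN iffD2] disjI1)
       (auto intro: coprime_divisors[of _ b "b\<^sup>2 - 1" "b\<^sup>2 - 1"])
qed

lemma Pi_mod_dvd:
  assumes "b \<ge> 1" "q \<ge> 1"
  shows "Pi_mod b q dvd q"
proof -
  note * = base_part_properties[OF assms]
  have "coprime (gcd q (b\<^sup>2 - 1)) (\<Prod>p | prime p \<and> p dvd b. p ^ multiplicity p q)"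
    using *(3) by (metis coprime_commute coprime_divisors dvd_refl gcd_dvd2)
  then show ?thesis unfolding Pi_mod_def using *(1) by (intro divides_mult) auto
qed

text \<open>Write \<open>q = B * q2\<close> with \<open>q2\<close> coprime to \<open>b\<close>. Then \<open>q2\<close> divides \<open>h (b\<^sup>2 - 1)\<close>, and removing the
  common part of \<open>q2\<close> and \<open>b\<^sup>2 - 1\<close> leaves exactly \<open>q div Pi_mod b q\<close>. So the frequencies without
  cancellation are those that see only the class modulo \<open>Pi_mod b q\<close>.\<close>

lemma dvd_of_degenerate_frequency:
  assumes "b \<ge> 1" "q \<ge> 1" "q dvd h * (b\<^sup>2 - 1) * b ^ i"
  shows "q div Pi_mod b q dvd h"
proof -
  define B where "B = (\<Prod>p | prime p \<and> p dvd b. p ^ multiplicity p q)"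
  note * = base_part_properties[OF assms(1,2), folded B_def]
  define q2 where "q2 = q div B"
  define g where "g = gcd q (b\<^sup>2 - 1)"
  have q: "q = B * q2" using *(1) by (simp add: q2_def)
  have g: "g > 0" using assms by (simp add: g_def)
  have "q2 dvd h * (b\<^sup>2 - 1) * b ^ i" using assms(3) q by (metis dvd_mult_right)
  moreover have "coprime q2 (b ^ i)" using *(2) by (simp add: q2_def)
  ultimately have d: "q2 dvd h * (b\<^sup>2 - 1)" by (simp add: coprime_dvd_mult_left_iff)
  have "coprime B g" using *(3) by (metis coprime_divisors dvd_refl g_def gcd_dvd2)
  moreover have "g dvd B * q2" using q by (simp add: g_def)
  ultimately have gq: "g dvd q2" by (simp add: coprime_dvd_mult_right_iff coprime_commute)
  have gb: "g dvd b\<^sup>2 - 1" by (simp add: g_def)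
  have gcd: "gcd q2 (b\<^sup>2 - 1) = g"
  proof (rule dvd_antisym)
    show "gcd q2 (b\<^sup>2 - 1) dvd g" unfolding g_def using q by (intro gcd_greatest) (auto intro: dvd_trans)
    show "g dvd gcd q2 (b\<^sup>2 - 1)" using gq gb by simp
  qed
  obtain u where u: "q2 = g * u" using gq by (elim dvdE)
  obtain v where v: "b\<^sup>2 - 1 = g * v" using gb by (elim dvdE)
  have "g * gcd u v = gcd q2 (b\<^sup>2 - 1)" unfolding u v by (rule gcd_mult_distrib_nat)
  then have "g * gcd u v = g * 1" using gcd by simp
  then have "coprime u v" using g by (metis gcd_eq_1_imp_coprime less_irrefl mult_cancel1)
  moreover have "u dvd h * v"
  proof -
    have "g * u dvd g * (h * v)" using d unfolding u v by (simp only: mult.left_commute)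
    then show ?thesis using g by simp
  qed
  ultimately have "u dvd h" by (simp add: coprime_dvd_mult_left_iff)
  moreover have "q div Pi_mod b q = u"
  proof -
    have "Pi_mod b q = g * B" by (simp add: Pi_mod_def g_def B_def)
    moreover have "q = (g * B) * u" using q u by (simp add: mult_ac)
    moreover have "g * B > 0" using g q assms(2) by (metis gr0I mult_eq_0_iff not_one_le_zero)
    ultimately show ?thesis by (metis nonzero_mult_div_cancel_left less_irrefl)
  qed
  ultimately show ?thesis by simp
qed

lemma Pi_mod_eq_1:
  assumes "coprime q (b * (b\<^sup>2 - 1))"
  shows "Pi_mod b q = 1"
proof -
  have "multiplicity p q = 0" if "prime p" "p dvd b" for p
  proof (rule not_dvd_imp_multiplicity_0)
    show "\<not> p dvd q" using assms that by (metis coprime_common_divisor coprime_mult_right_iff not_prime_unit)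
  qed
  then have "(\<Prod>p | prime p \<and> p dvd b. p ^ multiplicity p q) = 1" by (intro prod.neutral) simp
  moreover have "gcd q (b\<^sup>2 - 1) = 1" using assms by (simp add: coprime_mult_right_iff)
  ultimately show ?thesis by (simp add: Pi_mod_def)
qed

section \<open>Reversed primes in residue classes\<close>

theorem theorem1p4:
  fixes b :: nat
  assumes "b \<ge> 2"
  shows "\<exists>c :: real. c > 0 \<and> (\<exists>C :: real. \<forall>(a :: int) (d :: nat) (l :: nat).
    l \<ge> 2 \<longrightarrow> 2 \<le> d \<longrightarrow> real d \<le> exp (c * real l / ln (real l)) \<longrightarrow>
    (\<forall>t :: real. t \<in> {real b ^ (l - 1) .. real b ^ l} \<longrightarrow>
       \<bar>real (reverse_prime_count b l t a d)
          - real (Pi_mod b d) / real d * real (reverse_prime_count b l t a (Pi_mod b d))\<bar>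
         \<le> C * (real b ^ l * exp (- (c * real l / ln (real d)))) \<and>
       (coprime d (b * (b\<^sup>2 - 1)) \<longrightarrow>
         \<bar>real (reverse_prime_count b l t a d) - real (prime_count b l t) / real d\<bar>
           \<le> C * (real b ^ l * exp (- (c * real l / ln (real d)))))))"
proof (rule norm_sum_primes_reversal_le[OF assms])
  fix c5 A :: real
  assume c5: "c5 > 0" and A: "A \<ge> 0"
    and main: "\<And>q h l X1. q \<ge> 2 \<Longrightarrow> (\<And>e. \<not> q dvd h * (b\<^sup>2 - 1) * b ^ e) \<Longrightarrow> l \<ge> 4 \<Longrightarrow> X1 \<le> b ^ l \<Longrightarrow>
      norm (\<Sum>n\<in>{b ^ (l - 1)..<X1}. of_bool (prime n) * of_bool (coprime n b) * ee (real h / real q * real (digit_reverse b l n)))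
        \<le> A * real l ^ (b + 3) * real b ^ l * exp (- (c5 * (real l / ln (real q))))"
  define K where "K = b + 3"
  (* The factor K + 1 reserves room in the exponent for the power l^K. *)
  define c where "c = min (c5 / (real K + 1)) (ln 2 * ln (real b))"
  define C where "C = A + real b + real b ^ 3"
  have lnb: "ln (real b) > 0" using assms by simp
  have c: "c > 0" "(real K + 1) * c \<le> c5" "c \<le> ln 2 * ln (real b)"
  proof -
    show "c > 0" using c5 lnb by (simp add: c_def)
    have "(real K + 1) * c \<le> (real K + 1) * (c5 / (real K + 1))"
      unfolding c_def by (intro mult_left_mono) auto
    also have "\<dots> = c5" by (simp add: add_nonneg_eq_0_iff)
    finally show "(real K + 1) * c \<le> c5" .
    show "c \<le> ln 2 * ln (real b)" by (simp add: c_def)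
  qed
  have bound: "\<bar>real (reverse_prime_count b l t a d) - real (Pi_mod b d) / real d * real (reverse_prime_count b l t a (Pi_mod b d))\<bar>
      \<le> C * (real b ^ l * exp (- (c * real l / ln (real d))))"
    if l: "l \<ge> 2" and d: "2 \<le> d" "real d \<le> exp (c * real l / ln (real l))"
      and t: "t \<in> {real b ^ (l - 1)..real b ^ l}" for a d l t
  proof -
    define Y where "Y = real l / ln (real d)"
    define err where "err = real b ^ l * exp (- (c * Y))"
    define X1 where "X1 = nat \<lceil>t\<rceil>"
    define P where "P = {p. prime p \<and> b ^ (l - 1) \<le> p \<and> p < X1}"
    have lnd: "ln (real d) > 0" "ln (real d) \<ge> ln 2" using d by auto
    have lt: "real p < t \<longleftrightarrow> p < X1" for p
      unfolding X1_def by linarith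
    have X1: "X1 \<le> b ^ l"
    proof -
      have "t \<le> of_int (int (b ^ l))" using t by simp
      then have "\<lceil>t\<rceil> \<le> int (b ^ l)" by (rule ceiling_le)
      then show ?thesis by (simp add: X1_def nat_le_iff)
    qed
    have finP: "finite P" by (simp add: P_def)
    have count: "reverse_prime_count b l t a m = card {p \<in> P. [int (digit_reverse b l p) = a] (mod int m)}" for m
      unfolding reverse_prime_count_def P_def lt by (rule arg_cong[of _ _ card]) auto
    have Pi: "Pi_mod b d dvd d" using Pi_mod_dvd[of b d] assms d by simp
    define e where "e = d div Pi_mod b d"
    have de: "d = e * Pi_mod b d" using Pi by (simp add: e_def)
    have pos: "e > 0" "Pi_mod b d > 0"
      using de d(1) by (metis gr0I mult_0 not_numeral_le_zero, metis gr0I mult_0_right not_numeral_le_zero)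
    (* The choice c \<le> ln 2 * ln b keeps the error term above 1, so bounded quantities are harmless. *)
    have err1: "err \<ge> 1"
    proof -
      have "c * Y \<le> real l * ln (real b)"
      proof -
        have "c * real l \<le> (ln 2 * ln (real b)) * real l" using c by (intro mult_right_mono) auto
        also have "\<dots> \<le> (ln (real d) * ln (real b)) * real l"
          using lnd lnb by (intro mult_right_mono) auto
        finally have "c * real l / ln (real d) \<le> (ln (real d) * ln (real b)) * real l / ln (real d)"
          using lnd by (intro divide_right_mono) auto
        then show ?thesis using lnd(1) unfolding Y_def by (simp add: mult_ac)
      qed
      then have "exp (- (real l * ln (real b))) \<le> exp (- (c * Y))" by simp
      moreover have "real b ^ l = exp (real l * ln (real b))"
        using assms by (simp add: exp_of_nat_mult)
      ultimately have "real b ^ l * exp (- (real l * ln (real b))) \<le> err"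
        unfolding err_def by (intro mult_left_mono) auto
      then show ?thesis using \<open>real b ^ l = _\<close> by (simp flip: exp_add)
    qed
    have "\<bar>real (reverse_prime_count b l t a d) - real (Pi_mod b d) / real d * real (reverse_prime_count b l t a (Pi_mod b d))\<bar> \<le> C * err"
    proof (cases "l \<ge> 4")
      case True
      define B where "B = A * real l ^ K * real b ^ l * exp (- (c5 * Y)) + real b"
      have B0: "B \<ge> 0" using A by (simp add: B_def)
      have sum: "norm (\<Sum>p\<in>P. ee (real h / real d * real (digit_reverse b l p))) \<le> B" if h: "h < d" "\<not> e dvd h" for h
      proof -
        define f where "f p = ee (real h / real d * real (digit_reverse b l p))" for p
        have nd: "\<not> d dvd h * (b\<^sup>2 - 1) * b ^ i" for i
          using dvd_of_degenerate_frequency[of b d h i] assms d h(2) by (auto simp: e_def)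
        have P_split: "(\<Sum>p\<in>P. f p) = (\<Sum>p | p \<in> P \<and> coprime p b. f p) + (\<Sum>p | p \<in> P \<and> \<not> coprime p b. f p)"
        proof -
          have "P = {p. p \<in> P \<and> coprime p b} \<union> {p. p \<in> P \<and> \<not> coprime p b}" by auto
          then have "(\<Sum>p\<in>P. f p) = (\<Sum>p\<in>{p. p \<in> P \<and> coprime p b} \<union> {p. p \<in> P \<and> \<not> coprime p b}. f p)" by simp
          also have "\<dots> = (\<Sum>p | p \<in> P \<and> coprime p b. f p) + (\<Sum>p | p \<in> P \<and> \<not> coprime p b. f p)"
            using finP by (intro sum.union_disjoint) auto
          finally show ?thesis .
        qed
        have "(\<Sum>p | p \<in> P \<and> coprime p b. f p) = (\<Sum>n\<in>{b ^ (l - 1)..<X1}. of_bool (prime n) * of_bool (coprime n b) * f n)"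
          by (rule sum.mono_neutral_cong_left) (auto simp: P_def)
        then have 1: "norm (\<Sum>p | p \<in> P \<and> coprime p b. f p) \<le> A * real l ^ K * real b ^ l * exp (- (c5 * Y))"
          unfolding f_def K_def Y_def using main[OF d(1) nd True X1] by (simp only:)
        (* A prime not coprime to b divides b, so there are at most b of them. *)
        have "norm (\<Sum>p | p \<in> P \<and> \<not> coprime p b. f p) \<le> (\<Sum>p | p \<in> P \<and> \<not> coprime p b. 1)"
          by (intro sum_norm_le) (simp add: f_def)
        also have "\<dots> \<le> real b"
        proof -
          have "{p. p \<in> P \<and> \<not> coprime p b} \<subseteq> {1..b}"
          proof
            fix p assume p: "p \<in> {p. p \<in> P \<and> \<not> coprime p b}"
            then have "prime p" "p dvd b" using prime_imp_coprime[of p b] by (auto simp: P_def)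
            then show "p \<in> {1..b}" using assms prime_gt_0_nat[of p] by (auto dest: dvd_imp_le)
          qed
          then have "card {p. p \<in> P \<and> \<not> coprime p b} \<le> card {1..b}" by (intro card_mono) auto
          then show ?thesis by simp
        qed
        finally have 2: "norm (\<Sum>p | p \<in> P \<and> \<not> coprime p b. f p) \<le> real b" .
        show ?thesis
          using 1 2 P_split norm_triangle_ineq[of "\<Sum>p | p \<in> P \<and> coprime p b. f p" "\<Sum>p | p \<in> P \<and> \<not> coprime p b. f p"]
          unfolding B_def f_def by simp
      qed
      have "\<bar>real (card {p \<in> P. [int (digit_reverse b l p) = a] (mod int (e * Pi_mod b d))})
          - real (Pi_mod b d) / real (e * Pi_mod b d) * real (card {p \<in> P. [int (digit_reverse b l p) = a] (mod int (Pi_mod b d))})\<bar> \<le> B"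
        by (rule card_residue_difference_le[OF finP pos _ B0]) (use sum in \<open>simp flip: de\<close>)
      then have "\<bar>real (reverse_prime_count b l t a d) - real (Pi_mod b d) / real d * real (reverse_prime_count b l t a (Pi_mod b d))\<bar> \<le> B"
        unfolding de[symmetric] by (simp only: count)
      also have "B \<le> A * err + real b * err"
      proof -
        (* The range of d makes c * Y at least ln l, so powers of l cost only a constant factor in the exponent. *)
        have "ln (real l) > 0" using True by simp
        have "ln (real d) \<le> c * real l / ln (real l)"
          using d by (metis ln_exp ln_mono exp_gt_zero of_nat_0_less_iff order_less_le_trans zero_less_numeral ln_le_cancel_iff)
        then have "ln (real l) * ln (real d) \<le> c * real l"
          using \<open>ln (real l) > 0\<close> by (simp add: field_simps)
        then have lnl: "ln (real l) \<le> c * Y"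
          using lnd(1) by (simp add: Y_def pos_le_divide_eq)
        have "real l ^ K = exp (real K * ln (real l))" using True by (simp add: exp_of_nat_mult)
        also have "\<dots> \<le> exp (real K * (c * Y))" using lnl by (simp add: mult_left_mono)
        finally have "real l ^ K * exp (- (c5 * Y)) \<le> exp (real K * (c * Y)) * exp (- (c5 * Y))"
          by (intro mult_right_mono) auto
        also have "\<dots> = exp (real K * (c * Y) - c5 * Y)" by (simp flip: exp_add)
        also have "\<dots> \<le> exp (- (c * Y))"
        proof -
          have "(real K + 1) * c * Y \<le> c5 * Y"
            using c lnd(1) by (intro mult_right_mono) (auto simp: Y_def)
          then show ?thesis by (simp add: algebra_simps)
        qed
        finally have "A * real b ^ l * (real l ^ K * exp (- (c5 * Y))) \<le> A * real b ^ l * exp (- (c * Y))"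
          using A by (intro mult_left_mono) auto
        moreover have "real b * 1 \<le> real b * err" using err1 by (intro mult_left_mono) auto
        ultimately show ?thesis by (simp add: B_def err_def mult_ac)
      qed
      also have "\<dots> \<le> C * err" using err1 by (simp add: C_def distrib_right)
      finally show ?thesis .
    next
      case False
      have small: "real (reverse_prime_count b l t a m) \<le> real b ^ 3" for m
      proof -
        have "card {p \<in> P. [int (digit_reverse b l p) = a] (mod int m)} \<le> card {..<X1}"
          by (intro card_mono) (auto simp: P_def)
        also have "\<dots> \<le> b ^ l" using X1 by simp
        also have "\<dots> \<le> b ^ 3" using False assms by (intro power_increasing) auto
        finally have "real (reverse_prime_count b l t a m) \<le> real (b ^ 3)" unfolding count by (simp only: of_nat_le_iff)
        then show ?thesis by simp
      qed
      have "real (Pi_mod b d) / real d \<le> 1" using Pi d by (simp add: dvd_imp_le)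
      then have "real (Pi_mod b d) / real d * real (reverse_prime_count b l t a (Pi_mod b d)) \<le> 1 * real b ^ 3"
        by (intro mult_mono small) auto
      moreover have "0 \<le> real (Pi_mod b d) / real d * real (reverse_prime_count b l t a (Pi_mod b d))" by simp
      ultimately have "\<bar>real (reverse_prime_count b l t a d) - real (Pi_mod b d) / real d * real (reverse_prime_count b l t a (Pi_mod b d))\<bar> \<le> real b ^ 3"
        using small[of d] by linarith
      also have "\<dots> \<le> real b ^ 3 * err" using mult_left_mono[OF err1, of "real b ^ 3"] by simp
      also have "\<dots> \<le> C * err" using A err1 by (simp add: C_def distrib_right)
      finally show ?thesis .
    qed
    then show ?thesis by (simp add: err_def Y_def)
  qed
  have coprime_case: "\<bar>real (reverse_prime_count b l t a d) - real (prime_count b l t) / real d\<bar>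
      \<le> C * (real b ^ l * exp (- (c * real l / ln (real d))))"
    if "l \<ge> 2" "2 \<le> d" "real d \<le> exp (c * real l / ln (real l))" "t \<in> {real b ^ (l - 1)..real b ^ l}"
      "coprime d (b * (b\<^sup>2 - 1))" for a d l t
  proof -
    have "reverse_prime_count b l t a 1 = prime_count b l t"
      by (simp add: reverse_prime_count_def prime_count_def)
    then show ?thesis
      using bound[OF that(1-4), of a] unfolding Pi_mod_eq_1[OF that(5)] by simp
  qed
  show ?thesis
    using c(1) bound coprime_case by blast
qed

end
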